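(* $\mathbf{FPC}\subseteq\mathbf{FP}$: every function computed by a well-typed CorePolyC program is computable by a deterministic Turing machine in time polynomial in the total binary length of its input.
   Context: CorePolyC. Types are $\mathtt{iint},\mathtt{int},\mathtt{bool}$; $\mathsf{Int}=\{\mathtt{iint},\mathtt{int}\}$, ordered by $\mathtt{iint}\preccurlyeq\mathtt{int}$. Values are unbounded integers ($\mathbb Z$) and booleans $\#t,\#f$. Expressions: variables $x$; constants (nonempty decimal digit strings denoting natural numbers; $\mathtt{true}$, $\mathtt{false}$); operator applications $\mathtt{op}(e_1,\dots,e_m)$; parenthesized $(e)$. Operators and semantics: unary $-$ (negation); binary $+,-,/,\%$ (integer addition, subtraction, division, remainder, with division and remainder by $0$ returning $0$); $\mathtt{size}$, with $\mathtt{size}(v)=\lceil\log_2(\mathrm{abs}(v)+1)\rceil$; comparisons $\texttt{>=},\texttt{<=},\texttt{>},\texttt{<},\texttt{==},\texttt{!=}$ on integers returning booleans; boolean $\texttt{!},\texttt{\&\&},\texttt{||}$. Statements: declaration $t\ x;$; assignment $x=e;$; block $\{s_1\dots s_m\}$; conditional $\mathbf{if}(e)\ s_1\ \mathbf{else}\ s_2$; loop $\mathbf{for}(x<\mathtt{size}(e))\ s$ (loop bounds are always syntactically of the form $\mathtt{size}(e)$). A program is $\mathbf{int\ main}(\mathbf{int}\ x_1,\dots,\mathbf{int}\ x_m)\{s_1\dots s_k\ \mathbf{return}\ e;\}$. Semantics (big-step). A store $\Sigma$ is a finite partial map from variables to values; $\Sigma[x\mapsto v]$ is the update. $\Sigma\vdash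 e\Downarrow v$: a variable $x\in\mathrm{dom}\,\Sigma$ evaluates to $\Sigma(x)$, constants to their value, $\mathtt{op}(e_1,\dots,e_m)$ to $\mathtt{op}$ applied to the values of the $e_i$. $\Sigma\vdash s\Downarrow\Sigma'$: $t\ x;$ gives $\Sigma[x\mapsto 0]$ if $t\in\mathsf{Int}$ and $\Sigma[x\mapsto\#f]$ if $t=\mathtt{bool}$; $x=e;$ (with $x\in\mathrm{dom}\,\Sigma$) gives $\Sigma[x\mapsto v]$ where $\Sigma\vdash e\Downarrow v$; a sequence or block executes its statements in order threading the store (a block returns the final store); a conditional evaluates its guard to a boolean and executes the corresponding branch; $\mathbf{for}(x<e)\ s$ evaluates $e$ once to an integer $i$, sets $\Sigma_0=\Sigma$, executes $s$ from $\Sigma_j[x\mapsto j]$ obtaining $\Sigma_{j+1}$ for $j=0,\dots,i-1$, and ends in $\Sigma_i$ (i.e. in $\Sigma$ if $i\le 0$). A program on inputs $v_1,\dots,v_m$ runs its statements from the store $[x_1\mapsto v_1,\dots,x_m\mapsto v_m]$ and outputs the value of its return expression in the resulting store. Type system. A typing environment $\Gamma$ is a finite partial map from variables to types; $\ell\in\{\#t,\#f\}$ is the loop indicator. Expression typing $\Gamma,\ell\vdash e:t$: a variable $x\in\mathrm{dom}\,\Gamma$ has type $\Gamma(x)$; digit literals have type $\mathtt{iint}$, $\mathtt{true},\mathtt{false}$ have type $\mathtt{bool}$; $\texttt{!},\texttt{\&\&},\texttt{||}$ take $\mathtt{bool}$ arguments to $\mathtt{bool}$; comparisons take arguments with types in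 $\mathsf{Int}$ to $\mathtt{bool}$; $+,-,/,\%$ take arguments with types in $\mathsf{Int}$ to their supremum under $\preccurlyeq$ ($\mathtt{iint}$ iff all arguments are $\mathtt{iint}$); $\mathtt{size}$ takes only an $\mathtt{iint}$ argument, giving $\mathtt{iint}$; parentheses preserve types. Statement typing $\Gamma,\ell\vdash s:\Gamma'$: $t\ x;$ is typable iff $x\notin\mathrm{dom}\,\Gamma$ and not($\ell=\#t$ and $t=\mathtt{iint}$), giving $\Gamma[x\mapsto t]$; $x=e;$ is typable iff $x\in\mathrm{dom}\,\Gamma$, not($\ell=\#t$ and $\Gamma(x)=\mathtt{iint}$), and $\Gamma,\ell\vdash e:t$ with $t,\Gamma(x)$ both in $\mathsf{Int}$ or both $\mathtt{bool}$, giving $\Gamma$; a sequence $s_1\dots s_m$ threads $\Gamma_0=\Gamma$, $\Gamma_{i-1},\ell\vdash s_i:\Gamma_i$, giving $\Gamma_m$; a block $\{\tilde s\}$ is typable if its sequence is, giving $\Gamma$; a conditional needs a guard of type $\mathtt{bool}$ and both branches typable under $\Gamma,\ell$, giving $\Gamma$; $\mathbf{for}(x<e)\ s$ needs $\Gamma,\ell\vdash e:\mathtt{iint}$, $x\notin\mathrm{dom}\,\Gamma$, and $\Gamma[x\mapsto\mathtt{iint}],\#t\vdash s:\Gamma'$ for some $\Gamma'$, giving $\Gamma$. A program is well-typed if its statements are typable starting from $[x_1\mapsto\mathtt{int},\dots,x_m\mapsto\mathtt{int}]$ with $\ell=\#f$, ending in some $\Gamma'$, and its return expression has a type in $\mathsf{Int}$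 under $\Gamma',\#f$. A well-typed program $p$ with $m$ inputs computes a total function $[\![p]\!]:\mathbb Z^m\to\mathbb Z$; $\mathbf{FPC}$ is the set of all such functions. $\mathbf{FP}$ is the class of total functions $\mathbb Z^m\to\mathbb Z$ ($m\ge0$) computable by a deterministic Turing machine in time polynomial in the total binary length of the input. *)

theory Defs
  imports Complex_Main
begin

datatype ty = TIInt | TInt | TBool

definition IntTys :: "ty set" where "IntTys = {TIInt, TInt}"

text \<open>Supremum under iint \<preccurlyeq> int.\<close>
definition ty_sup :: "ty \<Rightarrow> ty \<Rightarrow> ty" where
  "ty_sup t1 t2 = (if t1 = TIInt \<and> t2 = TIInt then TIInt else TInt)"

datatype val = VInt int | VBool bool

type_synonym vname = string

datatype oper =
    ONeg
  | OPlus | OMinus | ODiv | OMod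
  | OSize
  | OGe | OLe | OGt | OLt | OEq | ONe
  | ONot | OAnd | OOr

text \<open>A numeric constant is a nonempty decimal digit string denoting a natural
  number; we represent it directly by the natural number it denotes.\<close>
datatype expr =
    Var vname
  | NumC nat
  | TrueC
  | FalseC
  | Op oper "expr list"
  | Paren expr

text \<open>\<open>For x e s\<close> represents the loop \<open>for (x < size(e)) s\<close>.\<close>
datatype stmt =
    Decl ty vname
  | Assign vname expr
  | Block "stmt list"
  | If expr stmt stmt
  | For vname expr stmt

text \<open>\<open>Prog [x1..xm] [s1..sk] e\<close> is \<open>int main(int x1,...,int xm){s1 ... sk return e;}\<close>.\<close>
datatype prog = Prog "vname list" "stmt list" expr

fun prog_arity :: "prog \<Rightarrow> nat" where
  "prog_arity (Prog xs ss e) = length xs"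

type_synonym store = "vname \<Rightarrow> val option"

text \<open>Integer division and remainder (C-style, truncating towards zero),
  with division / remainder by 0 returning 0.\<close>
definition cdiv :: "int \<Rightarrow> int \<Rightarrow> int" where
  "cdiv a b = (if b = 0 then 0 else sgn a * sgn b * (\<bar>a\<bar> div \<bar>b\<bar>))"

definition cmod :: "int \<Rightarrow> int \<Rightarrow> int" where
  "cmod a b = (if b = 0 then 0 else a - b * cdiv a b)"

definition size_fn :: "int \<Rightarrow> int" where
  "size_fn v = \<lceil>log 2 (real_of_int (\<bar>v\<bar> + 1))\<rceil>"

definition int_args :: "val list \<Rightarrow> int list option" where
  "int_args vs = (if (\<forall>v\<in>set vs. \<exists>i. v = VInt i)
                   then Some (map (\<lambda>v. case v of VInt i \<Rightarrow> i | VBool _ \<Rightarrow> 0) vs) else None)"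

definition bool_args :: "val list \<Rightarrow> bool list option" where
  "bool_args vs = (if (\<forall>v\<in>set vs. \<exists>b. v = VBool b)
                   then Some (map (\<lambda>v. case v of VBool b \<Rightarrow> b | VInt _ \<Rightarrow> False) vs) else None)"

definition apply_op :: "oper \<Rightarrow> val list \<Rightarrow> val option" where
  "apply_op opr vs =
    (case opr of
       ONeg \<Rightarrow> (case int_args vs of Some [a] \<Rightarrow> Some (VInt (- a)) | _ \<Rightarrow> None)
     | OSize \<Rightarrow> (case int_args vs of Some [a] \<Rightarrow> Some (VInt (size_fn a)) | _ \<Rightarrow> None)
     | ONot \<Rightarrow> (case bool_args vs of Some [a] \<Rightarrow> Some (VBool (\<not> a)) | _ \<Rightarrow> None)
     | OAnd \<Rightarrow> (case bool_args vs of Some [a, b] \<Rightarrow> Some (VBool (a \<and> b)) | _ \<Rightarrow> None)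
     | OOr \<Rightarrow> (case bool_args vs of Some [a, b] \<Rightarrow> Some (VBool (a \<or> b)) | _ \<Rightarrow> None)
     | _ \<Rightarrow> (case int_args vs of
               Some [a, b] \<Rightarrow>
                 Some (case opr of
                         OPlus \<Rightarrow> VInt (a + b) | OMinus \<Rightarrow> VInt (a - b)
                       | ODiv \<Rightarrow> VInt (cdiv a b) | OMod \<Rightarrow> VInt (cmod a b)
                       | OGe \<Rightarrow> VBool (a \<ge> b) | OLe \<Rightarrow> VBool (a \<le> b)
                       | OGt \<Rightarrow> VBool (a > b) | OLt \<Rightarrow> VBool (a < b)
                       | OEq \<Rightarrow> VBool (a = b) | ONe \<Rightarrow> VBool (a \<noteq> b)
                       | _ \<Rightarrow> VInt 0)
             | _ \<Rightarrow> None))"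

inductive eval :: "store \<Rightarrow> expr \<Rightarrow> val \<Rightarrow> bool" where
  EVar: "\<Sigma> x = Some v \<Longrightarrow> eval \<Sigma> (Var x) v"
| ENum: "eval \<Sigma> (NumC n) (VInt (int n))"
| ETrue: "eval \<Sigma> TrueC (VBool True)"
| EFalse: "eval \<Sigma> FalseC (VBool False)"
| EOp: "list_all2 (eval \<Sigma>) es vs \<Longrightarrow> apply_op opr vs = Some v \<Longrightarrow> eval \<Sigma> (Op opr es) v"
| EParen: "eval \<Sigma> e v \<Longrightarrow> eval \<Sigma> (Paren e) v"

definition init_val :: "ty \<Rightarrow> val" where
  "init_val t = (if t = TBool then VBool False else VInt 0)"

inductive exec :: "store \<Rightarrow> stmt \<Rightarrow> store \<Rightarrow> bool"
  and exec_seq :: "store \<Rightarrow> stmt list \<Rightarrow> store \<Rightarrow> bool"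
  and exec_loop :: "vname \<Rightarrow> stmt \<Rightarrow> int \<Rightarrow> int \<Rightarrow> store \<Rightarrow> store \<Rightarrow> bool"
where
  XDecl: "exec \<Sigma> (Decl t x) (\<Sigma>(x \<mapsto> init_val t))"
| XAssign: "x \<in> dom \<Sigma> \<Longrightarrow> eval \<Sigma> e v \<Longrightarrow> exec \<Sigma> (Assign x e) (\<Sigma>(x \<mapsto> v))"
| XBlock: "exec_seq \<Sigma> ss \<Sigma>' \<Longrightarrow> exec \<Sigma> (Block ss) \<Sigma>'"
| XIfT: "eval \<Sigma> e (VBool True) \<Longrightarrow> exec \<Sigma> s1 \<Sigma>' \<Longrightarrow> exec \<Sigma> (If e s1 s2) \<Sigma>'"
| XIfF: "eval \<Sigma> e (VBool False) \<Longrightarrow> exec \<Sigma> s2 \<Sigma>' \<Longrightarrow> exec \<Sigma> (If e s1 s2) \<Sigma>'"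
| XFor: "eval \<Sigma> (Op OSize [e]) (VInt i) \<Longrightarrow> exec_loop x s 0 i \<Sigma> \<Sigma>' \<Longrightarrow>
         exec \<Sigma> (For x e s) \<Sigma>'"
| XSeqNil: "exec_seq \<Sigma> [] \<Sigma>"
| XSeqCons: "exec \<Sigma> s \<Sigma>1 \<Longrightarrow> exec_seq \<Sigma>1 ss \<Sigma>' \<Longrightarrow> exec_seq \<Sigma> (s # ss) \<Sigma>'"
| XLoopDone: "\<not> j < i \<Longrightarrow> exec_loop x s j i \<Sigma> \<Sigma>"
| XLoopStep: "j < i \<Longrightarrow> exec (\<Sigma>(x \<mapsto> VInt j)) s \<Sigma>1 \<Longrightarrow> exec_loop x s (j + 1) i \<Sigma>1 \<Sigma>' \<Longrightarrow>
              exec_loop x s j i \<Sigma> \<Sigma>'"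

fun prog_sem :: "prog \<Rightarrow> int list \<Rightarrow> int \<Rightarrow> bool" where
  "prog_sem (Prog xs ss e) vs v =
     (length vs = length xs \<and>
      (\<exists>\<Sigma>'. exec_seq (Map.empty(xs [\<mapsto>] map VInt vs)) ss \<Sigma>' \<and> eval \<Sigma>' e (VInt v)))"

type_synonym tenv = "vname \<Rightarrow> ty option"

definition arith_op :: "oper \<Rightarrow> bool" where
  "arith_op opr \<longleftrightarrow> opr \<in> {OPlus, OMinus, ODiv, OMod}"

definition cmp_op :: "oper \<Rightarrow> bool" where
  "cmp_op opr \<longleftrightarrow> opr \<in> {OGe, OLe, OGt, OLt, OEq, ONe}"

inductive ty_expr :: "tenv \<Rightarrow> bool \<Rightarrow> expr \<Rightarrow> ty \<Rightarrow> bool" where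
  TVar: "\<Gamma> x = Some t \<Longrightarrow> ty_expr \<Gamma> lp (Var x) t"
| TNum: "ty_expr \<Gamma> lp (NumC n) TIInt"
| TTrue: "ty_expr \<Gamma> lp TrueC TBool"
| TFalse: "ty_expr \<Gamma> lp FalseC TBool"
| TNot: "ty_expr \<Gamma> lp e TBool \<Longrightarrow> ty_expr \<Gamma> lp (Op ONot [e]) TBool"
| TAnd: "ty_expr \<Gamma> lp e1 TBool \<Longrightarrow> ty_expr \<Gamma> lp e2 TBool \<Longrightarrow> ty_expr \<Gamma> lp (Op OAnd [e1, e2]) TBool"
| TOr: "ty_expr \<Gamma> lp e1 TBool \<Longrightarrow> ty_expr \<Gamma> lp e2 TBool \<Longrightarrow> ty_expr \<Gamma> lp (Op OOr [e1, e2]) TBool"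
| TCmp: "cmp_op opr \<Longrightarrow> ty_expr \<Gamma> lp e1 t1 \<Longrightarrow> ty_expr \<Gamma> lp e2 t2 \<Longrightarrow>
         t1 \<in> IntTys \<Longrightarrow> t2 \<in> IntTys \<Longrightarrow> ty_expr \<Gamma> lp (Op opr [e1, e2]) TBool"
| TArith: "arith_op opr \<Longrightarrow> ty_expr \<Gamma> lp e1 t1 \<Longrightarrow> ty_expr \<Gamma> lp e2 t2 \<Longrightarrow>
           t1 \<in> IntTys \<Longrightarrow> t2 \<in> IntTys \<Longrightarrow> ty_expr \<Gamma> lp (Op opr [e1, e2]) (ty_sup t1 t2)"
| TNeg: "ty_expr \<Gamma> lp e t \<Longrightarrow> t \<in> IntTys \<Longrightarrow> ty_expr \<Gamma> lp (Op ONeg [e]) t"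
| TSize: "ty_expr \<Gamma> lp e TIInt \<Longrightarrow> ty_expr \<Gamma> lp (Op OSize [e]) TIInt"
| TParen: "ty_expr \<Gamma> lp e t \<Longrightarrow> ty_expr \<Gamma> lp (Paren e) t"

inductive ty_stmt :: "tenv \<Rightarrow> bool \<Rightarrow> stmt \<Rightarrow> tenv \<Rightarrow> bool"
  and ty_seq :: "tenv \<Rightarrow> bool \<Rightarrow> stmt list \<Rightarrow> tenv \<Rightarrow> bool"
where
  TDecl: "x \<notin> dom \<Gamma> \<Longrightarrow> \<not> (lp \<and> t = TIInt) \<Longrightarrow> ty_stmt \<Gamma> lp (Decl t x) (\<Gamma>(x \<mapsto> t))"
| TAssign: "\<Gamma> x = Some tx \<Longrightarrow> \<not> (lp \<and> tx = TIInt) \<Longrightarrow> ty_expr \<Gamma> lp e t \<Longrightarrow>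
            (t \<in> IntTys \<and> tx \<in> IntTys) \<or> (t = TBool \<and> tx = TBool) \<Longrightarrow>
            ty_stmt \<Gamma> lp (Assign x e) \<Gamma>"
| TBlock: "ty_seq \<Gamma> lp ss \<Gamma>' \<Longrightarrow> ty_stmt \<Gamma> lp (Block ss) \<Gamma>"
| TIf: "ty_expr \<Gamma> lp e TBool \<Longrightarrow> ty_stmt \<Gamma> lp s1 \<Gamma>1 \<Longrightarrow> ty_stmt \<Gamma> lp s2 \<Gamma>2 \<Longrightarrow>
        ty_stmt \<Gamma> lp (If e s1 s2) \<Gamma>"
| TFor: "ty_expr \<Gamma> lp (Op OSize [e]) TIInt \<Longrightarrow> x \<notin> dom \<Gamma> \<Longrightarrow>
         ty_stmt (\<Gamma>(x \<mapsto> TIInt)) True s \<Gamma>' \<Longrightarrow> ty_stmt \<Gamma> lp (For x e s) \<Gamma>"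
| TSeqNil: "ty_seq \<Gamma> lp [] \<Gamma>"
| TSeqCons: "ty_stmt \<Gamma> lp s \<Gamma>1 \<Longrightarrow> ty_seq \<Gamma>1 lp ss \<Gamma>' \<Longrightarrow> ty_seq \<Gamma> lp (s # ss) \<Gamma>'"

fun well_typed :: "prog \<Rightarrow> bool" where
  "well_typed (Prog xs ss e) =
     (\<exists>\<Gamma>' t. ty_seq (Map.empty(xs [\<mapsto>] replicate (length xs) TInt)) False ss \<Gamma>' \<and>
             ty_expr \<Gamma>' False e t \<and> t \<in> IntTys)"

text \<open>FPC: pairs (m, f) such that some well-typed program with m inputs computes f
  on \<open>\<int>\<^sup>m\<close> (inputs are lists of length m; values of f on other lengths are irrelevant).\<close>
definition FPC :: "(nat \<times> (int list \<Rightarrow> int)) set" where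
  "FPC = {(m, f). \<exists>p. well_typed p \<and> prog_arity p = m \<and>
                      (\<forall>vs. length vs = m \<longrightarrow> prog_sem p vs (f vs))}"

datatype dir = DL | DR | DS

text \<open>Tape symbols are natural numbers; 0 is the blank. States are naturals.
  Fields: number of states, number of symbols, transition function, start state, halting state.\<close>
record tm =
  tm_nstates :: nat
  tm_nsyms :: nat
  tm_delta :: "nat \<Rightarrow> nat \<Rightarrow> nat \<times> nat \<times> dir"
  tm_start :: nat
  tm_halt :: nat

definition tm_wf :: "tm \<Rightarrow> bool" where
  "tm_wf M \<longleftrightarrow> tm_start M < tm_nstates M \<and> tm_halt M < tm_nstates M \<and> 5 \<le> tm_nsyms M \<and>
     (\<forall>q < tm_nstates M. \<forall>a < tm_nsyms M.
        (case tm_delta M q a of (q', b, d) \<Rightarrow> q' < tm_nstates M \<and> b < tm_nsyms M))"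

text \<open>Configuration: state, tape left of the head (nearest cell first), tape from the
  head rightwards (head reads the first cell; empty list means blank).\<close>
type_synonym config = "nat \<times> nat list \<times> nat list"

fun tm_step :: "tm \<Rightarrow> config \<Rightarrow> config" where
  "tm_step M (q, ls, rs) =
     (if q = tm_halt M then (q, ls, rs) else
      (let a = (case rs of [] \<Rightarrow> 0 | x # _ \<Rightarrow> x); rs' = drop 1 rs in
       case tm_delta M q a of (q', b, d) \<Rightarrow>
         (case d of
            DS \<Rightarrow> (q', ls, b # rs')
          | DR \<Rightarrow> (q', b # ls, rs')
          | DL \<Rightarrow> (case ls of [] \<Rightarrow> (q', [], 0 # b # rs')
                             | l # ls' \<Rightarrow> (q', ls', l # b # rs')))))"

definition tm_run :: "tm \<Rightarrow> nat \<Rightarrow> config \<Rightarrow> config" where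
  "tm_run M t c = (tm_step M ^^ t) c"

text \<open>Binary encoding of integers: symbol 1 = digit 0, 2 = digit 1, 3 = minus sign,
  4 = separator. Digits are most significant first; 0 is encoded as a single digit 0.\<close>
fun bin_digits :: "nat \<Rightarrow> nat list" where
  "bin_digits n = (if n < 2 then [n + 1] else bin_digits (n div 2) @ [n mod 2 + 1])"

definition enc_int :: "int \<Rightarrow> nat list" where
  "enc_int v = (if v < 0 then 3 # bin_digits (nat (- v)) else bin_digits (nat v))"

definition enc_input :: "int list \<Rightarrow> nat list" where
  "enc_input vs = concat (map (\<lambda>v. enc_int v @ [4]) vs)"

definition input_len :: "int list \<Rightarrow> nat" where
  "input_len vs = length (enc_input vs)"

definition strip_blanks :: "nat list \<Rightarrow> nat list" where
  "strip_blanks xs = rev (dropWhile (\<lambda>a. a = 0) (rev xs))"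

definition FP :: "(nat \<times> (int list \<Rightarrow> int)) set" where
  "FP = {(m, f). \<exists>M c k. tm_wf M \<and>
          (\<forall>vs. length vs = m \<longrightarrow>
             (\<exists>t. t \<le> c * (input_len vs + 1) ^ k \<and>
                  (case tm_run M t (tm_start M, [], enc_input vs) of (q, ls, rs) \<Rightarrow>
                     q = tm_halt M \<and> strip_blanks rs = enc_int (f vs))))}"

end

theory Submission
  imports Defs
begin

text \<open>Registers hold integers in two's complement. All registers are stored side by side: a tape
  cell holds a column, the set of registers whose bit at that position is 1, with the least
  significant column rightmost. One sweep of the head from right to left then adds any two registers,
  and the sign of the result is the bit in the last column written. A While language whose only
  operations are addition and sign test, hence also a Turing machine, simulates every
  CorePolyC operation; its control state is the list of commands still to be executed, and only
  finitely many such lists are reachable. Since each sweep lengthens the tape by one cell, the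
  running time is polynomial in the number of sweeps and the length of the input.

  The number of sweeps is polynomial because inside a loop no variable of type iint visible
  outside it is assigned. So all loop bounds are controlled by a number \<open>I\<close> of bits fixed on entry,
  the body lengthens the values by a number of bits that depends polynomially on \<open>I\<close> only, and
  nested loops are executed polynomially often. Outside loops there are boundedly many
  statements, and polynomials are closed under composition.\<close>

section \<open>Turing machines over arbitrary finite alphabets\<close>

text \<open>There is no multiplication, so the result of an operator is at most one bit longer than
  its longest operand, and evaluating \<open>e\<close> adds at most the constant
  \<open>ebits e\<close> to the longest value. A loop runs \<open>size(e)\<close> times, hence at
  most as often as \<open>e\<close> has bits, and since \<open>e\<close> has type iint it mentions
  iint variables only. Inside a loop \<open>L\<close> therefore grows by addition, and the amount is
  computed from \<open>I\<close> alone. If the body could replace \<open>L\<close> by, say,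
  \<open>2 * L\<close>, iterating it would be exponential; hence \<open>poly_sim\<close> has two
  regimes, the bound \<open>L + A I\<close> inside loops and \<open>A L\<close> outside. The
  polynomials \<open>A\<close> and \<open>P\<close> are chosen by induction on the typing
  derivation, before any store is given. The run to be simulated is supplied by \<open>FPC\<close>,
  which asserts an execution on every input. The columns lie to the left of the unread input, so
  they can grow into the blank half of the tape without anything being moved. In two's complement
  this growth copies the last column, whatever the signs of the individual registers.\<close>

fun astep :: "('q \<Rightarrow> 's \<Rightarrow> 'q \<times> 's \<times> dir) \<Rightarrow> 'q \<Rightarrow> 's \<Rightarrow> 'q \<times> 's list \<times> 's list \<Rightarrow> 'q \<times> 's list \<times> 's list" where
  "astep \<delta> hlt bl (q, ls, rs) =
     (if q = hlt then (q, ls, rs) else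
      (case \<delta> q (case rs of [] \<Rightarrow> bl | x # _ \<Rightarrow> x) of (q', b, d) \<Rightarrow>
         (case d of
            DS \<Rightarrow> (q', ls, b # drop 1 rs)
          | DR \<Rightarrow> (q', b # ls, drop 1 rs)
          | DL \<Rightarrow> (q', tl ls, (if ls = [] then bl else hd ls) # b # drop 1 rs))))"

text \<open>The types of states and symbols may be infinite; only the subsets \<open>Q\<close> and
  \<open>S\<close>, closed under \<open>\<delta>\<close>, are finite, the latter because
  \<open>es\<close> injects it into \<open>{..<ns}\<close>. The numbering \<open>es\<close> is a
  parameter so that the symbols of the input encoding can keep their numbers.\<close>

lemma encode_machine:
  fixes \<delta> :: "'q \<Rightarrow> 's \<Rightarrow> 'q \<times> 's \<times> dir"
  assumes fin: "finite Q" and Q: "q0 \<in> Q" "hlt \<in> Q"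
    and es: "inj_on es S" "es ` S \<subseteq> {..<ns}" "bl \<in> S" "es bl = 0" "5 \<le> ns"
    and closed: "\<And>q a q' b d. q \<in> Q \<Longrightarrow> a \<in> S \<Longrightarrow> \<delta> q a = (q', b, d) \<Longrightarrow> q' \<in> Q \<and> b \<in> S"
  obtains M eq where "tm_wf M" "tm_start M = eq q0" "tm_halt M = eq hlt"
    "\<And>n q ls rs q' ls' rs'. q \<in> Q \<Longrightarrow> set ls \<subseteq> S \<Longrightarrow> set rs \<subseteq> S \<Longrightarrow>
       (astep \<delta> hlt bl ^^ n) (q, ls, rs) = (q', ls', rs') \<Longrightarrow>
       tm_run M n (eq q, map es ls, map es rs) = (eq q', map es ls', map es rs')"
proof -
  obtain eq :: "'q \<Rightarrow> nat" where bij: "bij_betw eq Q {0..<card Q}"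
    using ex_bij_betw_finite_nat[OF fin] by blast
  have inj: "inj_on eq Q" and rng: "\<And>q. q \<in> Q \<Longrightarrow> eq q < card Q"
    using bij by (auto simp: bij_betw_def)
  \<comment> \<open>\<open>tm_wf\<close> constrains the table at all numbers below the bounds, also
    at those that encode no symbol; these get a legal dummy entry.\<close>
  define dl where "dl = (\<lambda>q a. if q \<in> eq ` Q \<and> a \<in> es ` S
     then (case \<delta> (inv_into Q eq q) (inv_into S es a) of (q', b, d) \<Rightarrow> (eq q', es b, d)) else (eq q0, 0, DS))"
  define M where "M = \<lparr>tm_nstates = card Q, tm_nsyms = ns, tm_delta = dl,
                        tm_start = eq q0, tm_halt = eq hlt\<rparr>"
  have dl: "dl (eq q) (es a) = (case \<delta> q a of (q', b, d) \<Rightarrow> (eq q', es b, d))"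
    if "q \<in> Q" "a \<in> S" for q a
    using that inj es(1) by (simp add: dl_def inv_into_f_f)
  have wf: "tm_wf M"
    unfolding tm_wf_def
  proof (intro conjI allI impI)
    fix q a assume "q < tm_nstates M" "a < tm_nsyms M"
    show "case tm_delta M q a of (q', b, d) \<Rightarrow> q' < tm_nstates M \<and> b < tm_nsyms M"
    proof (cases "q \<in> eq ` Q \<and> a \<in> es ` S")
      case True
      then obtain q1 a1 where qa: "q1 \<in> Q" "q = eq q1" "a1 \<in> S" "a = es a1" by auto
      obtain q' b d where d: "\<delta> q1 a1 = (q', b, d)" using prod_cases3 by blast
      show ?thesis using closed[OF qa(1,3) d] dl[OF qa(1,3)] d qa rng es(2) by (auto simp: M_def)
    next
      case False
      then show ?thesis using Q rng es(5) by (auto simp: M_def dl_def)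
    qed
  qed (use Q rng es(5) in \<open>auto simp: M_def\<close>)
  have step: "tm_step M (eq q, map es ls, map es rs) = (eq q', map es ls', map es rs')
      \<and> q' \<in> Q \<and> set ls' \<subseteq> S \<and> set rs' \<subseteq> S"
    if c: "q \<in> Q" "set ls \<subseteq> S" "set rs \<subseteq> S" and st: "astep \<delta> hlt bl (q, ls, rs) = (q', ls', rs')"
    for q ls rs q' ls' rs'
  proof (cases "q = hlt")
    case True
    then show ?thesis using that by (simp add: M_def)
  next
    case False
    define a where "a = (case rs of [] \<Rightarrow> bl | x # _ \<Rightarrow> x)"
    have a: "a \<in> S" using c es(3) by (auto simp: a_def split: list.split)
    have ea: "(case map es rs of [] \<Rightarrow> 0 | x # _ \<Rightarrow> x) = es a"
      using es(4) by (auto simp: a_def split: list.split)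
    obtain q1 b d where d: "\<delta> q a = (q1, b, d)" using prod_cases3 by blast
    have qb: "q1 \<in> Q" "b \<in> S" using closed[OF c(1) a d] by auto
    have ne: "eq q \<noteq> eq hlt" using False inj c(1) Q(2) by (auto simp: inj_on_def)
    have dr: "set (drop (Suc 0) rs) \<subseteq> S" using c(3) set_drop_subset by fastforce
    have "tm_delta M (eq q) (es a) = (eq q1, es b, d)" using dl[OF c(1) a] d by (simp add: M_def)
    moreover have "eq q \<noteq> tm_halt M" using ne by (simp add: M_def)
    ultimately have tst: "tm_step M (eq q, map es ls, map es rs) =
      (case d of DS \<Rightarrow> (eq q1, map es ls, es b # drop 1 (map es rs))
        | DR \<Rightarrow> (eq q1, es b # map es ls, drop 1 (map es rs))
        | DL \<Rightarrow> (case map es ls of [] \<Rightarrow> (eq q1, [], 0 # es b # drop 1 (map es rs))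
              | l # ls' \<Rightarrow> (eq q1, ls', l # es b # drop 1 (map es rs))))"
      by (simp only: tm_step.simps ea Let_def if_False prod.case)
    have "(q', ls', rs') = (case d of DS \<Rightarrow> (q1, ls, b # drop 1 rs)
        | DR \<Rightarrow> (q1, b # ls, drop 1 rs)
        | DL \<Rightarrow> (q1, tl ls, (if ls = [] then bl else hd ls) # b # drop 1 rs))"
      unfolding st[symmetric] using False d by (simp only: astep.simps a_def[symmetric] if_False prod.case)
    then show ?thesis unfolding tst using qb c dr es(3,4)
      by (cases d; cases ls) (auto simp: drop_map)
  qed
  have run: "tm_run M n (eq q, map es ls, map es rs) = (eq q', map es ls', map es rs')
      \<and> q' \<in> Q \<and> set ls' \<subseteq> S \<and> set rs' \<subseteq> S"
    if "q \<in> Q" "set ls \<subseteq> S" "set rs \<subseteq> S" "(astep \<delta> hlt bl ^^ n) (q, ls, rs) = (q', ls', rs')"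
    for n q ls rs q' ls' rs' using that
  proof (induction n arbitrary: q' ls' rs')
    case 0
    then show ?case by (simp add: tm_run_def)
  next
    case (Suc n)
    obtain q1 ls1 rs1 where m: "(astep \<delta> hlt bl ^^ n) (q, ls, rs) = (q1, ls1, rs1)"
      using prod_cases3 by blast
    note IH = Suc.IH[OF Suc.prems(1-3) m]
    have "astep \<delta> hlt bl (q1, ls1, rs1) = (q', ls', rs')" using Suc.prems(4) m by simp
    then show ?case using IH step[of q1 ls1 rs1 q' ls' rs'] by (simp add: tm_run_def)
  qed
  have se: "tm_start M = eq q0" "tm_halt M = eq hlt" by (simp_all add: M_def)
  show ?thesis by (rule that[OF wf se]) (rule run[THEN conjunct1])
qed

section \<open>A While language on integer registers\<close>

text \<open>Program variables, expression stack, scratch registers, and per loop depth the loop counter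
  and its difference to the loop bound.\<close>
datatype reg = V vname | T nat | X nat | J nat | D nat

text \<open>\<open>Const True\<close> is the constant $-1$ (all bits 1) and \<open>Cpl\<close> the bitwise complement $-x-1$, so that
  subtraction is addition with initial carry 1.\<close>
datatype operand = Const bool | Pos reg | Cpl reg

datatype cmd =
    Skip
  | Add reg operand operand bool
  | Seq cmd cmd
  | IfNeg reg cmd cmd
  | While reg cmd
  | Read cmd cmd cmd cmd

fun op_val :: "operand \<Rightarrow> (reg \<Rightarrow> int) \<Rightarrow> int" where
  "op_val (Const b) \<sigma> = (if b then -1 else 0)"
| "op_val (Pos r) \<sigma> = \<sigma> r"
| "op_val (Cpl r) \<sigma> = - \<sigma> r - 1"

fun select :: "nat \<Rightarrow> cmd \<Rightarrow> cmd \<Rightarrow> cmd \<Rightarrow> cmd \<Rightarrow> cmd" where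
  "select a c1 c2 c3 c4 = (if a = 1 then c1 else if a = 2 then c2 else if a = 3 then c3 else c4)"

type_synonym rstate = "(reg \<Rightarrow> int) \<times> nat list"

text \<open>The counter charges one unit per sweep or read of the machine. \<open>Seq\<close> costs
  a unit too, since unfolding it is a sweep that changes only the continuation.\<close>

inductive runs :: "cmd \<Rightarrow> rstate \<Rightarrow> nat \<Rightarrow> rstate \<Rightarrow> bool" where
  BSkip: "runs Skip s (Suc 0) s"
| BAdd: "runs (Add r a b c) (\<sigma>, i) (Suc 0) (\<sigma>(r := op_val a \<sigma> + op_val b \<sigma> + of_bool c), i)"
| BSeq: "runs c1 s t1 s1 \<Longrightarrow> runs c2 s1 t2 s2 \<Longrightarrow> runs (Seq c1 c2) s (Suc (t1 + t2)) s2"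
| BIfT: "fst s r < 0 \<Longrightarrow> runs c1 s t s' \<Longrightarrow> runs (IfNeg r c1 c2) s (Suc t) s'"
| BIfF: "\<not> fst s r < 0 \<Longrightarrow> runs c2 s t s' \<Longrightarrow> runs (IfNeg r c1 c2) s (Suc t) s'"
| BWhF: "\<not> fst s r < 0 \<Longrightarrow> runs (While r c) s (Suc 0) s"
| BWhT: "fst s r < 0 \<Longrightarrow> runs c s t1 s1 \<Longrightarrow> runs (While r c) s1 t2 s2 \<Longrightarrow> runs (While r c) s (Suc (t1 + t2)) s2"
| BRead: "a \<in> {1..4} \<Longrightarrow> runs (select a c1 c2 c3 c4) (\<sigma>, i) t s' \<Longrightarrow> runs (Read c1 c2 c3 c4) (\<sigma>, a # i) (Suc t) s'"

text \<open>Target, operands and initial carry of a sweep. Tests and control steps are sweeps that leave the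
  registers unchanged; the boolean passed to \<open>next_cont\<close> is the sign of the target after the sweep.\<close>
type_synonym instr = "reg \<times> operand \<times> operand \<times> bool"

fun instr :: "cmd list \<Rightarrow> instr" where
  "instr (Add r a b c # K) = (r, a, b, c)"
| "instr (IfNeg r c1 c2 # K) = (r, Pos r, Const False, False)"
| "instr (While r c # K) = (r, Pos r, Const False, False)"
| "instr K = (T 0, Pos (T 0), Const False, False)"

fun next_cont :: "cmd list \<Rightarrow> bool \<Rightarrow> cmd list" where
  "next_cont (Seq c1 c2 # K) b = c1 # c2 # K"
| "next_cont (IfNeg r c1 c2 # K) b = (if b then c1 else c2) # K"
| "next_cont (While r c # K) b = (if b then c # While r c # K else K)"
| "next_cont (c # K) b = K"
| "next_cont [] b = []"

fun next_read :: "cmd list \<Rightarrow> nat \<Rightarrow> cmd list" where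
  "next_read (Read c1 c2 c3 c4 # K) a = select a c1 c2 c3 c4 # K"
| "next_read K a = []"

section \<open>Simulation by sweeps\<close>

type_synonym col = "reg set"

fun op_bit :: "operand \<Rightarrow> col \<Rightarrow> bool" where
  "op_bit (Const b) c = b"
| "op_bit (Pos r) c = (r \<in> c)"
| "op_bit (Cpl r) c = (r \<notin> c)"

fun out_col :: "instr \<Rightarrow> bool \<Rightarrow> col \<Rightarrow> col" where
  "out_col (r, a, b, c0) cy c = (if (op_bit a c \<noteq> op_bit b c) \<noteq> cy then insert r c else c - {r})"

fun next_carry :: "instr \<Rightarrow> bool \<Rightarrow> col \<Rightarrow> bool" where
  "next_carry (r, a, b, c0) cy c = (op_bit a c \<and> op_bit b c \<or> op_bit a c \<and> cy \<or> op_bit b c \<and> cy)"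

text \<open>Past the last column the sweep processes a copy of that column, i.e. it sign-extends all registers
  by one bit, which leaves room for the carry.\<close>
fun sweep :: "instr \<Rightarrow> bool \<Rightarrow> col \<Rightarrow> col list \<Rightarrow> col list" where
  "sweep I cy l [] = [out_col I cy l]"
| "sweep I cy l (c # cs) = out_col I cy c # sweep I (next_carry I cy c) c cs"

section \<open>Two's complement and the effect of a sweep\<close>

fun twos_compl :: "bool list \<Rightarrow> int" where
  "twos_compl [] = 0"
| "twos_compl [b] = (if b then -1 else 0)"
| "twos_compl (b # b' # bs) = of_bool b + 2 * twos_compl (b' # bs)"

lemma twos_compl_Cons: "bs \<noteq> [] \<Longrightarrow> twos_compl (b # bs) = of_bool b + 2 * twos_compl bs"
  by (cases bs) auto

lemma twos_compl_neg_iff: "bs \<noteq> [] \<Longrightarrow> twos_compl bs < 0 \<longleftrightarrow> last bs"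
  by (induction bs rule: twos_compl.induct) auto

text \<open>Sign extension: the weight \<open>- 2 ^ n\<close> of the sign bit equals
  \<open>2 ^ n - 2 ^ (n + 1)\<close>.\<close>

lemma twos_compl_dup_last: "twos_compl (bs @ [last bs]) = twos_compl bs" if "bs \<noteq> []"
  using that by (induction bs rule: twos_compl.induct) auto

definition reg_val :: "col list \<Rightarrow> reg \<Rightarrow> int" where
  "reg_val w r = twos_compl (map (\<lambda>c. r \<in> c) w)"

lemma twos_compl_op_bit: "w \<noteq> [] \<Longrightarrow> twos_compl (map (op_bit a) w) = op_val a (reg_val w)"
proof (induction w rule: list_nonempty_induct)
  case (single x)
  then show ?case by (cases a) (auto simp: reg_val_def)
next
  case (cons x xs)
  then show ?case by (cases a) (auto simp: reg_val_def twos_compl_Cons)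
qed

lemma sweep_not_Nil [simp]: "sweep I cy l w \<noteq> []"
  by (cases w) auto

text \<open>The induction step is the full adder identity. For a single column the operands are 0 or
  -1, so the sum with carry lies between -2 and 1, which is exactly the range of the two bits
  produced by the column and its copy.\<close>

lemma twos_compl_sweep: "twos_compl (map (\<lambda>c. r \<in> c) (sweep (r, a, b, c0) cy l (c # cs))) =
    twos_compl (map (op_bit a) (c # cs)) + twos_compl (map (op_bit b) (c # cs)) + of_bool cy"
proof (induction cs arbitrary: c cy l)
  case Nil
  then show ?case by auto
next
  case (Cons c' cs)
  show ?case
    by (subst sweep.simps, subst list.map, subst twos_compl_Cons, simp, subst Cons.IH) (auto simp: twos_compl_Cons)
qed

lemma sweep_other: "r' \<noteq> r \<Longrightarrow>
    map (\<lambda>c. r' \<in> c) (sweep (r, a, b, c0) cy l w) = map (\<lambda>c. r' \<in> c) w @ [r' \<in> last (l # w)]"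
  by (induction w arbitrary: cy l) auto

lemma reg_val_sweep:
  assumes "w \<noteq> []"
  shows "reg_val (sweep (r, a, b, c0) c0 l w) = (reg_val w)(r := op_val a (reg_val w) + op_val b (reg_val w) + of_bool c0)"
proof
  fix r'
  obtain c cs where w: "w = c # cs" using assms by (cases w) auto
  show "reg_val (sweep (r, a, b, c0) c0 l w) r' = ((reg_val w)(r := op_val a (reg_val w) + op_val b (reg_val w) + of_bool c0)) r'"
  proof (cases "r' = r")
    case True
    then show ?thesis using twos_compl_sweep[of r a b c0 c0 l c cs] twos_compl_op_bit[OF assms] w by (simp add: reg_val_def)
  next
    case False
    have "twos_compl (map (\<lambda>c. r' \<in> c) w @ [last (map (\<lambda>c. r' \<in> c) w)]) = twos_compl (map (\<lambda>c. r' \<in> c) w)"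
      by (rule twos_compl_dup_last) (simp add: assms)
    then show ?thesis using False assms by (simp add: reg_val_def sweep_other last_map)
  qed
qed

lemma sign_sweep: "r \<in> last (sweep (r, a, b, c0) cy l w) \<longleftrightarrow> reg_val (sweep (r, a, b, c0) cy l w) r < 0"
  by (simp add: reg_val_def twos_compl_neg_iff last_map)

lemma length_sweep [simp]: "length (sweep I cy l w) = Suc (length w)"
  by (induction I cy l w rule: sweep.induct) auto

section \<open>The sweeping machine\<close>

datatype sym = Raw nat | Col col

text \<open>\<open>Ret\<close> moves right across the columns and starts the next command at the first cell
  beyond them; \<open>Sw\<close> carries the carry and the previous column; \<open>Bk\<close> returns to the columns after an
  input symbol has been consumed; \<open>Out\<close>, \<open>Skp\<close> and \<open>Minus\<close> convert \<open>T 0\<close> to digits, erase leading zeros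
  and write the sign found in \<open>X 0\<close>.\<close>
datatype st = Init1 | Init2 | Ret "cmd list" | Sw "cmd list" bool col | Bk "cmd list"
  | Out bool | Skp bool | Minus | Halt

fun is_read :: "cmd list \<Rightarrow> bool" where
  "is_read (Read c1 c2 c3 c4 # K) = True"
| "is_read K = False"

text \<open>\<open>Init1\<close> and \<open>Init2\<close> write one empty column left of the input,
  so that the width is never 0 and all registers start as 0. \<open>Sw\<close> hands on the column
  as it was read, not as rewritten: the sign extension at the left end needs the old operand bits,
  and the target may itself be an operand. Symbols consumed by a read are erased, so that only
  blanks follow the output.\<close>

fun delta :: "cmd \<Rightarrow> st \<Rightarrow> sym \<Rightarrow> st \<times> sym \<times> dir" where
  "delta p Init1 a = (Init2, a, DL)"
| "delta p Init2 a = (Ret [p], Col {}, DR)"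
| "delta p (Ret k) (Col c) = (Ret k, Col c, DR)"
| "delta p (Ret k) (Raw a) =
     (if k = [] then (Out False, Raw a, DL)
      else if is_read k then (if a = 0 then (Ret k, Raw 0, DR) else (Bk (next_read k a), Raw 0, DL))
      else (Sw k (snd (snd (snd (instr k)))) {}, Raw a, DL))"
| "delta p (Sw k cy l) (Col c) = (Sw k (next_carry (instr k) cy c) c, Col (out_col (instr k) cy c), DL)"
| "delta p (Sw k cy l) (Raw a) =
     (Ret (next_cont k (fst (instr k) \<in> out_col (instr k) cy l)), Col (out_col (instr k) cy l), DR)"
| "delta p (Bk k) (Raw a) = (Bk k, Raw a, DL)"
| "delta p (Bk k) (Col c) = (Ret k, Col c, DR)"
| "delta p (Out s) (Col c) = (Out (X 0 \<in> c), Raw (if T 0 \<in> c then 2 else 1), DL)"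
| "delta p (Out s) (Raw a) = (Skp s, Raw a, DR)"
| "delta p (Skp s) (Raw a) =
     (if a = 1 then (Skp s, Raw 0, DR)
      else if a = 2 then (if s then (Minus, Raw 2, DL) else (Halt, Raw 2, DS))
      else (Halt, Raw 1, DS))"
| "delta p (Skp s) (Col c) = (Halt, Raw 1, DS)"
| "delta p Minus a = (Halt, Raw 3, DS)"
| "delta p Halt a = (Halt, a, DS)"

abbreviation steps :: "cmd \<Rightarrow> nat \<Rightarrow> st \<times> sym list \<times> sym list \<Rightarrow> st \<times> sym list \<times> sym list" where
  "steps p n \<equiv> astep (delta p) Halt (Raw 0) ^^ n"

lemma steps_trans: "steps p m c = c1 \<Longrightarrow> steps p n c1 = c2 \<Longrightarrow> steps p (m + n) c = c2"
  by (subst add.commute) (simp add: funpow_add)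

lemma steps_1: "astep (delta p) Halt (Raw 0) c = c1 \<Longrightarrow> steps p (Suc n) c = steps p n c1"
  by (simp add: funpow_swap1)

definition at_left :: "col list \<Rightarrow> sym list \<Rightarrow> sym list \<times> sym list" where
  "at_left w rs = (map Col (tl w), (if w = [] then Raw 0 else Col (hd w)) # rs)"

text \<open>There are \<open>length w\<close> steps of rewriting, one that appends the sign
  extension and turns, and \<open>length w\<close> steps back. The sign of the target is known at
  the turning point, so the next continuation is chosen there.\<close>

lemma steps_sweep:
  "steps p (2 * length w + 1) (Sw k cy l, at_left w rs) =
     (Ret (next_cont k (fst (instr k) \<in> last (sweep (instr k) cy l w))), map Col (sweep (instr k) cy l w), rs)"
proof (induction w arbitrary: cy l rs)
  case Nil
  then show ?case by (simp add: at_left_def)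
next
  case (Cons c cs)
  let ?o = "out_col (instr k) cy c"
  have 1: "astep (delta p) Halt (Raw 0) (Sw k cy l, at_left (c # cs) rs) = (Sw k (next_carry (instr k) cy c) c, at_left cs (Col ?o # rs))"
    by (cases cs) (auto simp: at_left_def)
  have "steps p (1 + (2 * length cs + 1)) (Sw k cy l, at_left (c # cs) rs)
      = (Ret (next_cont k (fst (instr k) \<in> last (sweep (instr k) (next_carry (instr k) cy c) c cs))),
         map Col (sweep (instr k) (next_carry (instr k) cy c) c cs), Col ?o # rs)"
    by (rule steps_trans[OF _ Cons.IH]) (use 1 in simp)
  from steps_trans[OF this, of 1] show ?case by simp
qed

lemma steps_instr:
  assumes "k \<noteq> []" "\<not> is_read k" "instr k = (r, a, b, c)" "w \<noteq> []" "list_all (\<lambda>s. \<exists>n. s = Raw n) rs"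
  obtains w' where "steps p (2 * length w + 2) (Ret k, map Col w, rs) =
      (Ret (next_cont k (reg_val w' r < 0)), map Col w', if rs = [] then [Raw 0] else rs)"
    "reg_val w' = (reg_val w)(r := op_val a (reg_val w) + op_val b (reg_val w) + of_bool c)" "length w' = Suc (length w)"
proof
  let ?w' = "sweep (r, a, b, c) c {} w" and ?rs = "if rs = [] then [Raw 0] else rs"
  have "steps p 1 (Ret k, map Col w, rs) = (Sw k c {}, at_left w ?rs)"
    using assms by (cases rs; cases w) (auto simp: at_left_def)
  from steps_trans[OF this steps_sweep] 
  show "steps p (2 * length w + 2) (Ret k, map Col w, rs) = (Ret (next_cont k (reg_val ?w' r < 0)), map Col ?w', ?rs)"
    using assms(3) by (simp add: sign_sweep)
  show "reg_val ?w' = (reg_val w)(r := op_val a (reg_val w) + op_val b (reg_val w) + of_bool c)"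
    using reg_val_sweep assms(4) by simp
qed simp

lemma steps_right_blanks:
  "is_read k \<Longrightarrow> steps p g (Ret k, ls, replicate g (Raw 0) @ rs) = (Ret k, replicate g (Raw 0) @ ls, rs)"
proof (induction g arbitrary: ls)
  case (Suc g)
  have "astep (delta p) Halt (Raw 0) (Ret k, ls, replicate (Suc g) (Raw 0) @ rs) = (Ret k, Raw 0 # ls, replicate g (Raw 0) @ rs)"
    using Suc.prems by auto
  then show ?case using Suc by (simp only: steps_1) (simp add: replicate_app_Cons_same)
qed simp

lemma steps_left_blanks:
  "steps p (g + 1) (Bk k, tl (replicate g (Raw 0) @ Col c # ls), hd (replicate g (Raw 0) @ Col c # ls) # rs)
    = (Ret k, Col c # ls, replicate g (Raw 0) @ rs)"
proof (induction g arbitrary: rs)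
  case 0
  then show ?case by simp
next
  case (Suc g)
  have "astep (delta p) Halt (Raw 0) (Bk k, tl (replicate (Suc g) (Raw 0) @ Col c # ls), hd (replicate (Suc g) (Raw 0) @ Col c # ls) # rs)
     = (Bk k, tl (replicate g (Raw 0) @ Col c # ls), hd (replicate g (Raw 0) @ Col c # ls) # Raw 0 # rs)"
    by auto
  then show ?case using Suc.IH[of "Raw 0 # rs"] by (simp only: steps_1 add_Suc) (simp add: replicate_app_Cons_same)
qed

lemma steps_read:
  assumes "is_read k" "a \<noteq> 0" "w \<noteq> []"
  shows "steps p (2 * g + 2) (Ret k, map Col w, replicate g (Raw 0) @ Raw a # rs) =
    (Ret (next_read k a), map Col w, replicate (Suc g) (Raw 0) @ rs)"
proof -
  obtain c cs where w: "w = c # cs" using assms(3) by (cases w) auto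
  let ?L = "replicate g (Raw 0) @ Col c # map Col cs"
  have 1: "steps p g (Ret k, map Col w, replicate g (Raw 0) @ Raw a # rs) = (Ret k, ?L, Raw a # rs)"
    using steps_right_blanks[OF assms(1)] w by simp
  have 2: "steps p 1 (Ret k, ?L, Raw a # rs) = (Bk (next_read k a), tl ?L, hd ?L # Raw 0 # rs)"
    using assms by (cases k) auto
  have "steps p (g + (1 + (g + 1))) (Ret k, map Col w, replicate g (Raw 0) @ Raw a # rs) =
    (Ret (next_read k a), Col c # map Col cs, replicate g (Raw 0) @ Raw 0 # rs)"
    by (rule steps_trans[OF 1 steps_trans[OF 2 steps_left_blanks]])
  then show ?thesis using w by (simp add: mult_2 replicate_app_Cons_same)
qed

text \<open>The consumed part of the input leaves a gap of \<open>g\<close> blanks between the columns and the rest of the input.\<close>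
definition home :: "cmd list \<Rightarrow> col list \<Rightarrow> nat \<Rightarrow> nat list \<Rightarrow> st \<times> sym list \<times> sym list" where
  "home k w g inp = (Ret k, map Col w, replicate g (Raw 0) @ map Raw inp)"

text \<open>A read moves one cell from the input to the gap, so \<open>G\<close> can stay fixed
  during a run; \<open>1 \<le> G\<close> leaves room for the blank that appears at the right end
  when the input is empty.\<close>

definition holds :: "rstate \<Rightarrow> col list \<Rightarrow> nat \<Rightarrow> nat \<Rightarrow> bool" where
  "holds s w g G \<longleftrightarrow> w \<noteq> [] \<and> reg_val w = fst s \<and> g + length (snd s) \<le> G \<and> 1 \<le> G"

lemma macro_step:
  assumes k: "k \<noteq> []" "\<not> is_read k" "instr k = (r, a, b, c)" and h: "holds (\<sigma>, i) w g G"
    and \<sigma>': "\<sigma>' = \<sigma>(r := op_val a \<sigma> + op_val b \<sigma> + of_bool c)"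
  obtains w' g' where "steps p (2 * length w + 2) (home k w g i) = home (next_cont k (\<sigma>' r < 0)) w' g' i"
    "holds (\<sigma>', i) w' g' G" "length w' = Suc (length w)"
proof -
  let ?rs = "replicate g (Raw 0) @ map Raw i"
  have w: "w \<noteq> []" "reg_val w = \<sigma>" using h by (auto simp: holds_def)
  have "list_all (\<lambda>s. \<exists>n. s = Raw n) ?rs" by (auto simp: list_all_iff)
  from steps_instr[OF k w(1) this, of p] obtain w' where w':
    "steps p (2 * length w + 2) (Ret k, map Col w, ?rs) =
      (Ret (next_cont k (reg_val w' r < 0)), map Col w', if ?rs = [] then [Raw 0] else ?rs)"
    "reg_val w' = \<sigma>'" "length w' = Suc (length w)"
    using w(2) \<sigma>' by metis
  \<comment> \<open>The tape may end right after the columns; turning there creates one blank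
    cell.\<close>
  define g' where "g' = (if ?rs = [] then 1 else g)"
  have g': "(if ?rs = [] then [Raw 0] else ?rs) = replicate g' (Raw 0) @ map Raw i"
    by (auto simp: g'_def)
  show ?thesis
  proof (rule that[of w' g'])
    show "steps p (2 * length w + 2) (home k w g i) = home (next_cont k (\<sigma>' r < 0)) w' g' i"
      using w' unfolding home_def g'[symmetric] by simp
    show "holds (\<sigma>', i) w' g' G" using h w' by (auto simp: holds_def g'_def)
  qed (rule w'(3))
qed

lemma macro_test:
  assumes k: "k \<noteq> []" "\<not> is_read k" "instr k = (r, Pos r, Const False, False)" and h: "holds s w g G"
  obtains w' g' where "steps p (2 * length w + 2) (home k w g (snd s)) = home (next_cont k (fst s r < 0)) w' g' (snd s)"
    "holds s w' g' G" "length w' = Suc (length w)"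
proof -
  obtain \<sigma> i where s: "s = (\<sigma>, i)" by (cases s)
  show ?thesis using macro_step[OF k h[unfolded s] refl, of p] that s by (auto simp: fun_upd_idem)
qed

text \<open>A sweep costs at most \<open>2 * B + 2\<close> machine steps and a read at most
  \<open>2 * G + 2\<close>. Fixing the width bound \<open>B\<close> for the whole run makes the
  costs of consecutive pieces add up.\<close>

definition goes :: "cmd \<Rightarrow> cmd list \<Rightarrow> cmd list \<Rightarrow> rstate \<Rightarrow> nat \<Rightarrow> rstate \<Rightarrow> bool" where
  "goes p k k' s t s' \<longleftrightarrow> (\<forall>w g G B. holds s w g G \<longrightarrow> length w + t \<le> B \<longrightarrow>
     (\<exists>n w' g'. steps p n (home k w g (snd s)) = home k' w' g' (snd s') \<and> holds s' w' g' G \<and>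
        length w' \<le> length w + t \<and> n \<le> t * (2 * B + 2 * G + 2)))"

lemma goes_trans:
  assumes "goes p k k1 s t1 s1" "goes p k1 k2 s1 t2 s2"
  shows "goes p k k2 s (t1 + t2) s2"
  unfolding goes_def
proof (intro allI impI)
  fix w g G B assume h: "holds s w g G" "length w + (t1 + t2) \<le> B"
  then obtain n1 w1 g1 where 1: "steps p n1 (home k w g (snd s)) = home k1 w1 g1 (snd s1)" "holds s1 w1 g1 G"
     "length w1 \<le> length w + t1" "n1 \<le> t1 * (2 * B + 2 * G + 2)"
    using assms(1)[unfolded goes_def, rule_format, OF h(1), of B] by auto
  have "length w1 + t2 \<le> B" using 1 h by linarith
  then obtain n2 w2 g2 where 2: "steps p n2 (home k1 w1 g1 (snd s1)) = home k2 w2 g2 (snd s2)" "holds s2 w2 g2 G"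
     "length w2 \<le> length w1 + t2" "n2 \<le> t2 * (2 * B + 2 * G + 2)"
    using assms(2) 1(2) unfolding goes_def by blast
  show "\<exists>n w' g'. steps p n (home k w g (snd s)) = home k2 w' g' (snd s2) \<and> holds s2 w' g' G \<and>
        length w' \<le> length w + (t1 + t2) \<and> n \<le> (t1 + t2) * (2 * B + 2 * G + 2)"
    using steps_trans[OF 1(1) 2(1)] 1 2
    by (intro exI[of _ "n1 + n2"] exI[of _ w2] exI[of _ g2]) (auto simp: add_mult_distrib)
qed

lemma goes_test:
  assumes "k \<noteq> []" "\<not> is_read k" "instr k = (r, Pos r, Const False, False)" "next_cont k (fst s r < 0) = k'"
  shows "goes p k k' s 1 s"
  unfolding goes_def
proof (intro allI impI)
  fix w g G B assume h: "holds s w g G" "length w + 1 \<le> B"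
  show "\<exists>n w' g'. steps p n (home k w g (snd s)) = home k' w' g' (snd s) \<and> holds s w' g' G \<and>
        length w' \<le> length w + 1 \<and> n \<le> 1 * (2 * B + 2 * G + 2)"
  proof -
    obtain w' g' where "steps p (2 * length w + 2) (home k w g (snd s)) = home k' w' g' (snd s)"
      "holds s w' g' G" "length w' = Suc (length w)"
      using macro_test[OF assms(1-3) h(1)] assms(4) by metis
    then show ?thesis
      by (intro exI[of _ "2 * length w + 2"] exI[of _ w'] exI[of _ g']) (use h(2) in simp)
  qed
qed

lemma goes_Add: "goes p (Add r a b c # K) K (\<sigma>, i) 1 (\<sigma>(r := op_val a \<sigma> + op_val b \<sigma> + of_bool c), i)"
  unfolding goes_def
proof (intro allI impI)
  fix w g G B assume h: "holds (\<sigma>, i) w g G" "length w + 1 \<le> B"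
  let ?s = "(\<sigma>(r := op_val a \<sigma> + op_val b \<sigma> + of_bool c), i)"
  show "\<exists>n w' g'. steps p n (home (Add r a b c # K) w g (snd (\<sigma>, i))) = home K w' g' (snd ?s) \<and>
      holds ?s w' g' G \<and> length w' \<le> length w + 1 \<and> n \<le> 1 * (2 * B + 2 * G + 2)"
  proof -
    obtain w' g' where "steps p (2 * length w + 2) (home (Add r a b c # K) w g i) = home K w' g' i"
      "holds ?s w' g' G" "length w' = Suc (length w)"
      using macro_step[of "Add r a b c # K" r a b c, OF _ _ _ h(1) refl, where p = p] by auto
    then show ?thesis
      by (intro exI[of _ "2 * length w + 2"] exI[of _ w'] exI[of _ g']) (use h(2) in simp)
  qed
qed

lemma goes_Read:
  assumes "a \<noteq> 0"
  shows "goes p (Read c1 c2 c3 c4 # K) (select a c1 c2 c3 c4 # K) (\<sigma>, a # i) 1 (\<sigma>, i)"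
  unfolding goes_def
proof (intro allI impI)
  fix w g G B assume h: "holds (\<sigma>, a # i) w g G" "length w + 1 \<le> B"
  have "steps p (2 * g + 2) (home (Read c1 c2 c3 c4 # K) w g (snd (\<sigma>, a # i))) = home (select a c1 c2 c3 c4 # K) w (Suc g) (snd (\<sigma>, i))"
    using steps_read[of "Read c1 c2 c3 c4 # K" a w, where p = p and g = g and rs = "map Raw i"] h(1) assms
    by (simp add: home_def holds_def)
  then show "\<exists>n w' g'. steps p n (home (Read c1 c2 c3 c4 # K) w g (snd (\<sigma>, a # i))) = home (select a c1 c2 c3 c4 # K) w' g' (snd (\<sigma>, i)) \<and>
      holds (\<sigma>, i) w' g' G \<and> length w' \<le> length w + 1 \<and> n \<le> 1 * (2 * B + 2 * G + 2)"
    by (intro exI[of _ "2 * g + 2"] exI[of _ w] exI[of _ "Suc g"]) (use h in \<open>auto simp: holds_def\<close>)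
qed

lemma runs_goes: "runs c s t s' \<Longrightarrow> goes p (c # K) K s t s'"
proof (induction arbitrary: K rule: runs.induct)
  case (BSkip s)
  then show ?case using goes_test[of "Skip # K" "T 0" s K p] by simp
next
  case BAdd
  then show ?case using goes_Add by simp
next
  case (BSeq c1 s t1 s1 c2 t2 s2)
  have "goes p (Seq c1 c2 # K) (c1 # c2 # K) s 1 s" by (intro goes_test) auto
  from goes_trans[OF this goes_trans[OF BSeq.IH]] show ?case by simp
next
  case (BIfT s r c1 t s' c2)
  have "goes p (IfNeg r c1 c2 # K) (c1 # K) s 1 s" by (intro goes_test) (use BIfT in auto)
  from goes_trans[OF this BIfT.IH] show ?case by simp
next
  case (BIfF s r c2 t s' c1)
  have "goes p (IfNeg r c1 c2 # K) (c2 # K) s 1 s" by (intro goes_test) (use BIfF in auto)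
  from goes_trans[OF this BIfF.IH] show ?case by simp
next
  case (BWhF s r c)
  then show ?case using goes_test[of "While r c # K" r s K p] by simp
next
  case (BWhT s r c t1 s1 t2 s2)
  have "goes p (While r c # K) (c # While r c # K) s 1 s" by (intro goes_test) (use BWhT in auto)
  from goes_trans[OF this goes_trans[OF BWhT.IH]] show ?case by simp
next
  case (BRead a c1 c2 c3 c4 \<sigma> i t s')
  have "a \<noteq> 0" using BRead by auto
  from goes_trans[OF goes_Read[OF this] BRead.IH] show ?case by simp
qed

section \<open>Writing the result\<close>

declare bin_digits.simps [simp del]

lemma set_bin_digits: "set (bin_digits n) \<subseteq> {1, 2}"
proof (induction n rule: bin_digits.induct)
  case (1 n)
  then show ?case by (subst bin_digits.simps) auto
qed

lemma bin_digits_pos: "n > 0 \<Longrightarrow> \<exists>ds. bin_digits n = 2 # ds"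
proof (induction n rule: bin_digits.induct)
  case (1 n)
  then show ?case
  proof (cases "n < 2")
    case True
    then show ?thesis using 1(2) by (auto simp: bin_digits.simps[of n])
  next
    case False
    then show ?thesis using 1(1) by (auto simp: bin_digits.simps[of n] div_greater_zero_iff)
  qed
qed

definition digit :: "bool \<Rightarrow> nat" where "digit b = (if b then 2 else 1)"

text \<open>A nonnegative number in two's complement is its binary expansion with leading zeros.
  Zero is set apart because erasing leading zeros removes all of its digits.\<close>

lemma digits_twos_compl:
  assumes "bs \<noteq> []" "0 \<le> twos_compl bs"
  shows "\<exists>z. rev (map digit bs) = replicate z 1 @ (if twos_compl bs = 0 then [] else bin_digits (nat (twos_compl bs)))"
  using assms
proof (induction bs rule: twos_compl.induct)
  case 1
  then show ?case by simp
next
  case (2 b)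
  then show ?case by (auto simp: digit_def intro: exI[of _ 1] split: if_splits)
next
  case (3 b b' bs)
  let ?m = "twos_compl (b' # bs)"
  have m: "0 \<le> ?m" using 3 by (cases b) auto
  obtain z where z: "rev (map digit (b' # bs)) = replicate z 1 @ (if ?m = 0 then [] else bin_digits (nat ?m))"
    using 3 m by blast
  show ?case
  proof (cases "?m = 0")
    case True
    have "rev (map digit (b # b' # bs)) = replicate z 1 @ [digit b]" using z True by simp
    moreover have "twos_compl (b # b' # bs) = of_bool b" using True by simp
    moreover have "digit True = 2" "digit False = 1" by (simp_all add: digit_def)
    ultimately show ?thesis
      by (intro exI[of _ "if b then z else Suc z"])
         (cases b, auto simp: replicate_append_same bin_digits.simps[of "Suc 0"])
  next
    case False
    have n: "nat (of_bool b + 2 * ?m) = of_bool b + 2 * nat ?m" using m by (cases b) auto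
    have "bin_digits (of_bool b + 2 * nat ?m) = bin_digits (nat ?m) @ [digit b]"
      using m False by (subst bin_digits.simps) (auto simp: digit_def)
    moreover have "of_bool b + 2 * ?m \<noteq> 0" using m False by (cases b) auto
    ultimately show ?thesis using z False n by (intro exI[of _ z]) simp
  qed
qed

lemma steps_out:
  "steps p (length w + 1) (Out s, at_left w rs) =
    (Skp (if w = [] then s else X 0 \<in> last w), [Raw 0], map Raw (rev (map (\<lambda>c. digit (T 0 \<in> c)) w)) @ rs)"
proof (induction w arbitrary: s rs)
  case Nil
  then show ?case by (simp add: at_left_def)
next
  case (Cons c w)
  have "astep (delta p) Halt (Raw 0) (Out s, at_left (c # w) rs) = (Out (X 0 \<in> c), at_left w (Raw (digit (T 0 \<in> c)) # rs))"
    by (cases w) (auto simp: at_left_def digit_def)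
  then show ?case using Cons.IH[of "X 0 \<in> c"] by (simp only: steps_1 list.size add_Suc_right add_Suc) simp
qed

lemma steps_skip:
  "steps p z (Skp s, ls, replicate z (Raw 1) @ rs) = (Skp s, replicate z (Raw 0) @ ls, rs)"
proof (induction z arbitrary: ls)
  case (Suc z)
  have "astep (delta p) Halt (Raw 0) (Skp s, ls, replicate (Suc z) (Raw 1) @ rs) = (Skp s, Raw 0 # ls, replicate z (Raw 1) @ rs)"
    by auto
  then show ?case using Suc by (simp only: steps_1) (simp add: replicate_app_Cons_same)
qed simp

text \<open>One pass leftwards turns columns into digits of \<open>T 0\<close>; the last bit of
  \<open>X 0\<close> that it sees is the sign. The pass back erases leading zeros; if it erases
  everything, it writes the digit 0 on the blank behind them.\<close>

lemma steps_output:
  assumes "w \<noteq> []" "reg_val w (T 0) = \<bar>v\<bar>" "reg_val w (X 0) < 0 \<longleftrightarrow> v < 0"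
  shows "\<exists>n ls h. n \<le> 2 * length w + 4 \<and>
    steps p n (home [] w g []) = (Halt, ls, map Raw (enc_int v @ replicate h 0))"
proof -
  define s where "s = (v < 0)"
  have s: "X 0 \<in> last w \<longleftrightarrow> s"
    using assms(1,3) by (auto simp: reg_val_def twos_compl_neg_iff last_map s_def)
  let ?rs = "if g = 0 then [Raw 0] else replicate g (Raw 0)"
  let ?ds = "rev (map digit (map (\<lambda>c. T 0 \<in> c) w))"
  obtain h where h: "?rs = replicate (Suc h) (Raw 0)" by (cases g) auto
  have 1: "steps p 1 (home [] w g []) = (Out False, at_left w ?rs)"
    using assms(1) by (cases g; cases w) (auto simp: home_def at_left_def)
  have 2: "steps p (length w + 1) (Out False, at_left w ?rs) = (Skp s, [Raw 0], map Raw ?ds @ ?rs)"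
    using steps_out[where p = p and w = w] s assms(1) by (simp add: comp_def)
  have t: "twos_compl (map (\<lambda>c. T 0 \<in> c) w) = \<bar>v\<bar>" using assms(2) by (simp add: reg_val_def)
  obtain z where z: "?ds = replicate z 1 @ (if v = 0 then [] else bin_digits (nat \<bar>v\<bar>))"
    using digits_twos_compl[of "map (\<lambda>c. T 0 \<in> c) w"] assms(1) t by auto
  have "length ?ds = length w" by simp
  then have zl: "z \<le> length w" unfolding z by simp
  let ?r = "(if v = 0 then [] else map Raw (bin_digits (nat \<bar>v\<bar>))) @ ?rs"
  have 3: "steps p z (Skp s, [Raw 0], map Raw ?ds @ ?rs) = (Skp s, replicate z (Raw 0) @ [Raw 0], ?r)"
    using steps_skip[where p = p and z = z and s = s and ls = "[Raw 0]" and rs = ?r] z by (simp split: if_splits)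
  note 4 = steps_trans[OF 1 steps_trans[OF 2 3]]
  have "\<exists>n ls h. n \<le> 2 \<and> steps p n (Skp s, replicate z (Raw 0) @ [Raw 0], ?r) = (Halt, ls, map Raw (enc_int v @ replicate h 0))"
  proof (cases "v = 0")
    case True
    then show ?thesis using h
      by (intro exI[of _ 1] exI[of _ "replicate z (Raw 0) @ [Raw 0]"] exI[of _ h])
         (simp add: enc_int_def bin_digits.simps[of 0])
  next
    case False
    then obtain ds where ds: "bin_digits (nat \<bar>v\<bar>) = 2 # ds" using bin_digits_pos[of "nat \<bar>v\<bar>"] by auto
    show ?thesis
    proof (cases s)
      case True
      then have "enc_int v = 3 # 2 # ds" using ds by (simp add: enc_int_def s_def)
      then show ?thesis using True h False ds
        by (intro exI[of _ 2] exI[of _ "tl (replicate z (Raw 0) @ [Raw 0])"] exI[of _ "Suc h"]) (simp add: numeral_2_eq_2)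
    next
      case F: False
      then have "enc_int v = 2 # ds" using ds by (simp add: enc_int_def s_def)
      then show ?thesis using F h False ds
        by (intro exI[of _ 1] exI[of _ "replicate z (Raw 0) @ [Raw 0]"] exI[of _ "Suc h"]) simp
    qed
  qed
  then obtain n ls h where 5: "n \<le> 2" "steps p n (Skp s, replicate z (Raw 0) @ [Raw 0], ?r) = (Halt, ls, map Raw (enc_int v @ replicate h 0))"
    by blast
  then show ?thesis using steps_trans[OF 4 5(2)] 5(1) zl
    by (intro exI[of _ "1 + (length w + 1 + z) + n"] exI[of _ ls] exI[of _ h]) simp
qed

section \<open>Finiteness of the reachable control states and columns\<close>

text \<open>Covers the continuations met while \<open>c\<close> is executed on top of
  \<open>K\<close>. The body of a loop continues with the loop itself, so iterating leads back to a
  list already in the set, and structural recursion suffices.\<close>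

fun conts :: "cmd \<Rightarrow> cmd list \<Rightarrow> cmd list set" where
  "conts (Seq a b) K = insert (Seq a b # K) (conts a (b # K) \<union> conts b K)"
| "conts (IfNeg r a b) K = insert (IfNeg r a b # K) (conts a K \<union> conts b K)"
| "conts (While r a) K = insert (While r a # K) (conts a (While r a # K))"
| "conts (Read a b c d) K = insert (Read a b c d # K) (conts a K \<union> conts b K \<union> conts c K \<union> conts d K)"
| "conts c K = {c # K}"

text \<open>These registers and the dummy target \<open>T 0\<close> are the only targets of sweeps.
  All others keep their initial value 0 and occur in no column, so finitely many columns suffice.
  The same set bounds what a run can change.\<close>

fun regs :: "cmd \<Rightarrow> reg set" where
  "regs Skip = {}"
| "regs (Add r a b c) = {r}"
| "regs (Seq a b) = regs a \<union> regs b"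
| "regs (IfNeg r a b) = insert r (regs a \<union> regs b)"
| "regs (While r a) = insert r (regs a)"
| "regs (Read a b c d) = regs a \<union> regs b \<union> regs c \<union> regs d"

lemma finite_conts: "finite (conts c K)" by (induction c arbitrary: K) auto
lemma finite_regs: "finite (regs c)" by (induction c) auto
lemma conts_self: "c # K \<in> conts c K" by (cases c) auto

lemma conts_next_cont: "k \<in> conts c K \<Longrightarrow> next_cont k b \<in> insert K (conts c K)"
proof (induction c arbitrary: K)
  case (Seq c1 c2)
  then consider "k = Seq c1 c2 # K" | "k \<in> conts c1 (c2 # K)" | "k \<in> conts c2 K" by auto
  then show ?case
  proof cases
    case 2
    then show ?thesis using Seq.IH(1)[OF 2] by (auto simp: conts_self)
  qed (use Seq.IH(2) in \<open>auto simp: conts_self\<close>)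
next
  case (IfNeg r c1 c2)
  then show ?case using IfNeg.IH(1)[of K] IfNeg.IH(2)[of K] by (auto simp: conts_self)
next
  case (While r c)
  then consider "k = While r c # K" | "k \<in> conts c (While r c # K)" by auto
  then show ?case
  proof cases
    case 2
    then show ?thesis using While.IH[OF 2] by auto
  qed (auto simp: conts_self)
next
  case (Read c1 c2 c3 c4)
  then show ?case using Read.IH[of K] by (auto simp: conts_self)
qed auto

lemma conts_next_read: "k \<in> conts c K \<Longrightarrow> is_read k \<Longrightarrow> next_read k a \<in> conts c K"
proof (induction c arbitrary: K)
  case (Seq c1 c2)
  then show ?case using Seq.IH(1)[of "c2 # K"] Seq.IH(2)[of K] by (auto simp: conts_self)
next
  case (IfNeg r c1 c2)
  then show ?case using IfNeg.IH(1)[of K] IfNeg.IH(2)[of K] by (auto simp: conts_self)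
next
  case (While r c)
  then show ?case using While.IH[of "While r c # K"] by (auto simp: conts_self)
next
  case (Read c1 c2 c3 c4)
  then show ?case using Read.IH[of K] by (auto simp: conts_self)
qed auto

lemma conts_regs: "k \<in> conts c K \<Longrightarrow> fst (instr k) \<in> insert (T 0) (regs c)"
proof (induction c arbitrary: K)
  case (Seq c1 c2)
  then show ?case using Seq.IH(1)[of "c2 # K"] Seq.IH(2)[of K] by auto
next
  case (IfNeg r c1 c2)
  then show ?case using IfNeg.IH(1)[of K] IfNeg.IH(2)[of K] by auto
next
  case (While r c)
  then show ?case using While.IH[of "While r c # K"] by auto
next
  case (Read c1 c2 c3 c4)
  then show ?case using Read.IH[of K] by auto
qed auto

lemma out_col_subset: "fst I \<in> R \<Longrightarrow> c \<subseteq> R \<Longrightarrow> out_col I cy c \<subseteq> R"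
  by (cases I) auto

lemma strip_blanks_replicate: "0 \<notin> set xs \<Longrightarrow> strip_blanks (xs @ replicate h 0) = xs"
proof -
  assume "0 \<notin> set xs"
  then have "dropWhile (\<lambda>a. a = 0) (rev xs) = rev xs"
    by (cases "rev xs") (auto simp flip: set_rev[of xs])
  moreover have "dropWhile (\<lambda>a. a = 0) (replicate h 0 @ ys) = dropWhile (\<lambda>a. a = 0) ys" for ys :: "nat list"
    by (induction h) auto
  ultimately show ?thesis by (simp add: strip_blanks_def)
qed

lemma zero_notin_enc_int: "0 \<notin> set (enc_int v)"
  using set_bin_digits[of "nat v"] set_bin_digits[of "nat (- v)"] by (auto simp: enc_int_def)

theorem cmd_tm:
  "\<exists>M. tm_wf M \<and> (\<forall>i t \<sigma>' v. set i \<subseteq> {1..4} \<longrightarrow> runs p (\<lambda>_. 0, i) t (\<sigma>', []) \<longrightarrow>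
      \<sigma>' (T 0) = \<bar>v\<bar> \<longrightarrow> (\<sigma>' (X 0) < 0 \<longleftrightarrow> v < 0) \<longrightarrow>
      (\<exists>n \<le> (t + 1) * (2 * t + 2 * length i + 10). case tm_run M n (tm_start M, [], i) of (q, ls, rs) \<Rightarrow>
         q = tm_halt M \<and> strip_blanks rs = enc_int v))"
proof -
  define R where "R = insert (T 0) (regs p)"
  define C where "C = insert [] (conts p [])"
  define S where "S = Raw ` {..<5} \<union> Col ` Pow R"
  define Q where "Q = {Init1, Init2, Minus, Halt} \<union> Ret ` C \<union> Bk ` C \<union> Out ` UNIV \<union> Skp ` UNIV
     \<union> (\<lambda>(k, b, c). Sw k b c) ` ((C - {[]}) \<times> UNIV \<times> Pow R)"
  have fR: "finite R" "finite C" by (auto simp: R_def C_def finite_regs finite_conts)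
  obtain e :: "col \<Rightarrow> nat" where e: "bij_betw e (Pow R) {0..<card (Pow R)}"
    using ex_bij_betw_finite_nat[of "Pow R"] fR by blast
  \<comment> \<open>Raw symbols keep their numbers, so that the input and the output are those of
    the machine \<open>M\<close> without translation.\<close>
  define es where "es = (\<lambda>s. case s of Raw n \<Rightarrow> n | Col c \<Rightarrow> 5 + e c)"
  have memQ: "Init2 \<in> Q" "Minus \<in> Q" "Halt \<in> Q" "Out b \<in> Q" "Skp b \<in> Q"
    "Ret k \<in> Q \<longleftrightarrow> k \<in> C" "Bk k \<in> Q \<longleftrightarrow> k \<in> C" "Sw k b c \<in> Q \<longleftrightarrow> k \<in> C \<and> k \<noteq> [] \<and> c \<subseteq> R" for k b c
    by (auto simp: Q_def image_iff)
  have memS: "Raw n \<in> S \<longleftrightarrow> n < 5" "Col c \<in> S \<longleftrightarrow> c \<subseteq> R" for n c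
    by (auto simp: S_def)
  have next_cont: "next_cont k b \<in> C" if "k \<in> C" for k b
    using conts_next_cont[of k p "[]" b] that by (auto simp: C_def)
  have next_read: "next_read k a \<in> C" if "k \<in> C" "is_read k" for k a
    using conts_next_read[of k p "[]" a] that by (auto simp: C_def)
  have ireg: "fst (instr k) \<in> R" if "k \<in> C" "k \<noteq> []" for k
    using conts_regs[of k p "[]"] that by (auto simp: C_def R_def)
  have closed: "q' \<in> Q \<and> b \<in> S" if q: "q \<in> Q" and a: "a \<in> S" and d: "delta p q a = (q', b, d)" for q a q' b d
  proof (cases q)
    case Init1
    then show ?thesis using d a by (auto simp: memQ)
  next
    case Init2
    then show ?thesis using d by (auto simp: memQ memS C_def conts_self)
  next
    case (Ret k)
    then have "k \<in> C" using q by (auto simp: memQ)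
    then show ?thesis using Ret d a next_read[of k]
      by (cases a) (auto simp: memQ memS split: if_splits)
  next
    case (Sw k cy l)
    then have k: "k \<in> C" "k \<noteq> []" "l \<subseteq> R" using q by (auto simp: memQ)
    note o = out_col_subset[OF ireg[OF k(1,2)]]
    show ?thesis
    proof (cases a)
      case (Raw x)
      then show ?thesis using d Sw k next_cont[OF k(1)] o[OF k(3)] by (auto simp: memQ memS)
    next
      case (Col c)
      then have c: "c \<subseteq> R" using a by (auto simp: memS)
      show ?thesis using d Sw Col k c o[OF c] by (auto simp: memQ memS)
    qed
  next
    case (Bk k)
    then have "k \<in> C" using q by (auto simp: memQ)
    then show ?thesis using Bk d a by (cases a) (auto simp: memQ memS)
  next
    case (Out s)
    then show ?thesis using d a by (cases a) (auto simp: memQ memS)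
  next
    case (Skp s)
    then show ?thesis using d a by (cases a) (auto simp: memQ memS split: if_splits)
  next
    case Minus
    then show ?thesis using d by (auto simp: memQ memS)
  next
    case Halt
    then show ?thesis using d a by (auto simp: memQ)
  qed
  have "inj_on e (Pow R)" using e by (simp add: bij_betw_def)
  then have einj: "inj_on es S"
    unfolding inj_on_def[of es] by (auto simp: es_def memS inj_on_eq_iff split: sym.splits)
  have erng: "es ` S \<subseteq> {..<5 + card (Pow R)}"
    using e by (auto simp: es_def S_def bij_betw_def)
  have finQ: "finite Q" using fR by (auto simp: Q_def)
  have q0: "Init1 \<in> Q" "Halt \<in> Q" by (auto simp: Q_def)
  have bl: "Raw 0 \<in> S" "es (Raw 0) = 0" "5 \<le> 5 + card (Pow R)" by (auto simp: S_def es_def)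
  obtain M eq where M: "tm_wf M" "tm_start M = eq Init1" "tm_halt M = eq Halt"
    "\<And>n q ls rs q' ls' rs'. q \<in> Q \<Longrightarrow> set ls \<subseteq> S \<Longrightarrow> set rs \<subseteq> S \<Longrightarrow>
       (astep (delta p) Halt (Raw 0) ^^ n) (q, ls, rs) = (q', ls', rs') \<Longrightarrow>
       tm_run M n (eq q, map es ls, map es rs) = (eq q', map es ls', map es rs')"
    by (rule encode_machine[where \<delta> = "delta p", OF finQ q0 einj erng bl]) (erule (2) closed, rule that)
  have mr: "map es (map Raw xs) = xs" for xs by (simp add: es_def comp_def)
  have main: "\<exists>n \<le> (t + 1) * (2 * t + 2 * length i + 10). case tm_run M n (tm_start M, [], i) of (q, ls, rs) \<Rightarrow>
         q = tm_halt M \<and> strip_blanks rs = enc_int v"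
    if i: "set i \<subseteq> {1..4}" and r: "runs p (\<lambda>_. 0, i) t (\<sigma>', [])"
      and v: "\<sigma>' (T 0) = \<bar>v\<bar>" "\<sigma>' (X 0) < 0 \<longleftrightarrow> v < 0" for i t \<sigma>' v
  proof -
    let ?s = "(\<lambda>_. 0, i) :: rstate" and ?G = "length i + 1"
    define g where "g = (if i = [] then 1 else 0 :: nat)"
    have 1: "steps p 2 (Init1, [], map Raw i) = home [p] [{}] g (snd ?s)"
      by (cases i) (auto simp: numeral_2_eq_2 home_def g_def)
    have h: "holds ?s [{}] g ?G" by (auto simp: holds_def reg_val_def g_def)
    obtain n w g' where 2: "steps p n (home [p] [{}] g (snd ?s)) = home [] w g' []" "holds (\<sigma>', []) w g' ?G"
       "length w \<le> 1 + t" "n \<le> t * (2 * (1 + t) + 2 * ?G + 2)"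
      using runs_goes[OF r, of p "[]"] h unfolding goes_def by fastforce
    have "w \<noteq> []" "reg_val w = \<sigma>'" using 2(2) by (auto simp: holds_def)
    then obtain n2 ls h where 3: "n2 \<le> 2 * length w + 4" "steps p n2 (home [] w g' []) = (Halt, ls, map Raw (enc_int v @ replicate h 0))"
      using steps_output[of w v] v by blast
    have "tm_run M (2 + (n + n2)) (eq Init1, map es [], map es (map Raw i)) = (eq Halt, map es ls, map es (map Raw (enc_int v @ replicate h 0)))"
    proof (rule M(4))
      show "set (map Raw i) \<subseteq> S" using i by (fastforce simp: S_def)
      show "steps p (2 + (n + n2)) (Init1, [], map Raw i) = (Halt, ls, map Raw (enc_int v @ replicate h 0))"
        by (rule steps_trans[OF 1 steps_trans[OF 2(1) 3(2)]])
    qed (simp_all add: q0)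
    then have "tm_run M (2 + (n + n2)) (tm_start M, [], i) = (tm_halt M, map es ls, enc_int v @ replicate h 0)"
      by (simp only: mr M(2,3) list.map)
    \<comment> \<open>Two steps create the first column; the width stays at most
      \<open>1 + t\<close>, and the output makes two passes over it.\<close>
    moreover have "2 + (n + n2) \<le> (t + 1) * (2 * t + 2 * length i + 10)"
    proof -
      have "2 + (n + n2) \<le> t * (2 * (1 + t) + 2 * ?G + 2) + 2 * (1 + t) + 6"
      proof -
        have "2 + (n + n2) \<le> b + 2 * (1 + t) + 6" if "n \<le> b" for b using that 2(3) 3(1) by presburger
        from this[OF 2(4)] show ?thesis .
      qed
      also have "\<dots> \<le> (t + 1) * (2 * t + 2 * length i + 10)" by (simp add: algebra_simps)
      finally show ?thesis .
    qed
    ultimately show ?thesis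
      by (intro exI[of _ "2 + (n + n2)"]) (simp add: strip_blanks_replicate[OF zero_notin_enc_int])
  qed
  show ?thesis using M(1) main by blast
qed

section \<open>Arithmetic with addition and sign tests\<close>

text \<open>The time is an argument of \<open>Q\<close>, so that rewriting with the equations for
  straight-line code computes effect and cost together.\<close>

definition wp :: "cmd \<Rightarrow> rstate \<Rightarrow> (nat \<Rightarrow> rstate \<Rightarrow> bool) \<Rightarrow> bool" where
  "wp c s Q \<longleftrightarrow> (\<exists>t s'. runs c s t s' \<and> Q t s')"

inductive_cases runs_SkipE: "runs Skip s t s'"
inductive_cases runs_AddE: "runs (Add r a b c) s t s'"
inductive_cases runs_SeqE: "runs (Seq c1 c2) s t s'"
inductive_cases runs_IfNegE: "runs (IfNeg r c1 c2) s t s'"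

lemma wp_Skip [simp]: "wp Skip s Q = Q (Suc 0) s"
  unfolding wp_def by (blast elim: runs_SkipE intro: runs.intros)

lemma wp_Add [simp]: "wp (Add r a b c) s Q =
    Q (Suc 0) ((fst s)(r := op_val a (fst s) + op_val b (fst s) + of_bool c), snd s)"
proof -
  obtain \<sigma> i where s: "s = (\<sigma>, i)" by (cases s)
  show ?thesis unfolding wp_def s fst_conv snd_conv by (blast elim: runs_AddE intro: runs.intros)
qed

lemma wp_Seq [simp]: "wp (Seq c1 c2) s Q = wp c1 s (\<lambda>t1 s1. wp c2 s1 (\<lambda>t2. Q (Suc (t1 + t2))))"
  unfolding wp_def by (blast elim: runs_SeqE intro: runs.intros)

lemma wp_IfNeg [simp]:
  "wp (IfNeg r c1 c2) s Q = (if fst s r < 0 then wp c1 s (\<lambda>t. Q (Suc t)) else wp c2 s (\<lambda>t. Q (Suc t)))"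
  unfolding wp_def by (auto elim!: runs_IfNegE intro: BIfT BIfF; blast intro: BIfT BIfF)

lemma wp_WhileF: "\<not> fst s r < 0 \<Longrightarrow> Q (Suc 0) s \<Longrightarrow> wp (While r c) s Q"
  unfolding wp_def by (blast intro: runs.intros)

lemma wp_WhileT:
  "fst s r < 0 \<Longrightarrow> wp c s (\<lambda>t1 s1. wp (While r c) s1 (\<lambda>t2. Q (Suc (t1 + t2)))) \<Longrightarrow> wp (While r c) s Q"
  unfolding wp_def by (blast intro: runs.intros)

lemma wp_Read: "a \<in> {1..4} \<Longrightarrow> wp (select a c1 c2 c3 c4) (\<sigma>, i) (\<lambda>t. Q (Suc t)) \<Longrightarrow> wp (Read c1 c2 c3 c4) (\<sigma>, a # i) Q"
  unfolding wp_def by (blast intro: runs.intros)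

lemma wp_mono: "wp c s Q \<Longrightarrow> (\<And>t s'. Q t s' \<Longrightarrow> Q' t s') \<Longrightarrow> wp c s Q'"
  unfolding wp_def by blast

fun read_free :: "cmd \<Rightarrow> bool" where
  "read_free (Seq a b) = (read_free a \<and> read_free b)"
| "read_free (IfNeg r a b) = (read_free a \<and> read_free b)"
| "read_free (While r a) = read_free a"
| "read_free (Read a b c d) = False"
| "read_free c = True"

lemma runs_frame: "runs c s t s' \<Longrightarrow> r \<notin> regs c \<Longrightarrow> fst s' r = fst s r"
  by (induction rule: runs.induct) (auto split: if_splits)

lemma runs_read_free: "runs c s t s' \<Longrightarrow> read_free c \<Longrightarrow> snd s' = snd s"
  by (induction rule: runs.induct) auto

text \<open>Specifications below mention only the results of a command; that the other registers and
  the input are unchanged is added here from \<open>regs\<close> and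
  \<open>read_free\<close>.\<close>

lemma wp_frame:
  assumes "wp c (\<sigma>, i) Q" "read_free c"
    and "\<And>t \<sigma>'. Q t (\<sigma>', i) \<Longrightarrow> (\<And>r. r \<notin> regs c \<Longrightarrow> \<sigma>' r = \<sigma> r) \<Longrightarrow> Q' t (\<sigma>', i)"
  shows "wp c (\<sigma>, i) Q'"
proof -
  obtain t s' where r: "runs c (\<sigma>, i) t s'" "Q t s'" using assms(1) unfolding wp_def by blast
  have "s' = (fst s', i)" using runs_read_free[OF r(1) assms(2)] by (metis prod.collapse snd_conv)
  then have "Q' t s'" using assms(3)[of t "fst s'"] r runs_frame[OF r(1)] by simp
  then show ?thesis unfolding wp_def using r(1) by blast
qed

text \<open>\<open>m\<close> bounds the iterations left, each of which costs at most
  \<open>B\<close> and one test; the last summand 1 is the failing test.\<close>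

lemma wp_While_inv:
  assumes "Inv m s"
    and step: "\<And>m s. Inv m s \<Longrightarrow> fst s r < 0 \<Longrightarrow> m > 0 \<and> wp c s (\<lambda>t s'. t \<le> B \<and> Inv (m - 1) s')"
    and Q: "\<And>m' t s'. Inv m' s' \<Longrightarrow> \<not> fst s' r < 0 \<Longrightarrow> t \<le> m * (B + 1) + 1 \<Longrightarrow> Q t s'"
  shows "wp (While r c) s Q"
proof -
  have "wp (While r c) s (\<lambda>t s'. t \<le> m * (B + 1) + 1 \<and> (\<exists>m'. Inv m' s' \<and> \<not> fst s' r < 0))"
    using assms(1)
  proof (induction m arbitrary: s)
    case 0
    have "\<not> fst s r < 0" using step[OF 0] by auto
    then show ?case using 0 by (intro wp_WhileF) auto
  next
    case (Suc m)
    show ?case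
    proof (cases "fst s r < 0")
      case True
      have "wp c s (\<lambda>t s'. t \<le> B \<and> Inv m s')" using step[OF Suc.prems True] by simp
      then show ?thesis
      proof (intro wp_WhileT[OF True], elim wp_mono)
        fix t1 s1 assume *: "t1 \<le> B \<and> Inv m s1"
        show "wp (While r c) s1 (\<lambda>t2 s'. Suc (t1 + t2) \<le> Suc m * (B + 1) + 1 \<and> (\<exists>m'. Inv m' s' \<and> \<not> fst s' r < 0))"
        proof (rule wp_mono[OF Suc.IH[OF conjunct2[OF *]]], elim conjE, intro conjI)
          fix t2 assume "t2 \<le> m * (B + 1) + 1"
          then show "Suc (t1 + t2) \<le> Suc m * (B + 1) + 1" using * by simp
        qed
      qed
    next
      case False
      then show ?thesis using Suc.prems by (intro wp_WhileF) auto
    qed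
  qed
  then show ?thesis by (rule wp_mono) (use Q in blast)
qed

section \<open>Bit lengths and the size operator\<close>

definition fits :: "nat \<Rightarrow> int \<Rightarrow> bool" where "fits L z \<longleftrightarrow> \<bar>z\<bar> < 2 ^ L"

lemma fits_mono: "fits L z \<Longrightarrow> L \<le> L' \<Longrightarrow> fits L' z"
  unfolding fits_def using power_increasing[of L L' "2::int"] by linarith

lemma fits_abs_le: "fits L z \<Longrightarrow> \<bar>y\<bar> \<le> \<bar>z\<bar> \<Longrightarrow> fits L y"
  unfolding fits_def by linarith

text \<open>\<open>size_fn\<close> is the ordinary bit length; in this form it can be found by
  doubling.\<close>

lemma size_fn_eqI:
  assumes "\<bar>v\<bar> < 2 ^ n" "n = 0 \<or> 2 ^ (n - 1) \<le> \<bar>v\<bar>"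
  shows "size_fn v = int n"
proof -
  let ?x = "real_of_int (\<bar>v\<bar> + 1)"
  have "?x \<le> 2 ^ n"
    using assms(1) by (metis add1_zle_eq of_int_le_iff of_int_numeral of_int_power)
  then have "log 2 ?x \<le> n"
    by (subst log_le_iff) (auto simp: powr_realpow)
  moreover have "real n - 1 < log 2 ?x"
  proof (cases "n = 0")
    case True
    have "0 \<le> log 2 ?x" by (subst zero_le_log_cancel_iff) auto
    then show ?thesis using True by linarith
  next
    case False
    then have "(2::int) ^ (n - 1) < \<bar>v\<bar> + 1" using assms(2) by simp
    then have "2 ^ (n - 1) < ?x" by (metis of_int_less_iff of_int_numeral of_int_power)
    moreover have "2 powr real (n - 1) = (2::real) ^ (n - 1)" by (rule powr_realpow) simp
    ultimately have "2 powr real (n - 1) < ?x" by linarith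
    then have "real (n - 1) < log 2 ?x" by (subst less_log_iff) auto
    moreover have "real n - 1 = real (n - 1)" using False by simp
    ultimately show ?thesis by linarith
  qed
  ultimately show ?thesis unfolding size_fn_def by (simp add: ceiling_eq_iff)
qed

lemma size_fn_bounds:
  assumes "fits L v"
  shows "0 \<le> size_fn v" "size_fn v \<le> int L"
proof -
  define n where "n = (LEAST n. \<bar>v\<bar> < 2 ^ n)"
  have n: "\<bar>v\<bar> < 2 ^ n" "n \<le> L"
    using assms LeastI[of "\<lambda>n. \<bar>v\<bar> < 2 ^ n" L] Least_le[of "\<lambda>n. \<bar>v\<bar> < 2 ^ n" L] by (auto simp: n_def fits_def)
  have "n = 0 \<or> 2 ^ (n - 1) \<le> \<bar>v\<bar>"
    using not_less_Least[of "n - 1" "\<lambda>n. \<bar>v\<bar> < 2 ^ n"] n_def by force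
  from size_fn_eqI[OF n(1) this] n(2) show "0 \<le> size_fn v" "size_fn v \<le> int L" by auto
qed

abbreviation "mvr r a \<equiv> Add r (Pos a) (Const False) False"
abbreviation "zeror r \<equiv> Add r (Const False) (Const False) False"
abbreviation "oner r \<equiv> Add r (Const False) (Const False) True"
abbreviation "m1r r \<equiv> Add r (Const True) (Const False) False"
abbreviation "incr r \<equiv> Add r (Pos r) (Const False) True"
abbreviation "negr r a \<equiv> Add r (Cpl a) (Const False) True"
abbreviation "addr r a b \<equiv> Add r (Pos a) (Pos b) False"
abbreviation "subr r a b \<equiv> Add r (Pos a) (Cpl b) True"
text \<open>Omitting the initial carry gives \<open>a - b - 1\<close>, which is negative exactly
  when \<open>a \<le> b\<close>; this turns non-strict comparisons into sign tests.\<close>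

abbreviation "subm1r r a b \<equiv> Add r (Pos a) (Cpl b) False"
definition neg_if :: "reg \<Rightarrow> reg \<Rightarrow> cmd" where
  "neg_if r u = IfNeg r (negr u u) Skip"

lemma wp_neg_if [simp]:
  "wp (neg_if r u) s Q = Q 2 ((fst s)(u := if fst s r < 0 then - fst s u else fst s u), snd s)"
  by (simp add: neg_if_def numeral_2_eq_2)

lemma regs_neg_if [simp]: "regs (neg_if r u) = {r, u}" "read_free (neg_if r u)"
  by (auto simp: neg_if_def)

definition size_loop :: "reg \<Rightarrow> cmd" where
  "size_loop r = While (X 2) (Seq (addr (X 1) (X 1) (X 1)) (Seq (incr (X 0)) (subm1r (X 2) (X 1) r)))"

lemma wp_size_loop:
  assumes "\<sigma> r = v" "r \<notin> {X 0, X 1, X 2}" "0 \<le> v" "fits L v"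
    and "\<sigma> (X 0) = 0" "\<sigma> (X 1) = 1" "\<sigma> (X 2) = 1 - v - 1"
  shows "wp (size_loop r) (\<sigma>, i) (\<lambda>t s'. t \<le> 6 * L + 1 \<and> fst s' (X 0) = size_fn v)"
proof -
  \<comment> \<open>\<open>n = L - m\<close> counts the iterations done. \<open>X 2\<close> is
    negative as long as \<open>2 ^ n \<le> v\<close>, which \<open>fits L v\<close> excludes at
    \<open>n = L\<close>; the last conjunct is the lower bound that \<open>size_fn_eqI\<close> asks
    for.\<close>
  define Inv where "Inv = (\<lambda>m s. m \<le> L \<and> (let n = L - m; \<tau> = fst (s :: rstate) in
      \<tau> (X 0) = int n \<and> \<tau> (X 1) = 2 ^ n \<and> \<tau> (X 2) = 2 ^ n - v - 1 \<and> \<tau> r = v \<and> (n = 0 \<or> 2 ^ (n - 1) \<le> v)))"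
  show ?thesis unfolding size_loop_def
  proof (rule wp_While_inv[where Inv = Inv and m = L and B = 5])
    show "Inv L (\<sigma>, i)" using assms by (simp add: Inv_def Let_def)
  next
    fix m and s :: rstate
    assume I: "Inv m s" and neg: "fst s (X 2) < 0"
    obtain \<tau> j where s: "s = (\<tau>, j)" by (cases s)
    define n where "n = L - m"
    have n: "m \<le> L" "\<tau> (X 0) = int n" "\<tau> (X 1) = 2 ^ n" "\<tau> (X 2) = 2 ^ n - v - 1" "\<tau> r = v"
      using I s by (auto simp: Inv_def Let_def n_def)
    have nv: "2 ^ n \<le> v" using neg n s by simp
    have "(2::int) ^ n < 2 ^ L" using nv assms(3,4) unfolding fits_def by linarith
    then have m: "m > 0" using n(1) n_def by (cases m) auto
    have "L - (m - 1) = Suc n" using n(1) m n_def by simp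
    then show "0 < m \<and> wp (Seq (addr (X 1) (X 1) (X 1)) (Seq (incr (X 0)) (subm1r (X 2) (X 1) r))) s
        (\<lambda>t s'. t \<le> 5 \<and> Inv (m - 1) s')"
      using m n nv assms(2) s n_def by (auto simp: Inv_def Let_def)
  next
    fix m t and s' :: rstate
    assume "Inv m s'" "\<not> fst s' (X 2) < 0" "t \<le> L * (5 + 1) + 1"
    then show "t \<le> 6 * L + 1 \<and> fst s' (X 0) = size_fn v"
      using size_fn_eqI[of v "L - m"] assms(3) by (auto simp: Inv_def Let_def)
  qed
qed

definition csize :: "reg \<Rightarrow> cmd" where
  "csize r = Seq (neg_if r r) (Seq (zeror (X 0)) (Seq (oner (X 1)) (Seq (subm1r (X 2) (X 1) r)
     (Seq (size_loop r) (mvr r (X 0))))))"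

lemma size_fn_abs: "size_fn \<bar>v\<bar> = size_fn v" by (simp add: size_fn_def)

lemma wp_csize:
  assumes "\<sigma> r = v" "r \<notin> {X 0, X 1, X 2}" "fits L v"
  shows "wp (csize r) (\<sigma>, i) (\<lambda>t s'. t \<le> 6 * L + 20 \<and> fst s' r = size_fn v)"
proof -
  let ?\<sigma> = "\<sigma>(r := \<bar>v\<bar>, X 0 := 0, X 1 := 1, X 2 := - \<bar>v\<bar>)"
  have "wp (size_loop r) (?\<sigma>, i) (\<lambda>t s'. t \<le> 6 * L + 1 \<and> fst s' (X 0) = size_fn \<bar>v\<bar>)"
    by (rule wp_size_loop) (use assms in \<open>auto simp: fits_def\<close>)
  then have *: "wp (size_loop r) (?\<sigma>, i) (\<lambda>t1 s1. wp (mvr r (X 0)) s1 (\<lambda>t2 s'. t1 + t2 \<le> 6 * L + 2 \<and> fst s' r = size_fn v))"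
    by (rule wp_mono) (auto simp: size_fn_abs)
  have v: "(if v < 0 then - v else v) = \<bar>v\<bar>" by simp
  show ?thesis using assms * unfolding csize_def
    by (auto simp: v elim!: wp_mono)
qed

section \<open>Division by repeated doubling\<close>

definition shift_loop :: "reg \<Rightarrow> cmd" where
  "shift_loop u = While (X 6) (Seq (mvr (X 4) (X 7)) (Seq (addr (X 5) (X 5) (X 5))
     (Seq (addr (X 7) (X 4) (X 4)) (subm1r (X 6) (X 7) u))))"

text \<open>The test looks one doubling ahead: \<open>X 7\<close> is twice \<open>X 4\<close>, so
  the loop stops before \<open>X 4\<close> exceeds \<open>u\<close>. \<open>X 5\<close> is the power
  of two to be added to the quotient.\<close>

lemma wp_shift_loop:
  assumes "\<sigma> r = u" "r \<notin> range X" "fits L u" "\<sigma> (X 4) = w" "\<sigma> (X 5) = 1" "\<sigma> (X 7) = 2 * w"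
    "\<sigma> (X 6) = 2 * w - u - 1" "0 < w" "w \<le> u"
  shows "wp (shift_loop r) (\<sigma>, i) (\<lambda>t s'. t \<le> 8 * L + 1 \<and> fst s' (X 4) = fst s' (X 5) * w \<and>
     fst s' (X 4) \<le> u \<and> u < 2 * fst s' (X 4))"
proof -
  define Inv where "Inv = (\<lambda>m s. m \<le> L \<and> (let n = L - m; \<tau> = fst (s :: rstate) in
      \<tau> (X 5) = 2 ^ n \<and> \<tau> (X 4) = 2 ^ n * w \<and> \<tau> (X 7) = 2 * (2 ^ n * w) \<and> \<tau> (X 6) = 2 * (2 ^ n * w) - u - 1 \<and>
      \<tau> r = u \<and> 2 ^ n * w \<le> u))"
  show ?thesis unfolding shift_loop_def
  proof (rule wp_While_inv[where Inv = Inv and m = L and B = 7])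
    show "Inv L (\<sigma>, i)" using assms by (simp add: Inv_def Let_def)
  next
    fix m and s :: rstate
    assume I: "Inv m s" and neg: "fst s (X 6) < 0"
    obtain \<tau> j where s: "s = (\<tau>, j)" by (cases s)
    define n where "n = L - m"
    have n: "m \<le> L" "\<tau> (X 5) = 2 ^ n" "\<tau> (X 4) = 2 ^ n * w" "\<tau> (X 7) = 2 * (2 ^ n * w)"
      "\<tau> (X 6) = 2 * (2 ^ n * w) - u - 1" "\<tau> r = u" "2 ^ n * w \<le> u"
      using I s by (auto simp: Inv_def Let_def n_def)
    have "(2::int) ^ n * 1 \<le> 2 ^ n * w" using assms(8) by (intro mult_left_mono) auto
    then have "(2::int) ^ n < 2 ^ L" using n(7) assms(3) unfolding fits_def by linarith
    then have m: "m > 0" using n(1) n_def by (cases m) auto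
    have "L - (m - 1) = Suc n" using n(1) m n_def by simp
    then show "0 < m \<and> wp (Seq (mvr (X 4) (X 7)) (Seq (addr (X 5) (X 5) (X 5))
     (Seq (addr (X 7) (X 4) (X 4)) (subm1r (X 6) (X 7) r)))) s (\<lambda>t s'. t \<le> 7 \<and> Inv (m - 1) s')"
      using m n neg assms(2) s by (auto simp: Inv_def Let_def)
  next
    fix m t and s' :: rstate
    assume "Inv m s'" "\<not> fst s' (X 6) < 0" "t \<le> L * (7 + 1) + 1"
    then show "t \<le> 8 * L + 1 \<and> fst s' (X 4) = fst s' (X 5) * w \<and> fst s' (X 4) \<le> u \<and> u < 2 * fst s' (X 4)"
      by (auto simp: Inv_def Let_def)
  qed
qed

text \<open>Subtracts from \<open>u\<close> the largest \<open>2 ^ k * w\<close> not exceeding it, found anew each time by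
  doubling, so that no right shift is needed. This at least halves \<open>u\<close>.\<close>
definition div_body :: "reg \<Rightarrow> reg \<Rightarrow> cmd" where
  "div_body u w = Seq (mvr (X 4) w) (Seq (oner (X 5)) (Seq (addr (X 7) (X 4) (X 4)) (Seq (subm1r (X 6) (X 7) u)
     (Seq (shift_loop u) (Seq (subr u u (X 4)) (Seq (addr (X 2) (X 2) (X 5)) (subm1r (X 3) w u)))))))"

definition div_loop :: "reg \<Rightarrow> reg \<Rightarrow> cmd" where
  "div_loop u w = While (X 3) (div_body u w)"

lemma regs_shift_loop: "regs (shift_loop u) = {X 4, X 5, X 6, X 7}" "read_free (shift_loop u)"
  by (auto simp: shift_loop_def)

lemma wp_div_body:
  assumes "\<sigma> u = a" "\<sigma> w = b" "u \<notin> range X" "w \<notin> range X" "u \<noteq> w" "fits L a" "0 < b" "b \<le> a"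
  shows "wp (div_body u w) (\<sigma>, i) (\<lambda>t s'. t \<le> 8 * L + 20 \<and> (\<exists>a' p. fst s' u = a' \<and> fst s' w = b \<and> 0 \<le> a' \<and> 2 * a' < a \<and>
     fst s' (X 3) = b - a' - 1 \<and> fst s' (X 2) = \<sigma> (X 2) + p \<and> a = p * b + a'))"
proof -
  let ?\<sigma> = "\<sigma>(X 4 := b, X 5 := 1, X 7 := 2 * b, X 6 := 2 * b + (- a - 1))"
  have l: "wp (shift_loop u) (?\<sigma>, i) (\<lambda>t s'. t \<le> 8 * L + 1 \<and> fst s' (X 4) = fst s' (X 5) * b \<and>
     fst s' (X 4) \<le> a \<and> a < 2 * fst s' (X 4))"
    by (rule wp_shift_loop) (use assms in auto)
  have "wp (shift_loop u) (?\<sigma>, i) (\<lambda>t1 s1. wp (Seq (subr u u (X 4)) (Seq (addr (X 2) (X 2) (X 5)) (subm1r (X 3) w u))) s1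
     (\<lambda>t2 s'. t1 + t2 \<le> 8 * L + 6 \<and> (\<exists>a' p. fst s' u = a' \<and> fst s' w = b \<and> 0 \<le> a' \<and> 2 * a' < a \<and>
     fst s' (X 3) = b - a' - 1 \<and> fst s' (X 2) = \<sigma> (X 2) + p \<and> a = p * b + a')))"
    using l
  proof (rule wp_frame)
    fix t \<tau>
    assume t: "t \<le> 8 * L + 1 \<and> fst (\<tau>, i) (X 4) = fst (\<tau>, i) (X 5) * b \<and> fst (\<tau>, i) (X 4) \<le> a \<and> a < 2 * fst (\<tau>, i) (X 4)"
      and fr: "\<And>r. r \<notin> regs (shift_loop u) \<Longrightarrow> \<tau> r = ?\<sigma> r"
    have "\<tau> u = a" "\<tau> w = b" "\<tau> (X 2) = \<sigma> (X 2)"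
      using fr[of u] fr[of w] fr[of "X 2"] assms by (auto simp: regs_shift_loop)
    then show "wp (Seq (subr u u (X 4)) (Seq (addr (X 2) (X 2) (X 5)) (subm1r (X 3) w u))) (\<tau>, i)
     (\<lambda>t2 s'. t + t2 \<le> 8 * L + 6 \<and> (\<exists>a' p. fst s' u = a' \<and> fst s' w = b \<and> 0 \<le> a' \<and> 2 * a' < a \<and>
     fst s' (X 3) = b - a' - 1 \<and> fst s' (X 2) = \<sigma> (X 2) + p \<and> a = p * b + a'))"
      using t assms by auto
  qed (simp add: regs_shift_loop)
  moreover have "w \<noteq> X n" "u \<noteq> X n" "X n \<noteq> w" "X n \<noteq> u" for n using assms by auto
  ultimately show ?thesis using assms unfolding div_body_def
    by (auto elim!: wp_mono)
qed

lemma wp_div_loop: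
  assumes "\<sigma> u = a" "\<sigma> w = b" "u \<notin> range X" "w \<notin> range X" "u \<noteq> w" "fits L a" "0 < b" "0 \<le> a"
    "\<sigma> (X 2) = 0" "\<sigma> (X 3) = b - a - 1"
  shows "wp (div_loop u w) (\<sigma>, i) (\<lambda>t s'. t \<le> L * (8 * L + 21) + 1 \<and> fst s' (X 2) = a div b \<and> fst s' u = a mod b)"
proof -
  define Inv where "Inv = (\<lambda>m s. m \<le> L \<and> (let \<tau> = fst (s :: rstate) in
     \<tau> w = b \<and> 0 \<le> \<tau> u \<and> fits m (\<tau> u) \<and> \<tau> (X 3) = b - \<tau> u - 1 \<and> a = \<tau> (X 2) * b + \<tau> u))"
  show ?thesis unfolding div_loop_def
  proof (rule wp_While_inv[where Inv = Inv and m = L and B = "8 * L + 20"])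
    show "Inv L (\<sigma>, i)" using assms by (simp add: Inv_def Let_def)
  next
    fix m and s :: rstate
    assume I: "Inv m s" and neg: "fst s (X 3) < 0"
    obtain \<tau> j where s: "s = (\<tau>, j)" by (cases s)
    have n: "m \<le> L" "\<tau> w = b" "0 \<le> \<tau> u" "fits m (\<tau> u)" "\<tau> (X 3) = b - \<tau> u - 1" "a = \<tau> (X 2) * b + \<tau> u"
      using I s by (auto simp: Inv_def Let_def)
    have ge: "b \<le> \<tau> u" using n neg s by simp
    then have m: "m > 0" using n(4) assms(7) by (cases m) (auto simp: fits_def)
    \<comment> \<open>A number below half of an \<open>m\<close>-bit number has \<open>m - 1\<close>
      bits, so \<open>m\<close> bounds both the length of the current remainder and the number of
      passes left.\<close>
    have half: "fits (m - 1) z" if "0 \<le> z" "2 * z < \<tau> u" for z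
      using that n(3,4) m by (cases m) (auto simp: fits_def)
    have "wp (div_body u w) (\<tau>, j) (\<lambda>t s'. t \<le> 8 * L + 20 \<and> (\<exists>a' p. fst s' u = a' \<and> fst s' w = b \<and> 0 \<le> a' \<and> 2 * a' < \<tau> u \<and>
       fst s' (X 3) = b - a' - 1 \<and> fst s' (X 2) = \<tau> (X 2) + p \<and> \<tau> u = p * b + a'))"
      by (rule wp_div_body) (use n assms ge fits_mono[OF n(4,1)] in auto)
    then have "wp (div_body u w) s (\<lambda>t s'. t \<le> 8 * L + 20 \<and> Inv (m - 1) s')"
      unfolding s by (rule wp_mono) (use n half in \<open>auto simp: Inv_def Let_def algebra_simps\<close>)
    then show "0 < m \<and> wp (div_body u w) s (\<lambda>t s'. t \<le> 8 * L + 20 \<and> Inv (m - 1) s')" using m by blast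
  next
    fix m t and s' :: rstate
    assume I: "Inv m s'" and "\<not> fst s' (X 3) < 0" and t: "t \<le> L * (8 * L + 20 + 1) + 1"
    then have *: "0 \<le> fst s' u" "fst s' u < b" "a = fst s' (X 2) * b + fst s' u" by (auto simp: Inv_def Let_def)
    have "a div b = fst s' (X 2)" "a mod b = fst s' u"
      using * by (auto simp: div_pos_pos_trivial mod_pos_pos_trivial)
    then show "t \<le> L * (8 * L + 21) + 1 \<and> fst s' (X 2) = a div b \<and> fst s' u = a mod b"
      using t by (simp add: ac_simps)
  qed
qed

text \<open>The signs are saved in \<open>X 0\<close> and \<open>X 1\<close>, and absolute values
  are divided. \<open>X 3\<close> first becomes minus the absolute value of the divisor, so that its
  sign test detects division by 0.\<close>

definition div_mod :: "bool \<Rightarrow> reg \<Rightarrow> reg \<Rightarrow> cmd" where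
  "div_mod dv u w = Seq (mvr (X 0) u) (Seq (mvr (X 1) w) (Seq (neg_if u u) (Seq (neg_if w w) (Seq (zeror (X 2)) (Seq (negr (X 3) w)
     (IfNeg (X 3)
       (Seq (subm1r (X 3) w u) (Seq (div_loop u w)
         (if dv then Seq (mvr u (X 2)) (Seq (neg_if (X 0) u) (neg_if (X 1) u))
          else neg_if (X 0) u)))
       (zeror u)))))))"

lemma regs_div_loop: "regs (div_loop u w) = {X 2, X 3, X 4, X 5, X 6, X 7, u}" "read_free (div_loop u w)"
  by (auto simp: div_loop_def div_body_def regs_shift_loop)

lemma cmod_sgn: "b \<noteq> 0 \<Longrightarrow> cmod a b = sgn a * (\<bar>a\<bar> mod \<bar>b\<bar>)"
proof -
  assume b: "b \<noteq> 0"
  have "sgn a * (\<bar>a\<bar> mod \<bar>b\<bar>) = sgn a * (\<bar>a\<bar> - \<bar>b\<bar> * (\<bar>a\<bar> div \<bar>b\<bar>))"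
    by (simp add: minus_mult_div_eq_mod)
  also have "\<dots> = a - b * (sgn a * sgn b * (\<bar>a\<bar> div \<bar>b\<bar>))"
    by (simp add: right_diff_distrib mult_sgn_abs abs_sgn algebra_simps)
  finally show ?thesis using b by (simp add: cmod_def cdiv_def)
qed

lemma wp_div_mod:
  assumes "\<sigma> u = a" "\<sigma> w = b" "u \<notin> range X" "w \<notin> range X" "u \<noteq> w" "fits L a"
  shows "wp (div_mod dv u w) (\<sigma>, i) (\<lambda>t s'. t \<le> L * (8 * L + 21) + 40 \<and>
     fst s' u = (if dv then cdiv a b else cmod a b))"
proof -
  have ne: "w \<noteq> X n" "u \<noteq> X n" "X n \<noteq> w" "X n \<noteq> u" "w \<noteq> u" for n using assms by auto
  let ?t = "\<sigma>(X 0 := a, X 1 := b, u := \<bar>a\<bar>, w := \<bar>b\<bar>, X 2 := 0)"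
  let ?post = "(if dv then Seq (mvr u (X 2)) (Seq (neg_if (X 0) u) (neg_if (X 1) u))
          else neg_if (X 0) u)"
  let ?r = "if dv then cdiv a b else cmod a b"
  define R where "R = IfNeg (X 3) (Seq (subm1r (X 3) w u) (Seq (div_loop u w) ?post)) (zeror u)"
  have R: "wp R (?t(X 3 := - \<bar>b\<bar>), i) (\<lambda>t s'. t \<le> L * (8 * L + 21) + 20 \<and> fst s' u = ?r)"
  proof (cases "b = 0")
    case True
    then show ?thesis using ne by (simp add: R_def cdiv_def cmod_def)
  next
    case False
    let ?s = "?t(X 3 := \<bar>b\<bar> + (- \<bar>a\<bar> - 1))"
    have "wp (div_loop u w) (?s, i) (\<lambda>t s'. t \<le> L * (8 * L + 21) + 1 \<and> fst s' (X 2) = \<bar>a\<bar> div \<bar>b\<bar> \<and> fst s' u = \<bar>a\<bar> mod \<bar>b\<bar>)"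
      by (rule wp_div_loop) (use assms ne False in \<open>auto simp: fits_def\<close>)
    then have "wp (div_loop u w) (?s, i) (\<lambda>t1 s1. wp ?post s1 (\<lambda>t2 s'. t1 + t2 \<le> L * (8 * L + 21) + 10 \<and> fst s' u = ?r))"
    proof (rule wp_frame)
      fix t \<tau>
      assume t: "t \<le> L * (8 * L + 21) + 1 \<and> fst (\<tau>, i) (X 2) = \<bar>a\<bar> div \<bar>b\<bar> \<and> fst (\<tau>, i) u = \<bar>a\<bar> mod \<bar>b\<bar>"
        and fr: "\<And>r. r \<notin> regs (div_loop u w) \<Longrightarrow> \<tau> r = ?s r"
      have x: "\<tau> (X 0) = a" "\<tau> (X 1) = b" using fr[of "X 0"] fr[of "X 1"] ne by (auto simp: regs_div_loop)
      have z: "\<bar>a\<bar> div \<bar>b\<bar> = 0" "\<bar>a\<bar> mod \<bar>b\<bar> = 0" if "a = 0" using that by auto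
      show "wp ?post (\<tau>, i) (\<lambda>t2 s'. t + t2 \<le> L * (8 * L + 21) + 10 \<and> fst s' u = ?r)"
        using t x ne False z cmod_sgn[OF False, of a]
        by (cases dv; simp add: cdiv_def sgn_if; cases "a = 0"; simp)
    qed (simp add: regs_div_loop)
    then show ?thesis using ne False by (auto simp: R_def elim!: wp_mono)
  qed
  have v: "(if z < 0 then - z else z) = \<bar>z\<bar>" for z :: int by simp
  show ?thesis unfolding div_mod_def R_def[symmetric]
    using R assms ne by (auto simp: v elim!: wp_mono)
qed

section \<open>Expressions\<close>

text \<open>The only available test is for a negative sign, hence true is $-1$.\<close>
fun val_rep :: "val \<Rightarrow> int" where
  "val_rep (VInt i) = i"
| "val_rep (VBool b) = (if b then -1 else 0)"

definition store_rel :: "store \<Rightarrow> (reg \<Rightarrow> int) \<Rightarrow> bool" where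
  "store_rel \<Sigma> \<sigma> \<longleftrightarrow> (\<forall>x v. \<Sigma> x = Some v \<longrightarrow> \<sigma> (V x) = val_rep v)"

definition store_fits :: "nat \<Rightarrow> store \<Rightarrow> bool" where
  "store_fits L \<Sigma> \<longleftrightarrow> (\<forall>x v. \<Sigma> x = Some v \<longrightarrow> fits L (val_rep v))"

definition sign_to_bool :: "reg \<Rightarrow> cmd" where "sign_to_bool r = IfNeg r (m1r r) (zeror r)"

text \<open>The last equation serves \<open>ONot\<close>: the complement \<open>- x - 1\<close>
  exchanges the codes -1 and 0.\<close>

fun comp_unop :: "oper \<Rightarrow> reg \<Rightarrow> cmd" where
  "comp_unop ONeg r = negr r r"
| "comp_unop OSize r = csize r"
| "comp_unop _ r = Add r (Cpl r) (Const False) False"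

text \<open>For equality, \<open>X 0\<close> and \<open>X 1\<close> are negative iff the first
  operand is at most, respectively at least, the second; both are computed before \<open>u\<close>
  is overwritten.\<close>

fun comp_binop :: "oper \<Rightarrow> reg \<Rightarrow> reg \<Rightarrow> cmd" where
  "comp_binop OPlus u w = addr u u w"
| "comp_binop OMinus u w = subr u u w"
| "comp_binop ODiv u w = div_mod True u w"
| "comp_binop OMod u w = div_mod False u w"
| "comp_binop OAnd u w = IfNeg u (mvr u w) Skip"
| "comp_binop OOr u w = IfNeg u Skip (mvr u w)"
| "comp_binop OLt u w = Seq (subr u u w) (sign_to_bool u)"
| "comp_binop OLe u w = Seq (subm1r u u w) (sign_to_bool u)"
| "comp_binop OGt u w = Seq (subr u w u) (sign_to_bool u)"
| "comp_binop OGe u w = Seq (subm1r u w u) (sign_to_bool u)"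
| "comp_binop OEq u w = Seq (subm1r (X 0) u w) (Seq (subm1r (X 1) w u)
     (IfNeg (X 0) (IfNeg (X 1) (m1r u) (zeror u)) (zeror u)))"
| "comp_binop ONe u w = Seq (subm1r (X 0) u w) (Seq (subm1r (X 1) w u)
     (IfNeg (X 0) (IfNeg (X 1) (zeror u) (m1r u)) (m1r u)))"
| "comp_binop _ u w = Skip"

text \<open>Counting up is affordable because the literal is a constant of the program.\<close>

fun load_num :: "nat \<Rightarrow> reg \<Rightarrow> cmd" where
  "load_num 0 r = zeror r"
| "load_num (Suc n) r = Seq (load_num n r) (incr r)"

text \<open>The value is left in \<open>T d\<close>, and only scratch registers and stack cells from
  \<open>d\<close> upwards change. So the first operand survives in \<open>T d\<close> while the
  second is evaluated one cell higher.\<close>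

fun comp_expr :: "nat \<Rightarrow> expr \<Rightarrow> cmd" where
  "comp_expr d (Var x) = mvr (T d) (V x)"
| "comp_expr d (NumC n) = load_num n (T d)"
| "comp_expr d TrueC = m1r (T d)"
| "comp_expr d FalseC = zeror (T d)"
| "comp_expr d (Paren e) = comp_expr d e"
| "comp_expr d (Op opr [e]) = Seq (comp_expr d e) (comp_unop opr (T d))"
| "comp_expr d (Op opr [e1, e2]) = Seq (comp_expr d e1) (Seq (comp_expr (Suc d) e2) (comp_binop opr (T d) (T (Suc d))))"
| "comp_expr d (Op opr _) = Skip"

lemma int_args_Some: "int_args vs = Some is \<longleftrightarrow> vs = map VInt is"
  unfolding int_args_def by (auto simp: comp_def intro!: map_idI map_idI[symmetric]; force split: val.split)

lemma bool_args_Some: "bool_args vs = Some bs \<longleftrightarrow> vs = map VBool bs"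
  unfolding bool_args_def by (auto simp: comp_def intro!: map_idI map_idI[symmetric]; force split: val.split)

text \<open>Together with \<open>apply2\<close> this replaces the nested case distinctions of
  \<open>apply_op\<close> by one induction case per operator.\<close>

inductive apply1 :: "oper \<Rightarrow> val \<Rightarrow> val \<Rightarrow> bool" where
  "apply1 ONeg (VInt a) (VInt (- a))"
| "apply1 OSize (VInt a) (VInt (size_fn a))"
| "apply1 ONot (VBool p) (VBool (\<not> p))"

inductive apply2 :: "oper \<Rightarrow> val \<Rightarrow> val \<Rightarrow> val \<Rightarrow> bool" where
  "apply2 OPlus (VInt a) (VInt b) (VInt (a + b))"
| "apply2 OMinus (VInt a) (VInt b) (VInt (a - b))"
| "apply2 ODiv (VInt a) (VInt b) (VInt (cdiv a b))"
| "apply2 OMod (VInt a) (VInt b) (VInt (cmod a b))"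
| "apply2 OGe (VInt a) (VInt b) (VBool (a \<ge> b))"
| "apply2 OLe (VInt a) (VInt b) (VBool (a \<le> b))"
| "apply2 OGt (VInt a) (VInt b) (VBool (a > b))"
| "apply2 OLt (VInt a) (VInt b) (VBool (a < b))"
| "apply2 OEq (VInt a) (VInt b) (VBool (a = b))"
| "apply2 ONe (VInt a) (VInt b) (VBool (a \<noteq> b))"
| "apply2 OAnd (VBool p) (VBool q) (VBool (p \<and> q))"
| "apply2 OOr (VBool p) (VBool q) (VBool (p \<or> q))"

lemma apply_op_cases:
  assumes "apply_op opr vs = Some v"
  shows "(\<exists>a. vs = [a] \<and> apply1 opr a v) \<or> (\<exists>a b. vs = [a, b] \<and> apply2 opr a b v)"
  using assms unfolding apply_op_def
  by (cases opr) (auto simp: int_args_Some bool_args_Some split: option.splits list.splits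
      intro: apply1.intros apply2.intros)

lemma cdiv_abs_le: "\<bar>cdiv a b\<bar> \<le> \<bar>a\<bar>"
proof (cases "b = 0")
  case False
  have "\<bar>a\<bar> div \<bar>b\<bar> \<le> \<bar>a\<bar> div 1" using False by (intro zdiv_mono2) auto
  moreover have "0 \<le> \<bar>a\<bar> div \<bar>b\<bar>" by (simp add: div_int_pos_iff)
  ultimately show ?thesis using False by (auto simp: cdiv_def abs_mult sgn_if)
qed (simp add: cdiv_def)

lemma cmod_abs_le: "\<bar>cmod a b\<bar> \<le> \<bar>a\<bar>"
proof (cases "b = 0")
  case False
  have "\<bar>a\<bar> mod \<bar>b\<bar> \<le> \<bar>a\<bar>" by (rule zmod_le_nonneg_dividend) simp
  moreover have "0 \<le> \<bar>a\<bar> mod \<bar>b\<bar>" using False by simp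
  ultimately show ?thesis using False by (auto simp: cmod_sgn abs_mult sgn_if)
qed (simp add: cmod_def)

lemma fits_bool: "fits (Suc L) (val_rep (VBool b))"
proof -
  have "(1::int) < 2 ^ Suc L" by (rule one_less_power) simp_all
  then show ?thesis unfolding fits_def by (cases b) simp_all
qed

lemma less_two_power: "int n < 2 ^ n"
  by (rule of_nat_less_two_power)

lemma fits_size_fn: "fits L v \<Longrightarrow> fits L (size_fn v)"
  using size_fn_bounds[of L v] less_two_power[of L] unfolding fits_def by linarith

lemma apply1_fits: "apply1 opr a v \<Longrightarrow> fits L (val_rep a) \<Longrightarrow> fits (Suc L) (val_rep v)"
proof (induction rule: apply1.induct)
  case (2 a)
  then show ?case using fits_mono[OF fits_size_fn[of L a], of "Suc L"] by simp
next
  case (3 p)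
  show ?case by (rule fits_bool)
qed (simp add: fits_def)

lemma apply2_fits:
  assumes "apply2 opr a b v" "fits L (val_rep a)" "fits L (val_rep b)"
  shows "fits (Suc L) (val_rep v)"
  using assms
proof (induction rule: apply2.induct)
  case (3 a b)
  then show ?case using fits_abs_le[OF _ cdiv_abs_le] fits_mono[of L _ "Suc L"] by simp
next
  case (4 a b)
  then show ?case using fits_abs_le[OF _ cmod_abs_le] fits_mono[of L _ "Suc L"] by simp
qed (simp_all only: fits_bool, auto simp: fits_def)

lemma wp_comp_unop:
  assumes "apply1 opr a v" "\<sigma> r = val_rep a" "r \<notin> range X" "fits L (val_rep a)"
  shows "wp (comp_unop opr r) (\<sigma>, i) (\<lambda>t s'. t \<le> L * (8 * L + 21) + 40 \<and> fst s' r = val_rep v)"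
  using assms
proof (induction rule: apply1.induct)
  case (2 a)
  have "wp (csize r) (\<sigma>, i) (\<lambda>t s'. t \<le> 6 * L + 20 \<and> fst s' r = size_fn a)"
    by (rule wp_csize) (use 2 in auto)
  then show ?case unfolding comp_unop.simps by (rule wp_mono) (auto simp: algebra_simps)
qed auto

lemma wp_sign_to_bool [simp]: "wp (sign_to_bool r) s Q = Q 2 ((fst s)(r := if fst s r < 0 then -1 else 0), snd s)"
  by (simp add: sign_to_bool_def numeral_2_eq_2)

lemma wp_comp_binop:
  assumes "apply2 opr a b v" "\<sigma> u = val_rep a" "\<sigma> w = val_rep b" "u \<notin> range X" "w \<notin> range X" "u \<noteq> w" "fits L (val_rep a)"
  shows "wp (comp_binop opr u w) (\<sigma>, i) (\<lambda>t s'. t \<le> L * (8 * L + 21) + 40 \<and> fst s' u = val_rep v)"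
proof -
  have ne: "w \<noteq> X n" "u \<noteq> X n" "X n \<noteq> w" "X n \<noteq> u" "w \<noteq> u" for n using assms by auto
  show ?thesis using assms ne
  proof (induction rule: apply2.induct)
    case (3 a b)
    then show ?case using wp_div_mod[of \<sigma> u a w b L True i] by simp
  next
    case (4 a b)
    then show ?case using wp_div_mod[of \<sigma> u a w b L False i] by simp
  qed auto
qed

lemma wp_load_num: "wp (load_num n r) s (\<lambda>t s'. t = 2 * n + 1 \<and> fst s' r = int n)"
  by (induction n) (auto elim!: wp_mono)

lemma regs_load_num: "regs (load_num n r) = {r}" "read_free (load_num n r)"
  by (induction n) auto

lemma regs_size_loop: "regs (size_loop u) = {X 0, X 1, X 2}" "read_free (size_loop u)"
  by (auto simp: size_loop_def)

lemma regs_comp_unop: "regs (comp_unop opr r) \<subseteq> insert r (range X)" "read_free (comp_unop opr r)"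
  by (cases opr; auto simp: csize_def regs_size_loop)+

lemma regs_comp_binop: "regs (comp_binop opr u w) \<subseteq> {u, w} \<union> range X" "read_free (comp_binop opr u w)"
  by (cases opr; auto simp: div_mod_def sign_to_bool_def regs_div_loop)+

lemma regs_comp_expr: "regs (comp_expr d e) \<subseteq> T ` {d..} \<union> range X"
proof (induction d e rule: comp_expr.induct)
  case (6 d opr e)
  then show ?case using regs_comp_unop(1)[of opr "T d"] by auto
next
  case (7 d opr e1 e2)
  have "T ` {Suc d..} \<subseteq> T ` {d..}" by auto
  then show ?case using 7 regs_comp_binop(1)[of opr "T d" "T (Suc d)"] by auto
qed (auto simp: regs_load_num)

lemma read_free_comp_expr: "read_free (comp_expr d e)"
  by (induction d e rule: comp_expr.induct) (auto simp: regs_load_num regs_comp_unop regs_comp_binop)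

section \<open>Growth of values in expressions, and polynomial bounds\<close>

text \<open>Summing over the operands is a crude bound for their maximum, plus one bit for the
  operator. A literal \<open>n\<close> may be charged \<open>n\<close> bits since
  \<open>n < 2 ^ n\<close>; all that matters is independence of the store. \<open>TrueC\<close>
  takes one bit because its code is -1.\<close>

fun ebits :: "expr \<Rightarrow> nat" where
  "ebits (Var x) = 0"
| "ebits (NumC n) = n"
| "ebits TrueC = 1"
| "ebits FalseC = 0"
| "ebits (Op opr es) = Suc (sum_list (map ebits es))"
| "ebits (Paren e) = ebits e"

fun evars :: "expr \<Rightarrow> vname set" where
  "evars (Var x) = {x}"
| "evars (Op opr es) = (\<Union>e\<in>set es. evars e)"
| "evars (Paren e) = evars e"
| "evars _ = {}"

inductive_cases eval_VarE: "eval \<Sigma> (Var x) v"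
inductive_cases eval_NumE: "eval \<Sigma> (NumC n) v"
inductive_cases eval_TrueE: "eval \<Sigma> TrueC v"
inductive_cases eval_FalseE: "eval \<Sigma> FalseC v"
inductive_cases eval_ParenE: "eval \<Sigma> (Paren e) v"
inductive_cases eval_OpE: "eval \<Sigma> (Op opr es) v"

lemma eval_Op_cases:
  assumes "eval \<Sigma> (Op opr es) v"
  obtains e a where "es = [e]" "eval \<Sigma> e a" "apply1 opr a v"
  | e1 e2 a b where "es = [e1, e2]" "eval \<Sigma> e1 a" "eval \<Sigma> e2 b" "apply2 opr a b v"
  using assms by (elim eval_OpE) (auto dest!: apply_op_cases simp: list_all2_Cons2)

lemma eval_fits:
  assumes "eval \<Sigma> e v" "\<And>x u. x \<in> evars e \<Longrightarrow> \<Sigma> x = Some u \<Longrightarrow> fits L (val_rep u)"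
  shows "fits (L + ebits e) (val_rep v)"
  using assms
proof (induction e arbitrary: v)
  case (NumC n)
  have "fits n (int n)" using less_two_power[of n] unfolding fits_def by linarith
  then show ?case using NumC(1) fits_mono[of n "int n" "L + n"] by (auto elim!: eval_NumE)
next
  case TrueC
  then show ?case using fits_bool[of L True] by (auto elim!: eval_TrueE)
next
  case (Op opr es)
  from Op.prems(1) show ?case
  proof (cases rule: eval_Op_cases)
    case (1 e a)
    then have "fits (L + ebits e) (val_rep a)" using Op by auto
    then show ?thesis using apply1_fits[OF 1(3)] 1(1) by simp
  next
    case (2 e1 e2 a b)
    then have "fits (L + ebits e1) (val_rep a)" "fits (L + ebits e2) (val_rep b)" using Op by auto
    then have "fits (L + (ebits e1 + ebits e2)) (val_rep a)" "fits (L + (ebits e1 + ebits e2)) (val_rep b)"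
      by (auto elim!: fits_mono)
    then show ?thesis using apply2_fits[OF 2(4)] 2(1) by simp
  qed
qed (auto elim!: eval_VarE eval_FalseE eval_ParenE simp: fits_def)

lemma eval_store_fits: "eval \<Sigma> e v \<Longrightarrow> store_fits L \<Sigma> \<Longrightarrow> fits (L + ebits e) (val_rep v)"
  by (rule eval_fits) (auto simp: store_fits_def)

text \<open>Monotonicity is included because these functions are evaluated at upper estimates of bit
  lengths.\<close>

definition poly_bounded :: "(nat \<Rightarrow> nat) \<Rightarrow> bool" where
  "poly_bounded P \<longleftrightarrow> mono P \<and> (\<exists>c k. \<forall>n. P n \<le> c * (n + 1) ^ k)"

lemma poly_bounded_mono: "poly_bounded P \<Longrightarrow> m \<le> n \<Longrightarrow> P m \<le> P n"
  by (auto simp: poly_bounded_def mono_def)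

lemma poly_bounded_const: "poly_bounded (\<lambda>n. c)"
  unfolding poly_bounded_def by (intro conjI exI[of _ c] exI[of _ 0]) (simp_all add: mono_def)

lemma poly_bounded_id: "poly_bounded (\<lambda>n. n)"
  unfolding poly_bounded_def by (intro conjI exI[of _ 1]) (simp_all add: mono_def)

lemma poly_bounded_add: assumes "poly_bounded P" "poly_bounded Q" shows "poly_bounded (\<lambda>n. P n + Q n)"
proof -
  obtain c k where P: "\<And>n. P n \<le> c * (n + 1) ^ k" using assms(1) by (auto simp: poly_bounded_def)
  obtain c' k' where Q: "\<And>n. Q n \<le> c' * (n + 1) ^ k'" using assms(2) by (auto simp: poly_bounded_def)
  have "P n + Q n \<le> (c + c') * (n + 1) ^ (k + k')" for n
  proof -
    have "(n + 1) ^ k \<le> (n + 1) ^ (k + k')" "(n + 1) ^ k' \<le> (n + 1) ^ (k + k')"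
      by (intro power_increasing; simp)+
    then have "c * (n + 1) ^ k \<le> c * (n + 1) ^ (k + k')" "c' * (n + 1) ^ k' \<le> c' * (n + 1) ^ (k + k')"
      by (auto intro: mult_left_mono)
    then show ?thesis using P[of n] Q[of n] unfolding add_mult_distrib by linarith
  qed
  then show ?thesis using assms unfolding poly_bounded_def by (auto simp: mono_def intro: add_mono)
qed

lemma poly_bounded_mult: assumes "poly_bounded P" "poly_bounded Q" shows "poly_bounded (\<lambda>n. P n * Q n)"
proof -
  obtain c k where P: "\<And>n. P n \<le> c * (n + 1) ^ k" using assms(1) by (auto simp: poly_bounded_def)
  obtain c' k' where Q: "\<And>n. Q n \<le> c' * (n + 1) ^ k'" using assms(2) by (auto simp: poly_bounded_def)
  have "P n * Q n \<le> (c * c') * (n + 1) ^ (k + k')" for n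
    using mult_mono[OF P[of n] Q[of n]] by (simp add: power_add ac_simps)
  then show ?thesis using assms unfolding poly_bounded_def by (auto simp: mono_def intro: mult_mono)
qed

lemma poly_bounded_comp: assumes "poly_bounded P" "poly_bounded Q" shows "poly_bounded (\<lambda>n. P (Q n))"
proof -
  obtain c k where P: "\<And>n. P n \<le> c * (n + 1) ^ k" using assms(1) by (auto simp: poly_bounded_def)
  obtain c' k' where Q: "\<And>n. Q n \<le> c' * (n + 1) ^ k'" using assms(2) by (auto simp: poly_bounded_def)
  have "P (Q n) \<le> (c * (c' + 1) ^ k) * (n + 1) ^ (k' * k)" for n
  proof -
    have "1 \<le> (n + 1) ^ k'" by simp
    then have "Q n + 1 \<le> (c' + 1) * (n + 1) ^ k'" using Q[of n] unfolding add_mult_distrib by linarith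
    then have "(Q n + 1) ^ k \<le> ((c' + 1) * (n + 1) ^ k') ^ k" by (rule power_mono) simp
    then have "c * (Q n + 1) ^ k \<le> c * ((c' + 1) * (n + 1) ^ k') ^ k" by (rule mult_left_mono) simp
    then show ?thesis using P[of "Q n"] by (simp only: power_mult_distrib power_mult mult.assoc)
  qed
  then show ?thesis using assms unfolding poly_bounded_def by (auto simp: mono_def)
qed

lemmas poly_bounded_intros = poly_bounded_const poly_bounded_id poly_bounded_add poly_bounded_mult

lemma store_rel_cong: "store_rel \<Sigma> \<sigma> \<Longrightarrow> (\<And>x. \<sigma>' (V x) = \<sigma> (V x)) \<Longrightarrow> store_rel \<Sigma> \<sigma>'"
  by (auto simp: store_rel_def)

lemma wp_comp_expr:
  "\<exists>P. poly_bounded P \<and> (\<forall>\<Sigma> v L d \<sigma> i. eval \<Sigma> e v \<longrightarrow> store_fits L \<Sigma> \<longrightarrow> store_rel \<Sigma> \<sigma> \<longrightarrow>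
     wp (comp_expr d e) (\<sigma>, i) (\<lambda>t s'. t \<le> P L \<and> fst s' (T d) = val_rep v))"
proof (induction e)
  case (Var x)
  show ?case by (rule exI[of _ "\<lambda>_. 1"]) (auto simp: poly_bounded_const store_rel_def elim!: eval_VarE)
next
  case (NumC n)
  show ?case by (rule exI[of _ "\<lambda>_. 2 * n + 1"]) (auto simp: poly_bounded_const elim!: eval_NumE intro!: wp_mono[OF wp_load_num])
next
  case TrueC
  show ?case by (rule exI[of _ "\<lambda>_. 1"]) (auto simp: poly_bounded_const elim!: eval_TrueE)
next
  case FalseC
  show ?case by (rule exI[of _ "\<lambda>_. 1"]) (auto simp: poly_bounded_const elim!: eval_FalseE)
next
  case (Paren e)
  then obtain P where "poly_bounded P" and P: "\<And>\<Sigma> v L d \<sigma> i. eval \<Sigma> e v \<Longrightarrow> store_fits L \<Sigma> \<Longrightarrow> store_rel \<Sigma> \<sigma> \<Longrightarrow>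
     wp (comp_expr d e) (\<sigma>, i) (\<lambda>t s'. t \<le> P L \<and> fst s' (T d) = val_rep v)" by blast
  then show ?case by (intro exI[of _ P]) (auto elim!: eval_ParenE)
next
  case (Op opr es)
  \<comment> \<open>Division dominates: this is the common bound of \<open>wp_comp_unop\<close> and
    \<open>wp_comp_binop\<close>.\<close>
  define C where "C = (\<lambda>n. n * (8 * n + 21) + 40 :: nat)"
  have C: "poly_bounded C" unfolding C_def by (intro poly_bounded_intros)
  consider (one) e where "es = [e]" | (two) e1 e2 where "es = [e1, e2]" | (other) "\<nexists>e. es = [e]" "\<nexists>e1 e2. es = [e1, e2]"
    by blast
  then show ?case
  proof cases
    case one
    then obtain P where pP: "poly_bounded P" and P: "\<And>\<Sigma> v L d \<sigma> i. eval \<Sigma> e v \<Longrightarrow> store_fits L \<Sigma> \<Longrightarrow> store_rel \<Sigma> \<sigma> \<Longrightarrow>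
       wp (comp_expr d e) (\<sigma>, i) (\<lambda>t s'. t \<le> P L \<and> fst s' (T d) = val_rep v)" using Op by force
    show ?thesis
    proof (rule exI[of _ "\<lambda>n. P n + C (n + ebits e) + 1"], intro conjI allI impI)
      show "poly_bounded (\<lambda>n. P n + C (n + ebits e) + 1)" by (intro poly_bounded_intros pP poly_bounded_comp[OF C])
      fix \<Sigma> v L d \<sigma> i
      assume h: "eval \<Sigma> (Op opr es) v" "store_fits L \<Sigma>" "store_rel \<Sigma> \<sigma>"
      obtain a where a: "eval \<Sigma> e a" "apply1 opr a v"
        using h(1) one by (cases rule: eval_Op_cases) auto
      have "wp (comp_expr d e) (\<sigma>, i) (\<lambda>t1 s1. wp (comp_unop opr (T d)) s1 (\<lambda>t2 s'. Suc (t1 + t2) \<le> P L + C (L + ebits e) + 1 \<and> fst s' (T d) = val_rep v))"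
        using P[OF a(1) h(2,3)]
      proof (rule wp_frame[OF _ read_free_comp_expr])
        fix t \<tau> assume "t \<le> P L \<and> fst (\<tau>, i) (T d) = val_rep a"
        then show "wp (comp_unop opr (T d)) (\<tau>, i) (\<lambda>t2 s'. Suc (t + t2) \<le> P L + C (L + ebits e) + 1 \<and> fst s' (T d) = val_rep v)"
          by (intro wp_mono[OF wp_comp_unop[OF a(2) _ _ eval_store_fits[OF a(1) h(2)]]]) (auto simp: C_def)
      qed
      then show "wp (comp_expr d (Op opr es)) (\<sigma>, i) (\<lambda>t s'. t \<le> P L + C (L + ebits e) + 1 \<and> fst s' (T d) = val_rep v)"
        using one by simp
    qed
  next
    case two
    obtain P1 where pP1: "poly_bounded P1" and P1: "\<And>\<Sigma> v L d \<sigma> i. eval \<Sigma> e1 v \<Longrightarrow> store_fits L \<Sigma> \<Longrightarrow> store_rel \<Sigma> \<sigma> \<Longrightarrow>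
       wp (comp_expr d e1) (\<sigma>, i) (\<lambda>t s'. t \<le> P1 L \<and> fst s' (T d) = val_rep v)" using Op[of e1] two by force
    obtain P2 where pP2: "poly_bounded P2" and P2: "\<And>\<Sigma> v L d \<sigma> i. eval \<Sigma> e2 v \<Longrightarrow> store_fits L \<Sigma> \<Longrightarrow> store_rel \<Sigma> \<sigma> \<Longrightarrow>
       wp (comp_expr d e2) (\<sigma>, i) (\<lambda>t s'. t \<le> P2 L \<and> fst s' (T d) = val_rep v)" using Op[of e2] two by force
    define P where "P = (\<lambda>n. P1 n + P2 n + C (n + ebits e1) + 2)"
    show ?thesis
    proof (rule exI[of _ P], intro conjI allI impI)
      show "poly_bounded P" unfolding P_def by (intro poly_bounded_intros pP1 pP2 poly_bounded_comp[OF C])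
      fix \<Sigma> v L d \<sigma> i
      assume h: "eval \<Sigma> (Op opr es) v" "store_fits L \<Sigma>" "store_rel \<Sigma> \<sigma>"
      obtain a b where a: "eval \<Sigma> e1 a" "eval \<Sigma> e2 b" "apply2 opr a b v"
        using h(1) two by (cases rule: eval_Op_cases) auto
      have "wp (comp_expr d e1) (\<sigma>, i) (\<lambda>t1 s1. wp (comp_expr (Suc d) e2) s1 (\<lambda>t2 s2.
          wp (comp_binop opr (T d) (T (Suc d))) s2 (\<lambda>t3 s'. Suc (t1 + Suc (t2 + t3)) \<le> P L \<and> fst s' (T d) = val_rep v)))"
        using P1[OF a(1) h(2,3)]
      proof (rule wp_frame[OF _ read_free_comp_expr])
        fix t1 \<tau>
        assume t1: "t1 \<le> P1 L \<and> fst (\<tau>, i) (T d) = val_rep a" and fr1: "\<And>r. r \<notin> regs (comp_expr d e1) \<Longrightarrow> \<tau> r = \<sigma> r"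
        have store_rel: "store_rel \<Sigma> \<tau>" using h(3) by (rule store_rel_cong) (use fr1 regs_comp_expr[of d e1] in auto)
        show "wp (comp_expr (Suc d) e2) (\<tau>, i) (\<lambda>t2 s2.
          wp (comp_binop opr (T d) (T (Suc d))) s2 (\<lambda>t3 s'. Suc (t1 + Suc (t2 + t3)) \<le> P L \<and> fst s' (T d) = val_rep v))"
          using P2[OF a(2) h(2) store_rel]
        proof (rule wp_frame[OF _ read_free_comp_expr])
          fix t2 \<rho>
          assume t2: "t2 \<le> P2 L \<and> fst (\<rho>, i) (T (Suc d)) = val_rep b" and fr2: "\<And>r. r \<notin> regs (comp_expr (Suc d) e2) \<Longrightarrow> \<rho> r = \<tau> r"
          have "T d \<notin> regs (comp_expr (Suc d) e2)" using regs_comp_expr[of "Suc d" e2] by auto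
          then have "\<rho> (T d) = val_rep a" using fr2 t1 by simp
          then show "wp (comp_binop opr (T d) (T (Suc d))) (\<rho>, i) (\<lambda>t3 s'. Suc (t1 + Suc (t2 + t3)) \<le> P L \<and> fst s' (T d) = val_rep v)"
            using t1 t2 by (intro wp_mono[OF wp_comp_binop[OF a(3) _ _ _ _ _ eval_store_fits[OF a(1) h(2)]]]) (auto simp: C_def P_def)
        qed
      qed
      then show "wp (comp_expr d (Op opr es)) (\<sigma>, i) (\<lambda>t s'. t \<le> P L \<and> fst s' (T d) = val_rep v)"
        using two by simp
    qed
  next
    case other
    then have "\<not> eval \<Sigma> (Op opr es) v" for \<Sigma> v by (auto elim!: eval_Op_cases)
    then show ?thesis using poly_bounded_const by blast
  qed
qed

section \<open>Statements and their cost\<close>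

text \<open>\<open>D h\<close> holds the counter minus the bound, which is negative exactly while
  iterations remain, so it serves directly as loop test. The body is compiled at depth
  \<open>Suc h\<close> and therefore leaves \<open>J h\<close> and \<open>D h\<close> alone.\<close>

fun comp_stmt :: "nat \<Rightarrow> stmt \<Rightarrow> cmd" and comp_seq :: "nat \<Rightarrow> stmt list \<Rightarrow> cmd" where
  "comp_stmt h (Decl t x) = zeror (V x)"
| "comp_stmt h (Assign x e) = Seq (comp_expr 0 e) (mvr (V x) (T 0))"
| "comp_stmt h (Block ss) = comp_seq h ss"
| "comp_stmt h (If e s1 s2) = Seq (comp_expr 0 e) (IfNeg (T 0) (comp_stmt h s1) (comp_stmt h s2))"
| "comp_stmt h (For x e s) = Seq (comp_expr 0 (Op OSize [e])) (Seq (zeror (J h)) (Seq (negr (D h) (T 0))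
     (While (D h) (Seq (mvr (V x) (J h)) (Seq (comp_stmt (Suc h) s) (Seq (incr (J h)) (incr (D h))))))))"
| "comp_seq h [] = Skip"
| "comp_seq h (s # ss) = Seq (comp_stmt h s) (comp_seq h ss)"

lemma regs_comp_stmt:
  "regs (comp_stmt h s) \<subseteq> range V \<union> range T \<union> range X \<union> J ` {h..} \<union> D ` {h..}"
  "regs (comp_seq h ss) \<subseteq> range V \<union> range T \<union> range X \<union> J ` {h..} \<union> D ` {h..}"
proof (induction h s and h ss rule: comp_stmt_comp_seq.induct)
  case (2 h x e)
  then show ?case using regs_comp_expr[of 0 e] by auto
next
  case (4 h e s1 s2)
  then show ?case using regs_comp_expr[of 0 e] by auto
next
  case (5 h x e s)
  have "J ` {Suc h..} \<subseteq> J ` {h..}" "D ` {Suc h..} \<subseteq> D ` {h..}" by auto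
  then show ?case using 5 regs_comp_expr[of 0 "Op OSize [e]"] by (auto simp del: comp_expr.simps)
qed auto

lemma read_free_comp_stmt: "read_free (comp_stmt h s)" "read_free (comp_seq h ss)"
  by (induction h s and h ss rule: comp_stmt_comp_seq.induct) (auto simp: read_free_comp_expr simp del: comp_expr.simps)

definition iint_fits :: "tenv \<Rightarrow> nat \<Rightarrow> store \<Rightarrow> bool" where
  "iint_fits \<Gamma> I \<Sigma> \<longleftrightarrow> (\<forall>x v. \<Gamma> x = Some TIInt \<longrightarrow> \<Sigma> x = Some v \<longrightarrow> fits I (val_rep v))"

definition iint_same :: "tenv \<Rightarrow> store \<Rightarrow> store \<Rightarrow> bool" where
  "iint_same \<Gamma> \<Sigma> \<Sigma>' \<longleftrightarrow> (\<forall>x. \<Gamma> x = Some TIInt \<longrightarrow> \<Sigma>' x = \<Sigma> x)"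

text \<open>\<open>L\<close> bounds the bit length of all values and \<open>I\<close> that of the iint values. Inside loops the
  increase of \<open>L\<close> must depend on \<open>I\<close> only, as otherwise iterating the body would not stay polynomial.\<close>
definition poly_sim :: "tenv \<Rightarrow> bool \<Rightarrow> (store \<Rightarrow> store \<Rightarrow> bool) \<Rightarrow> (nat \<Rightarrow> cmd) \<Rightarrow> (nat \<Rightarrow> nat) \<Rightarrow> (nat \<Rightarrow> nat) \<Rightarrow> bool" where
  "poly_sim \<Gamma> lp E c A P \<longleftrightarrow> poly_bounded A \<and> poly_bounded P \<and> (\<forall>h \<Sigma> \<Sigma>' \<sigma> i I L. E \<Sigma> \<Sigma>' \<longrightarrow> store_rel \<Sigma> \<sigma> \<longrightarrow> store_fits L \<Sigma> \<longrightarrow>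
     (lp \<longrightarrow> iint_fits \<Gamma> I \<Sigma>) \<longrightarrow> I \<le> L \<longrightarrow>
     store_fits (if lp then L + A I else A L) \<Sigma>' \<and> (lp \<longrightarrow> iint_same \<Gamma> \<Sigma> \<Sigma>') \<and>
     wp (c h) (\<sigma>, i) (\<lambda>t s'. t \<le> P L \<and> store_rel \<Sigma>' (fst s')))"

lemma poly_simI:
  assumes "poly_bounded A" "poly_bounded P"
    and "\<And>h \<Sigma> \<Sigma>' \<sigma> i I L. E \<Sigma> \<Sigma>' \<Longrightarrow> store_rel \<Sigma> \<sigma> \<Longrightarrow> store_fits L \<Sigma> \<Longrightarrow> (lp \<Longrightarrow> iint_fits \<Gamma> I \<Sigma>) \<Longrightarrow> I \<le> L \<Longrightarrow>
      store_fits (if lp then L + A I else A L) \<Sigma>' \<and> (lp \<longrightarrow> iint_same \<Gamma> \<Sigma> \<Sigma>') \<and>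
      wp (c h) (\<sigma>, i) (\<lambda>t s'. t \<le> P L \<and> store_rel \<Sigma>' (fst s'))"
  shows "poly_sim \<Gamma> lp E c A P"
  using assms unfolding poly_sim_def by blast

lemma poly_simD:
  assumes "poly_sim \<Gamma> lp E c A P" "E \<Sigma> \<Sigma>'" "store_rel \<Sigma> \<sigma>" "store_fits L \<Sigma>" "lp \<Longrightarrow> iint_fits \<Gamma> I \<Sigma>" "I \<le> L"
  shows "store_fits (if lp then L + A I else A L) \<Sigma>'" "lp \<Longrightarrow> iint_same \<Gamma> \<Sigma> \<Sigma>'"
    "wp (c h) (\<sigma>, i) (\<lambda>t s'. t \<le> P L \<and> store_rel \<Sigma>' (fst s'))"
  using assms unfolding poly_sim_def by blast+

lemma poly_sim_poly_bounded: assumes "poly_sim \<Gamma> lp E c A P" shows "poly_bounded A" "poly_bounded P"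
  using assms unfolding poly_sim_def by auto

lemma store_fits_mono: "store_fits L \<Sigma> \<Longrightarrow> L \<le> L' \<Longrightarrow> store_fits L' \<Sigma>"
  unfolding store_fits_def using fits_mono by blast

lemma store_fits_upd: "store_fits L \<Sigma> \<Longrightarrow> fits L (val_rep v) \<Longrightarrow> store_fits L (\<Sigma>(x \<mapsto> v))"
  unfolding store_fits_def by auto

lemma store_rel_upd: "store_rel \<Sigma> \<sigma> \<Longrightarrow> store_rel (\<Sigma>(x \<mapsto> v)) (\<sigma>(V x := val_rep v))"
  unfolding store_rel_def by auto

text \<open>A supremum is iint only if both operands are, and comparisons yield bool. So the length
  of an iint value depends on \<open>I\<close> and the expression only.\<close>

lemma ty_expr_iint_vars: "ty_expr \<Gamma> lp e t \<Longrightarrow> t = TIInt \<Longrightarrow> x \<in> evars e \<Longrightarrow> \<Gamma> x = Some TIInt"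
  by (induction arbitrary: x rule: ty_expr.induct) (auto simp: ty_sup_def split: if_splits)

inductive_cases exec_DeclE: "exec \<Sigma> (Decl t x) \<Sigma>'"
inductive_cases exec_AssignE: "exec \<Sigma> (Assign x e) \<Sigma>'"
inductive_cases exec_BlockE: "exec \<Sigma> (Block ss) \<Sigma>'"
inductive_cases exec_IfE: "exec \<Sigma> (If e s1 s2) \<Sigma>'"
inductive_cases exec_ForE: "exec \<Sigma> (For x e s) \<Sigma>'"
inductive_cases exec_seq_NilE: "exec_seq \<Sigma> [] \<Sigma>'"
inductive_cases exec_seq_ConsE: "exec_seq \<Sigma> (s # ss) \<Sigma>'"
inductive_cases exec_loopE: "exec_loop x s j n \<Sigma> \<Sigma>'"

text \<open>Only declarations change the environment, and inside loops those of iint variables are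
  ill-typed. Hence \<open>I\<close> refers to the same variables all along a sequence.\<close>

lemma ty_loop_iint:
  "ty_stmt \<Gamma> lp s \<Gamma>' \<Longrightarrow> lp \<Longrightarrow> \<Gamma>' x = Some TIInt \<longleftrightarrow> \<Gamma> x = Some TIInt"
  by (erule ty_stmt.cases) auto

lemma wp_loop_body:
  assumes "wp c (\<sigma>(V x := \<sigma> (J h)), i) (\<lambda>t s. Q (t + 6) ((fst s)(J h := fst s (J h) + 1, D h := fst s (D h) + 1), snd s))"
  shows "wp (Seq (mvr (V x) (J h)) (Seq c (Seq (incr (J h)) (incr (D h))))) (\<sigma>, i) Q"
  using assms by (simp add: numeral_eq_Suc)

text \<open>Each iteration preserves the iint variables of \<open>\<Gamma>\<close>, hence the bound
  \<open>I\<close>, so all of them lengthen the values by the same \<open>A I\<close>. Time is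
  charged at the final length \<open>L + k * A I\<close> throughout; of the 7 extra units, six
  handle the counters and one is the loop test.\<close>

lemma loop_poly_sim:
  assumes body: "poly_sim (\<Gamma>(x \<mapsto> TIInt)) True (\<lambda>\<Sigma> \<Sigma>'. exec \<Sigma> s \<Sigma>') (\<lambda>h. comp_stmt h s) A P" and x: "x \<notin> dom \<Gamma>"
    and "exec_loop x s j n \<Sigma> \<Sigma>'" "nat (n - j) = k" "0 \<le> j" "n \<le> int I" "I \<le> L"
    and "store_rel \<Sigma> \<sigma>" "store_fits L \<Sigma>" "iint_fits \<Gamma> I \<Sigma>" "\<sigma> (J h) = j" "\<sigma> (D h) = j - n"
  shows "store_fits (L + k * A I) \<Sigma>' \<and> iint_same \<Gamma> \<Sigma> \<Sigma>' \<and>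
    wp (While (D h) (Seq (mvr (V x) (J h)) (Seq (comp_stmt (Suc h) s) (Seq (incr (J h)) (incr (D h)))))) (\<sigma>, i)
      (\<lambda>t s'. t \<le> k * (P (L + k * A I) + 7) + 1 \<and> store_rel \<Sigma>' (fst s'))"
  using assms(3-)
proof (induction k arbitrary: j \<Sigma> L \<sigma>)
  case 0
  then have "\<Sigma>' = \<Sigma>" by (auto elim: exec_loopE)
  then show ?case using 0 by (auto simp: iint_same_def intro!: wp_WhileF)
next
  case (Suc k)
  have jn: "j < n" using Suc.prems(2) by simp
  then obtain \<Sigma>1 where ex: "exec (\<Sigma>(x \<mapsto> VInt j)) s \<Sigma>1" "exec_loop x s (j + 1) n \<Sigma>1 \<Sigma>'"
    using Suc.prems(1) by (auto elim: exec_loopE)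
  let ?\<sigma> = "\<sigma>(V x := j)"
  have fj: "fits I j" using less_two_power[of I] jn Suc.prems(3,4) unfolding fits_def by linarith
  have r1: "store_rel (\<Sigma>(x \<mapsto> VInt j)) ?\<sigma>" using store_rel_upd[OF Suc.prems(6), of x "VInt j"] by simp
  have b1: "store_fits L (\<Sigma>(x \<mapsto> VInt j))" using Suc.prems(7) fits_mono[OF fj Suc.prems(5)] by (intro store_fits_upd) auto
  have i1: "iint_fits (\<Gamma>(x \<mapsto> TIInt)) I (\<Sigma>(x \<mapsto> VInt j))" using Suc.prems(8) fj by (auto simp: iint_fits_def)
  note o = poly_simD[OF body ex(1) r1 b1 i1 Suc.prems(5)]
  have b2: "store_fits (L + A I) \<Sigma>1" using o(1) by simp
  have same: "iint_same \<Gamma> \<Sigma> \<Sigma>1"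
    unfolding iint_same_def
  proof (intro allI impI)
    fix y assume y: "\<Gamma> y = Some TIInt"
    then have "y \<noteq> x" using x by auto
    then show "\<Sigma>1 y = \<Sigma> y" using o(2) y by (simp add: iint_same_def)
  qed
  then have i2: "iint_fits \<Gamma> I \<Sigma>1" using Suc.prems(8) by (simp add: iint_fits_def iint_same_def)
  have L2: "I \<le> L + A I" using Suc.prems(5) by simp
  have k2: "nat (n - (j + 1)) = k" using Suc.prems(2) by simp
  note IH = Suc.IH[OF ex(2) k2 _ Suc.prems(4) L2 _ b2 i2]
  let ?B = "P (L + Suc k * A I) + 7"
  have e: "L + A I + k * A I = L + Suc k * A I" by simp
  have pl: "P L \<le> P (L + Suc k * A I)" using poly_sim_poly_bounded(2)[OF body] by (rule poly_bounded_mono) simp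
  \<comment> \<open>The claim about stores is available only for a register state that represents
    the store, so one is made up.\<close>
  have "\<exists>\<tau>. store_rel \<Sigma>1 \<tau> \<and> \<tau> (J h) = j + 1 \<and> \<tau> (D h) = j + 1 - n"
    by (rule exI[of _ "\<lambda>r. case r of V y \<Rightarrow> val_rep (the (\<Sigma>1 y)) | J _ \<Rightarrow> j + 1 | D _ \<Rightarrow> j + 1 - n | _ \<Rightarrow> 0"])
       (auto simp: store_rel_def)
  then have 1: "store_fits (L + Suc k * A I) \<Sigma>' \<and> iint_same \<Gamma> \<Sigma>1 \<Sigma>'"
    using IH Suc.prems(3) e by (metis add_nonneg_nonneg zero_le_one)
  have "wp (Seq (mvr (V x) (J h)) (Seq (comp_stmt (Suc h) s) (Seq (incr (J h)) (incr (D h))))) (\<sigma>, i) (\<lambda>t1 s1.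
      wp (While (D h) (Seq (mvr (V x) (J h)) (Seq (comp_stmt (Suc h) s) (Seq (incr (J h)) (incr (D h)))))) s1
      (\<lambda>t2 s'. Suc (t1 + t2) \<le> Suc k * ?B + 1 \<and> store_rel \<Sigma>' (fst s')))"
    (is "wp _ _ ?Q")
  proof -
    have "wp (comp_stmt (Suc h) s) (?\<sigma>, i) (\<lambda>t s. ?Q (t + 6) ((fst s)(J h := fst s (J h) + 1, D h := fst s (D h) + 1), snd s))"
      using o(3)
    proof (rule wp_frame[OF _ read_free_comp_stmt(1)])
      fix t \<tau>
      assume t: "t \<le> P L \<and> store_rel \<Sigma>1 (fst (\<tau>, i))" and fr: "\<And>r. r \<notin> regs (comp_stmt (Suc h) s) \<Longrightarrow> \<tau> r = ?\<sigma> r"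
      have "J h \<notin> regs (comp_stmt (Suc h) s)" "D h \<notin> regs (comp_stmt (Suc h) s)" using regs_comp_stmt(1)[of "Suc h" s] by auto
      then have jd: "\<tau> (J h) = j" "\<tau> (D h) = j - n" using fr Suc.prems(9,10) by auto
      let ?\<tau> = "\<tau>(J h := \<tau> (J h) + 1, D h := \<tau> (D h) + 1)"
      have r2: "store_rel \<Sigma>1 ?\<tau>" using t by (auto intro: store_rel_cong)
      have "wp (While (D h) (Seq (mvr (V x) (J h)) (Seq (comp_stmt (Suc h) s) (Seq (incr (J h)) (incr (D h)))))) (?\<tau>, i)
        (\<lambda>t s'. t \<le> k * ?B + 1 \<and> store_rel \<Sigma>' (fst s'))"
        using IH[OF _ r2] jd Suc.prems(3) unfolding e by (simp add: fun_upd_def)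
      then show "?Q (t + 6) ((fst (\<tau>, i))(J h := fst (\<tau>, i) (J h) + 1, D h := fst (\<tau>, i) (D h) + 1), snd (\<tau>, i))"
        unfolding fst_conv snd_conv
      proof (rule wp_mono)
        fix t2 s' assume "t2 \<le> k * ?B + 1 \<and> store_rel \<Sigma>' (fst s')"
        then show "Suc (t + 6 + t2) \<le> Suc k * ?B + 1 \<and> store_rel \<Sigma>' (fst s')" using t pl unfolding mult_Suc by linarith
      qed
    qed
    then show ?thesis by (intro wp_loop_body[where Q = ?Q]) (simp only: Suc.prems(9))
  qed
  then have "wp (While (D h) (Seq (mvr (V x) (J h)) (Seq (comp_stmt (Suc h) s) (Seq (incr (J h)) (incr (D h)))))) (\<sigma>, i)
      (\<lambda>t s'. t \<le> Suc k * ?B + 1 \<and> store_rel \<Sigma>' (fst s'))"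
    by (intro wp_WhileT) (use Suc.prems(10) jn in simp)
  then show ?case using 1 same by (simp add: iint_same_def)
qed

lemma poly_sim_For:
  assumes e: "ty_expr \<Gamma> lp (Op OSize [e]) TIInt" and x: "x \<notin> dom \<Gamma>"
    and body: "poly_sim (\<Gamma>(x \<mapsto> TIInt)) True (\<lambda>\<Sigma> \<Sigma>'. exec \<Sigma> s \<Sigma>') (\<lambda>h. comp_stmt h s) A P"
  shows "\<exists>A P. poly_sim \<Gamma> lp (\<lambda>\<Sigma> \<Sigma>'. exec \<Sigma> (For x e s) \<Sigma>') (\<lambda>h. comp_stmt h (For x e s)) A P"
proof -
  let ?e = "Op OSize [e]"
  obtain Pe where pPe: "poly_bounded Pe" and Pe: "\<And>\<Sigma> v L d \<sigma> i. eval \<Sigma> ?e v \<Longrightarrow> store_fits L \<Sigma> \<Longrightarrow> store_rel \<Sigma> \<sigma> \<Longrightarrow>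
     wp (comp_expr d ?e) (\<sigma>, i) (\<lambda>t s'. t \<le> Pe L \<and> fst s' (T d) = val_rep v)" using wp_comp_expr[of ?e] by blast
  define E where "E = ebits e"
  \<comment> \<open>\<open>E\<close> accounts for evaluating \<open>e\<close>, so there are at most
    \<open>n + E\<close> iterations, each adding \<open>A (n + E)\<close>. The summand
    \<open>n\<close> pays for the old length outside loops, where \<open>A'\<close> bounds the total
    and not the increase.\<close>
  define A' where "A' = (\<lambda>n. n + E + (n + E) * A (n + E))"
  define P' where "P' = (\<lambda>n. Pe n + (n + E) * (P (A' n) + 7) + 10)"
  note pA = poly_sim_poly_bounded(1)[OF body] and pP = poly_sim_poly_bounded(2)[OF body]
  have pA': "poly_bounded A'" unfolding A'_def by (intro poly_bounded_intros poly_bounded_comp[OF pA])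
  have pP': "poly_bounded P'" unfolding P'_def by (intro poly_bounded_intros pPe poly_bounded_comp[OF pP] pA')
  have "poly_sim \<Gamma> lp (\<lambda>\<Sigma> \<Sigma>'. exec \<Sigma> (For x e s) \<Sigma>') (\<lambda>h. comp_stmt h (For x e s)) A' P'"
  proof (rule poly_simI[OF pA' pP'])
    fix h \<Sigma> \<Sigma>' \<sigma> i I L
    assume ex: "exec \<Sigma> (For x e s) \<Sigma>'" and r: "store_rel \<Sigma> \<sigma>" and b: "store_fits L \<Sigma>" and ii: "lp \<Longrightarrow> iint_fits \<Gamma> I \<Sigma>" and IL: "I \<le> L"
    obtain n where n: "eval \<Sigma> ?e (VInt n)" "exec_loop x s 0 n \<Sigma> \<Sigma>'" using ex by (auto elim: exec_ForE)
    \<comment> \<open>Outside loops no separate bound for iint variables is given, and the bound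
      \<open>L\<close> for all values takes its place.\<close>
    define I0 where "I0 = (if lp then I else L)"
    have I0: "I0 \<le> L" "iint_fits \<Gamma> I0 \<Sigma>" using IL ii b by (auto simp: I0_def iint_fits_def store_fits_def)
    have te: "ty_expr \<Gamma> lp e TIInt" using e by (cases rule: ty_expr.cases) auto
    obtain m where m: "eval \<Sigma> e (VInt m)" "n = size_fn m"
      using n(1) by (cases rule: eval_Op_cases) (auto elim: apply1.cases apply2.cases)
    have "fits (I0 + E) (val_rep (VInt m))" unfolding E_def
      by (rule eval_fits[OF m(1)]) (use I0(2) ty_expr_iint_vars[OF te refl] in \<open>auto simp: iint_fits_def\<close>)
    then have nb: "0 \<le> n" "n \<le> int (I0 + E)" using size_fn_bounds[of "I0 + E" m] m(2) by auto
    have I1: "iint_fits \<Gamma> (I0 + E) \<Sigma>" using I0(2) fits_mono[of I0 _ "I0 + E"] by (auto simp: iint_fits_def)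
    have b1: "store_fits (L + E) \<Sigma>" using b by (rule store_fits_mono) simp
    have le1: "I0 + E \<le> L + E" using I0(1) by simp
    define k where "k = nat (n - 0)"
    have kb: "k \<le> I0 + E" using nb by (simp add: k_def)
    have aI: "A (I0 + E) \<le> A (L + E)" by (rule poly_bounded_mono[OF pA le1])
    note loop = loop_poly_sim[OF body x n(2) k_def[symmetric] order_refl nb(2) le1 _ b1 I1]
    have g: "L + E + k * A (I0 + E) \<le> A' L"
      unfolding A'_def using mult_mono[OF order_trans[OF kb le1] aI] by simp
    have "\<exists>\<tau>. store_rel \<Sigma> \<tau> \<and> \<tau> (J h) = 0 \<and> \<tau> (D h) = 0 - n"
      by (rule exI[of _ "\<lambda>r. case r of V y \<Rightarrow> val_rep (the (\<Sigma> y)) | D _ \<Rightarrow> 0 - n | _ \<Rightarrow> 0"]) (auto simp: store_rel_def)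
    then have 1: "store_fits (L + E + k * A (I0 + E)) \<Sigma>' \<and> iint_same \<Gamma> \<Sigma> \<Sigma>'" using loop by metis
    have "L + E + k * A (I0 + E) \<le> L + A' I0"
      unfolding A'_def using mult_le_mono1[OF kb, of "A (I0 + E)"] by linarith
    then have "L + E + k * A (I0 + E) \<le> (if lp then L + A' I else A' L)"
      using g by (cases lp) (simp_all add: I0_def)
    then have 2: "store_fits (if lp then L + A' I else A' L) \<Sigma>'" using 1 store_fits_mono by blast
    have pk: "k * (P (L + E + k * A (I0 + E)) + 7) \<le> (L + E) * (P (A' L) + 7)"
      using mult_mono[OF order_trans[OF kb le1] add_right_mono[OF poly_bounded_mono[OF pP g], of 7]] by simp
    have "wp (comp_expr 0 ?e) (\<sigma>, i) (\<lambda>t1 s1. wp (Seq (zeror (J h)) (Seq (negr (D h) (T 0))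
     (While (D h) (Seq (mvr (V x) (J h)) (Seq (comp_stmt (Suc h) s) (Seq (incr (J h)) (incr (D h)))))))) s1
        (\<lambda>t2 s'. Suc (t1 + t2) \<le> P' L \<and> store_rel \<Sigma>' (fst s')))"
      using Pe[OF n(1) b r]
    proof (rule wp_frame[OF _ read_free_comp_expr])
      fix t \<tau>
      assume t: "t \<le> Pe L \<and> fst (\<tau>, i) (T 0) = val_rep (VInt n)" and fr: "\<And>r. r \<notin> regs (comp_expr 0 ?e) \<Longrightarrow> \<tau> r = \<sigma> r"
      let ?\<tau> = "\<tau>(J h := 0, D h := - n)"
      have store_rel: "store_rel \<Sigma> ?\<tau>" using r by (rule store_rel_cong) (use fr regs_comp_expr[of 0 ?e] in auto)
      have "wp (While (D h) (Seq (mvr (V x) (J h)) (Seq (comp_stmt (Suc h) s) (Seq (incr (J h)) (incr (D h)))))) (?\<tau>, i)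
         (\<lambda>t s'. t \<le> k * (P (L + E + k * A (I0 + E)) + 7) + 1 \<and> store_rel \<Sigma>' (fst s'))"
        using loop[OF store_rel] by simp
      then have "wp (While (D h) (Seq (mvr (V x) (J h)) (Seq (comp_stmt (Suc h) s) (Seq (incr (J h)) (incr (D h)))))) (?\<tau>, i)
         (\<lambda>t2 s'. Suc (t + (4 + t2)) \<le> P' L \<and> store_rel \<Sigma>' (fst s'))"
        by (rule wp_mono) (use t pk in \<open>simp add: P'_def\<close>)
      then show "wp (Seq (zeror (J h)) (Seq (negr (D h) (T 0))
       (While (D h) (Seq (mvr (V x) (J h)) (Seq (comp_stmt (Suc h) s) (Seq (incr (J h)) (incr (D h)))))))) (\<tau>, i)
          (\<lambda>t2 s'. Suc (t + t2) \<le> P' L \<and> store_rel \<Sigma>' (fst s'))"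
        using t by (simp add: numeral_eq_Suc)
    qed
    then show "store_fits (if lp then L + A' I else A' L) \<Sigma>' \<and> (lp \<longrightarrow> iint_same \<Gamma> \<Sigma> \<Sigma>') \<and>
      wp (comp_stmt h (For x e s)) (\<sigma>, i) (\<lambda>t s'. t \<le> P' L \<and> store_rel \<Sigma>' (fst s'))"
      using 1 2 by (simp del: comp_expr.simps)
  qed
  then show ?thesis by blast
qed

lemma poly_sim_Assign:
  assumes "\<Gamma> x = Some tx" "\<not> (lp \<and> tx = TIInt)"
  shows "\<exists>A P. poly_sim \<Gamma> lp (\<lambda>\<Sigma> \<Sigma>'. exec \<Sigma> (Assign x e) \<Sigma>') (\<lambda>h. comp_stmt h (Assign x e)) A P"
proof -
  obtain Pe where pPe: "poly_bounded Pe" and Pe: "\<And>\<Sigma> v L d \<sigma> i. eval \<Sigma> e v \<Longrightarrow> store_fits L \<Sigma> \<Longrightarrow> store_rel \<Sigma> \<sigma> \<Longrightarrow>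
     wp (comp_expr d e) (\<sigma>, i) (\<lambda>t s'. t \<le> Pe L \<and> fst s' (T d) = val_rep v)" using wp_comp_expr[of e] by blast
  have "poly_sim \<Gamma> lp (\<lambda>\<Sigma> \<Sigma>'. exec \<Sigma> (Assign x e) \<Sigma>') (\<lambda>h. comp_stmt h (Assign x e)) (\<lambda>n. n + ebits e) (\<lambda>n. Pe n + 2)"
  proof (rule poly_simI)
    fix h \<Sigma> \<Sigma>' \<sigma> i I L
    assume ex: "exec \<Sigma> (Assign x e) \<Sigma>'" and r: "store_rel \<Sigma> \<sigma>" and b: "store_fits L \<Sigma>"
    obtain v where v: "eval \<Sigma> e v" "\<Sigma>' = \<Sigma>(x \<mapsto> v)" using ex by (auto elim: exec_AssignE)
    have "store_fits (L + ebits e) \<Sigma>'" unfolding v(2)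
      by (rule store_fits_upd[OF store_fits_mono[OF b] eval_store_fits[OF v(1) b]]) simp
    then have 1: "store_fits (if lp then L + (I + ebits e) else L + ebits e) \<Sigma>'" by (auto elim: store_fits_mono)
    have "wp (comp_expr 0 e) (\<sigma>, i) (\<lambda>t1 s1. wp (mvr (V x) (T 0)) s1 (\<lambda>t2 s'. Suc (t1 + t2) \<le> Pe L + 2 \<and> store_rel \<Sigma>' (fst s')))"
      using Pe[OF v(1) b r]
    proof (rule wp_frame[OF _ read_free_comp_expr])
      fix t \<tau>
      assume t: "t \<le> Pe L \<and> fst (\<tau>, i) (T 0) = val_rep v" and fr: "\<And>r. r \<notin> regs (comp_expr 0 e) \<Longrightarrow> \<tau> r = \<sigma> r"
      have store_rel: "store_rel \<Sigma> \<tau>" using r by (rule store_rel_cong) (use fr regs_comp_expr[of 0 e] in auto)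
      show "wp (mvr (V x) (T 0)) (\<tau>, i) (\<lambda>t2 s'. Suc (t + t2) \<le> Pe L + 2 \<and> store_rel \<Sigma>' (fst s'))"
        using t store_rel_upd[OF store_rel, of x v] v(2) by simp
    qed
    then show "store_fits (if lp then L + (I + ebits e) else L + ebits e) \<Sigma>' \<and> (lp \<longrightarrow> iint_same \<Gamma> \<Sigma> \<Sigma>') \<and>
      wp (comp_stmt h (Assign x e)) (\<sigma>, i) (\<lambda>t s'. t \<le> Pe L + 2 \<and> store_rel \<Sigma>' (fst s'))"
      using 1 assms v(2) by (auto simp: iint_same_def)
  qed (intro poly_bounded_intros pPe)+
  then show ?thesis by blast
qed

lemma poly_sim_If:
  assumes o1: "poly_sim \<Gamma> lp (\<lambda>\<Sigma> \<Sigma>'. exec \<Sigma> s1 \<Sigma>') (\<lambda>h. comp_stmt h s1) A1 P1"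
    and o2: "poly_sim \<Gamma> lp (\<lambda>\<Sigma> \<Sigma>'. exec \<Sigma> s2 \<Sigma>') (\<lambda>h. comp_stmt h s2) A2 P2"
  shows "\<exists>A P. poly_sim \<Gamma> lp (\<lambda>\<Sigma> \<Sigma>'. exec \<Sigma> (If e s1 s2) \<Sigma>') (\<lambda>h. comp_stmt h (If e s1 s2)) A P"
proof -
  obtain Pe where pPe: "poly_bounded Pe" and Pe: "\<And>\<Sigma> v L d \<sigma> i. eval \<Sigma> e v \<Longrightarrow> store_fits L \<Sigma> \<Longrightarrow> store_rel \<Sigma> \<sigma> \<Longrightarrow>
     wp (comp_expr d e) (\<sigma>, i) (\<lambda>t s'. t \<le> Pe L \<and> fst s' (T d) = val_rep v)" using wp_comp_expr[of e] by blast
  let ?A = "\<lambda>n. A1 n + A2 n" and ?P = "\<lambda>n. Pe n + (P1 n + P2 n) + 2"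
  have "poly_sim \<Gamma> lp (\<lambda>\<Sigma> \<Sigma>'. exec \<Sigma> (If e s1 s2) \<Sigma>') (\<lambda>h. comp_stmt h (If e s1 s2)) ?A ?P"
  proof (rule poly_simI)
    fix h \<Sigma> \<Sigma>' \<sigma> i I L
    assume ex: "exec \<Sigma> (If e s1 s2) \<Sigma>'" and r: "store_rel \<Sigma> \<sigma>" and b: "store_fits L \<Sigma>" and ii: "lp \<Longrightarrow> iint_fits \<Gamma> I \<Sigma>" and IL: "I \<le> L"
    obtain p where p: "eval \<Sigma> e (VBool p)" "exec \<Sigma> (if p then s1 else s2) \<Sigma>'" using ex by (auto elim!: exec_IfE)
    have q: "store_fits (if lp then L + ?A I else ?A L) \<Sigma>' \<and> (lp \<longrightarrow> iint_same \<Gamma> \<Sigma> \<Sigma>') \<and>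
       (\<forall>\<tau> i. store_rel \<Sigma> \<tau> \<longrightarrow> wp (comp_stmt h (if p then s1 else s2)) (\<tau>, i) (\<lambda>t s'. t \<le> P1 L + P2 L \<and> store_rel \<Sigma>' (fst s')))"
    proof (cases p)
      case True
      then have ex: "exec \<Sigma> s1 \<Sigma>'" using p by simp
      note o = poly_simD[OF o1 ex _ b ii IL]
      have "wp (comp_stmt h s1) (\<tau>, i) (\<lambda>t s'. t \<le> P1 L + P2 L \<and> store_rel \<Sigma>' (fst s'))" if "store_rel \<Sigma> \<tau>" for \<tau> i
        by (rule wp_mono[OF o(3)[OF that]]) auto
      then show ?thesis using True o(1,2)[OF r] by (auto elim!: store_fits_mono split: if_splits)
    next
      case False
      then have ex: "exec \<Sigma> s2 \<Sigma>'" using p by simp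
      note o = poly_simD[OF o2 ex _ b ii IL]
      have "wp (comp_stmt h s2) (\<tau>, i) (\<lambda>t s'. t \<le> P1 L + P2 L \<and> store_rel \<Sigma>' (fst s'))" if "store_rel \<Sigma> \<tau>" for \<tau> i
        by (rule wp_mono[OF o(3)[OF that]]) auto
      then show ?thesis using False o(1,2)[OF r] by (auto elim!: store_fits_mono split: if_splits)
    qed
    have "wp (comp_expr 0 e) (\<sigma>, i) (\<lambda>t1 s1'. wp (IfNeg (T 0) (comp_stmt h s1) (comp_stmt h s2)) s1' (\<lambda>t2 s'. Suc (t1 + t2) \<le> ?P L \<and> store_rel \<Sigma>' (fst s')))"
      using Pe[OF p(1) b r]
    proof (rule wp_frame[OF _ read_free_comp_expr])
      fix t \<tau>
      assume t: "t \<le> Pe L \<and> fst (\<tau>, i) (T 0) = val_rep (VBool p)" and fr: "\<And>r. r \<notin> regs (comp_expr 0 e) \<Longrightarrow> \<tau> r = \<sigma> r"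
      have store_rel: "store_rel \<Sigma> \<tau>" using r by (rule store_rel_cong) (use fr regs_comp_expr[of 0 e] in auto)
      have "wp (comp_stmt h (if p then s1 else s2)) (\<tau>, i) (\<lambda>t s'. t \<le> P1 L + P2 L \<and> store_rel \<Sigma>' (fst s'))" using q store_rel by blast
      then show "wp (IfNeg (T 0) (comp_stmt h s1) (comp_stmt h s2)) (\<tau>, i) (\<lambda>t2 s'. Suc (t + t2) \<le> ?P L \<and> store_rel \<Sigma>' (fst s'))"
        using t by (cases p) (auto elim!: wp_mono)
    qed
    then show "store_fits (if lp then L + ?A I else ?A L) \<Sigma>' \<and> (lp \<longrightarrow> iint_same \<Gamma> \<Sigma> \<Sigma>') \<and>
      wp (comp_stmt h (If e s1 s2)) (\<sigma>, i) (\<lambda>t s'. t \<le> ?P L \<and> store_rel \<Sigma>' (fst s'))"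
      using q by simp
  qed (intro poly_bounded_intros pPe poly_sim_poly_bounded[OF o1] poly_sim_poly_bounded[OF o2])+
  then show ?thesis by blast
qed

lemma poly_sim_Cons:
  assumes o1: "poly_sim \<Gamma> lp (\<lambda>\<Sigma> \<Sigma>'. exec \<Sigma> s \<Sigma>') (\<lambda>h. comp_stmt h s) A1 P1"
    and o2: "poly_sim \<Gamma>1 lp (\<lambda>\<Sigma> \<Sigma>'. exec_seq \<Sigma> ss \<Sigma>') (\<lambda>h. comp_seq h ss) A2 P2"
    and ty: "ty_stmt \<Gamma> lp s \<Gamma>1"
  shows "\<exists>A P. poly_sim \<Gamma> lp (\<lambda>\<Sigma> \<Sigma>'. exec_seq \<Sigma> (s # ss) \<Sigma>') (\<lambda>h. comp_seq h (s # ss)) A P"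
proof -
  \<comment> \<open>Inside a loop \<open>I\<close> is the same for both parts, so the increases add;
    outside, the bounds are composed. In either case the length between the parts is at most
    \<open>n + A1 n\<close>.\<close>
  let ?A = "if lp then \<lambda>n. A1 n + A2 n else (\<lambda>n. A2 (A1 n))" and ?P = "\<lambda>n. P1 n + P2 (n + A1 n) + 1"
  note pA1 = poly_sim_poly_bounded(1)[OF o1] and pP2 = poly_sim_poly_bounded(2)[OF o2]
  have "poly_sim \<Gamma> lp (\<lambda>\<Sigma> \<Sigma>'. exec_seq \<Sigma> (s # ss) \<Sigma>') (\<lambda>h. comp_seq h (s # ss)) ?A ?P"
  proof (rule poly_simI)
    show "poly_bounded ?A" by (cases lp) (simp_all add: poly_bounded_add poly_bounded_comp poly_sim_poly_bounded[OF o1] poly_sim_poly_bounded[OF o2])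
    show "poly_bounded ?P" by (intro poly_bounded_intros poly_bounded_comp[OF pP2] poly_sim_poly_bounded[OF o1])
    fix h \<Sigma> \<Sigma>' \<sigma> i I L
    assume ex: "exec_seq \<Sigma> (s # ss) \<Sigma>'" and r: "store_rel \<Sigma> \<sigma>" and b: "store_fits L \<Sigma>" and ii: "lp \<Longrightarrow> iint_fits \<Gamma> I \<Sigma>" and IL: "I \<le> L"
    obtain \<Sigma>1 where ex1: "exec \<Sigma> s \<Sigma>1" and ex2: "exec_seq \<Sigma>1 ss \<Sigma>'" using ex by (auto elim: exec_seq_ConsE)
    note o = poly_simD[OF o1 ex1 r b ii IL]
    define L1 where "L1 = (if lp then L + A1 I else A1 L)"
    \<comment> \<open>Outside loops \<open>A1 L\<close> may be smaller than \<open>I\<close>; the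
      value 0 ensures \<open>I1 \<le> L1\<close>.\<close>
    define I1 where "I1 = (if lp then I else 0)"
    have b1: "store_fits L1 \<Sigma>1" using o(1) by (simp add: L1_def)
    have t: "\<Gamma>1 y = Some TIInt \<longleftrightarrow> \<Gamma> y = Some TIInt" if lp for y using ty_loop_iint[OF ty that] .
    have ii1: "iint_fits \<Gamma>1 I1 \<Sigma>1" if lp using o(2)[OF that] ii[OF that] t[OF that] that by (auto simp: iint_fits_def iint_same_def I1_def)
    have IL1: "I1 \<le> L1" using IL by (auto simp: L1_def I1_def)
    note o' = poly_simD[OF o2 ex2 _ b1 ii1 IL1]
    have ll: "L1 \<le> L + A1 L" using poly_bounded_mono[OF pA1 IL] by (auto simp: L1_def)
    have "\<exists>\<tau>. store_rel \<Sigma>1 \<tau>"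
      by (rule exI[of _ "\<lambda>r. case r of V y \<Rightarrow> val_rep (the (\<Sigma>1 y)) | _ \<Rightarrow> 0"]) (auto simp: store_rel_def)
    then have 1: "store_fits (if lp then L1 + A2 I1 else A2 L1) \<Sigma>'" "lp \<Longrightarrow> iint_same \<Gamma>1 \<Sigma>1 \<Sigma>'" using o'(1,2) by blast+
    have 2: "store_fits (if lp then L + ?A I else ?A L) \<Sigma>'" using 1(1) by (auto simp: L1_def I1_def add.assoc)
    have 3: "lp \<longrightarrow> iint_same \<Gamma> \<Sigma> \<Sigma>'" using 1(2) o(2) t by (auto simp: iint_same_def)
    have "wp (comp_stmt h s) (\<sigma>, i) (\<lambda>t1 s1. wp (comp_seq h ss) s1 (\<lambda>t2 s'. Suc (t1 + t2) \<le> ?P L \<and> store_rel \<Sigma>' (fst s')))"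
      using o(3)
    proof (rule wp_frame[OF _ read_free_comp_stmt(1)])
      fix t \<tau> assume t: "t \<le> P1 L \<and> store_rel \<Sigma>1 (fst (\<tau>, i))"
      then have "wp (comp_seq h ss) (\<tau>, i) (\<lambda>t s'. t \<le> P2 L1 \<and> store_rel \<Sigma>' (fst s'))" using o'(3) by simp
      then show "wp (comp_seq h ss) (\<tau>, i) (\<lambda>t2 s'. Suc (t + t2) \<le> ?P L \<and> store_rel \<Sigma>' (fst s'))"
        by (rule wp_mono) (use t poly_bounded_mono[OF pP2 ll] in auto)
    qed
    then show "store_fits (if lp then L + ?A I else ?A L) \<Sigma>' \<and> (lp \<longrightarrow> iint_same \<Gamma> \<Sigma> \<Sigma>') \<and>
      wp (comp_seq h (s # ss)) (\<sigma>, i) (\<lambda>t s'. t \<le> ?P L \<and> store_rel \<Sigma>' (fst s'))"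
      using 2 3 by simp
  qed
  then show ?thesis by blast
qed

lemma poly_sim_typed:
  "ty_stmt \<Gamma> lp s \<Gamma>' \<Longrightarrow> \<exists>A P. poly_sim \<Gamma> lp (\<lambda>\<Sigma> \<Sigma>'. exec \<Sigma> s \<Sigma>') (\<lambda>h. comp_stmt h s) A P"
  "ty_seq \<Gamma> lp ss \<Gamma>' \<Longrightarrow> \<exists>A P. poly_sim \<Gamma> lp (\<lambda>\<Sigma> \<Sigma>'. exec_seq \<Sigma> ss \<Sigma>') (\<lambda>h. comp_seq h ss) A P"
proof (induction rule: ty_stmt_ty_seq.inducts)
  case (TDecl x \<Gamma> lp t)
  have "poly_sim \<Gamma> lp (\<lambda>\<Sigma> \<Sigma>'. exec \<Sigma> (Decl t x) \<Sigma>') (\<lambda>h. comp_stmt h (Decl t x)) (\<lambda>n. n) (\<lambda>n. 1)"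
  proof (rule poly_simI)
    fix h \<Sigma> \<Sigma>' \<sigma> i I L
    assume ex: "exec \<Sigma> (Decl t x) \<Sigma>'" and r: "store_rel \<Sigma> \<sigma>" and b: "store_fits L \<Sigma>"
    have s: "\<Sigma>' = \<Sigma>(x \<mapsto> init_val t)" "val_rep (init_val t) = 0" using ex by (auto elim: exec_DeclE simp: init_val_def)
    have "store_fits L \<Sigma>'" unfolding s(1) by (rule store_fits_upd[OF b]) (simp add: s(2) fits_def)
    then have "store_fits (if lp then L + I else L) \<Sigma>'" by (auto elim: store_fits_mono)
    moreover have "store_rel \<Sigma>' (\<sigma>(V x := 0))" using store_rel_upd[OF r, of x "init_val t"] s by simp
    ultimately show "store_fits (if lp then L + I else L) \<Sigma>' \<and> (lp \<longrightarrow> iint_same \<Gamma> \<Sigma> \<Sigma>') \<and>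
      wp (comp_stmt h (Decl t x)) (\<sigma>, i) (\<lambda>t s'. t \<le> 1 \<and> store_rel \<Sigma>' (fst s'))"
      using s(1) TDecl by (auto simp: iint_same_def)
  qed (intro poly_bounded_intros)+
  then show ?case by blast
next
  case (TAssign \<Gamma> x tx lp e t)
  then show ?case by (intro poly_sim_Assign)
next
  case (TBlock \<Gamma> lp ss \<Gamma>')
  then obtain A P where "poly_sim \<Gamma> lp (\<lambda>\<Sigma> \<Sigma>'. exec_seq \<Sigma> ss \<Sigma>') (\<lambda>h. comp_seq h ss) A P" by blast
  then have "poly_sim \<Gamma> lp (\<lambda>\<Sigma> \<Sigma>'. exec \<Sigma> (Block ss) \<Sigma>') (\<lambda>h. comp_stmt h (Block ss)) A P"
    unfolding poly_sim_def by (auto elim!: exec_BlockE)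
  then show ?case by blast
next
  case (TIf \<Gamma> lp e s1 \<Gamma>1 s2 \<Gamma>2)
  then show ?case using poly_sim_If by blast
next
  case (TFor \<Gamma> lp e x s \<Gamma>')
  then show ?case using poly_sim_For by blast
next
  case (TSeqNil \<Gamma> lp)
  have "poly_sim \<Gamma> lp (\<lambda>\<Sigma> \<Sigma>'. exec_seq \<Sigma> [] \<Sigma>') (\<lambda>h. comp_seq h []) (\<lambda>n. n) (\<lambda>n. 1)"
    by (rule poly_simI) (auto simp: poly_bounded_const poly_bounded_id iint_same_def elim!: exec_seq_NilE elim: store_fits_mono)
  then show ?case by blast
next
  case (TSeqCons \<Gamma> lp s \<Gamma>1 ss \<Gamma>')
  then show ?case using poly_sim_Cons by blast
qed

section \<open>Reading the input\<close>

text \<open>Horner's scheme: a digit doubles \<open>r\<close>, with the digit 1 entering as initial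
  carry. A minus sign is noted in \<open>X 0\<close>; \<open>X 1\<close> is -1 until the separator
  clears it.\<close>

definition read_loop :: "reg \<Rightarrow> cmd" where
  "read_loop r = While (X 1) (Read (addr r r r) (Add r (Pos r) (Pos r) True) (m1r (X 0)) (zeror (X 1)))"

definition read_int :: "reg \<Rightarrow> cmd" where
  "read_int r = Seq (zeror r) (Seq (zeror (X 0)) (Seq (m1r (X 1)) (Seq (read_loop r) (neg_if (X 0) r))))"

fun read_ints :: "vname list \<Rightarrow> cmd" where
  "read_ints [] = Skip"
| "read_ints (x # xs) = Seq (read_int (V x)) (read_ints xs)"

abbreviation dval :: "int \<Rightarrow> nat list \<Rightarrow> int" where
  "dval \<equiv> foldl (\<lambda>a d. 2 * a + (int d - 1))"

text \<open>A digit costs three units, for test, read and addition; the separator costs the same,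
  and the failing test one more.\<close>

lemma wp_read_digits:
  assumes "set ds \<subseteq> {1, 2}" "\<sigma> (X 1) = -1" "r \<notin> range X"
  shows "wp (read_loop r) (\<sigma>, ds @ 4 # rest) (\<lambda>t s'. t \<le> 3 * length ds + 4 \<and>
     s' = (\<sigma>(r := dval (\<sigma> r) ds, X 1 := 0), rest))"
  using assms
proof (induction ds arbitrary: \<sigma>)
  case Nil
  show ?case unfolding read_loop_def
    by (rule wp_WhileT) (use Nil in \<open>auto simp: fun_upd_def intro!: wp_Read wp_WhileF\<close>)
next
  case (Cons d ds)
  let ?\<sigma> = "\<sigma>(r := 2 * \<sigma> r + (int d - 1))"
  have ne: "r \<noteq> X 1" using Cons.prems by auto
  have IH: "wp (read_loop r) (?\<sigma>, ds @ 4 # rest) (\<lambda>t s'. t \<le> 3 * length ds + 4 \<and>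
     s' = (?\<sigma>(r := dval (?\<sigma> r) ds, X 1 := 0), rest))"
    by (rule Cons.IH) (use Cons.prems ne in auto)
  have IH': "wp (read_loop r) (?\<sigma>, ds @ 4 # rest) (\<lambda>t2 s'. Suc (2 + t2) \<le> 3 * length (d # ds) + 4 \<and>
     s' = (\<sigma>(r := dval (\<sigma> r) (d # ds), X 1 := 0), rest))"
    by (rule wp_mono[OF IH]) auto
  have d: "d = 1 \<or> d = 2" using Cons.prems by auto
  have select: "select d (addr r r r) (Add r (Pos r) (Pos r) True) c c' = Add r (Pos r) (Pos r) (d = 2)" for c c'
    using d by auto
  have "\<sigma>(r := op_val (Pos r) \<sigma> + op_val (Pos r) \<sigma> + of_bool (d = 2)) = ?\<sigma>" using d by auto
  then have wp_upd: "wp (Add r (Pos r) (Pos r) (d = 2)) (\<sigma>, i) Q = Q (Suc 0) (?\<sigma>, i)" for i Q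
    by (simp only: wp_Add fst_conv snd_conv)
  show ?case unfolding read_loop_def
  proof (rule wp_WhileT[OF _ wp_Read[where a = d and i = "ds @ 4 # rest", folded append_Cons]])
    show "fst (\<sigma>, (d # ds) @ 4 # rest) (X 1) < 0" using Cons.prems(2) by simp
    show "d \<in> {1..4}" using d by auto
    show "wp (select d (addr r r r) (Add r (Pos r) (Pos r) True) (m1r (X 0)) (zeror (X 1))) (\<sigma>, ds @ 4 # rest)
       (\<lambda>t s1. wp (While (X 1) (Read (addr r r r) (Add r (Pos r) (Pos r) True) (m1r (X 0)) (zeror (X 1)))) s1
        (\<lambda>t2 s'. Suc (Suc t + t2) \<le> 3 * length (d # ds) + 4 \<and> s' = (\<sigma>(r := dval (\<sigma> r) (d # ds), X 1 := 0), rest)))"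
      using IH' unfolding read_loop_def[symmetric] select wp_upd by (simp only: numeral_2_eq_2)
  qed
qed

lemma dval_bin_digits: "dval 0 (bin_digits n) = int n"
proof (induction n rule: bin_digits.induct)
  case (1 n)
  show ?case
  proof (cases "n < 2")
    case True
    then show ?thesis by (simp add: bin_digits.simps[of n])
  next
    case False
    then have "dval 0 (bin_digits n) = 2 * int (n div 2) + int (n mod 2)"
      using 1 by (simp add: bin_digits.simps[of n])
    also have "\<dots> = int n" by presburger
    finally show ?thesis .
  qed
qed

lemma wp_read_int:
  assumes "r \<notin> range X"
  shows "wp (read_int r) (\<sigma>, enc_int v @ 4 # rest) (\<lambda>t s'. t \<le> 3 * length (enc_int v) + 20 \<and> snd s' = rest \<and>
     fst s' r = v \<and> (\<forall>r'. r' \<notin> insert r (range X) \<longrightarrow> fst s' r' = \<sigma> r'))"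
proof -
  have ne: "r \<noteq> X n" "X n \<noteq> r" for n using assms by auto
  let ?\<sigma> = "\<sigma>(r := 0, X 0 := 0, X 1 := -1)"
  let ?ds = "bin_digits (nat \<bar>v\<bar>)"
  have "wp (read_loop r) (?\<sigma>, enc_int v @ 4 # rest) (\<lambda>t s'. t \<le> 3 * length (enc_int v) + 10 \<and>
     s' = (?\<sigma>(X 0 := if v < 0 then -1 else 0, r := \<bar>v\<bar>, X 1 := 0), rest))"
  proof (cases "v < 0")
    case False
    have "wp (read_loop r) (?\<sigma>, ?ds @ 4 # rest) (\<lambda>t s'. t \<le> 3 * length ?ds + 4 \<and>
       s' = (?\<sigma>(r := dval (?\<sigma> r) ?ds, X 1 := 0), rest))"
      by (rule wp_read_digits) (use assms set_bin_digits in auto)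
    then show ?thesis using False ne by (auto simp: enc_int_def dval_bin_digits fun_upd_twist elim!: wp_mono)
  next
    case True
    let ?\<tau> = "?\<sigma>(X 0 := -1)"
    have "wp (read_loop r) (?\<tau>, ?ds @ 4 # rest) (\<lambda>t s'. t \<le> 3 * length ?ds + 4 \<and>
       s' = (?\<tau>(r := dval (?\<tau> r) ?ds, X 1 := 0), rest))"
      by (rule wp_read_digits) (use assms set_bin_digits in auto)
    then have w: "wp (read_loop r) (?\<tau>, ?ds @ 4 # rest) (\<lambda>t s'. Suc (2 + t) \<le> 3 * length (3 # ?ds) + 10 \<and>
       s' = (?\<sigma>(X 0 := -1, r := \<bar>v\<bar>, X 1 := 0), rest))"
      by (rule wp_mono) (use ne in \<open>auto simp: dval_bin_digits\<close>)
    have e: "enc_int v = 3 # ?ds" using True by (simp add: enc_int_def)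
    have "wp (While (X 1) (Read (addr r r r) (Add r (Pos r) (Pos r) True) (m1r (X 0)) (zeror (X 1)))) (?\<sigma>, 3 # ?ds @ 4 # rest)
      (\<lambda>t s'. t \<le> 3 * length (3 # ?ds) + 10 \<and> s' = (?\<sigma>(X 0 := -1, r := \<bar>v\<bar>, X 1 := 0), rest))"
    proof (rule wp_WhileT, simp, rule wp_Read)
      show "wp (select 3 (addr r r r) (Add r (Pos r) (Pos r) True) (m1r (X 0)) (zeror (X 1))) (?\<sigma>, ?ds @ 4 # rest)
       (\<lambda>t s1. wp (While (X 1) (Read (addr r r r) (Add r (Pos r) (Pos r) True) (m1r (X 0)) (zeror (X 1)))) s1
        (\<lambda>t2 s'. Suc (Suc t + t2) \<le> 3 * length (3 # ?ds) + 10 \<and> s' = (?\<sigma>(X 0 := -1, r := \<bar>v\<bar>, X 1 := 0), rest)))"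
        using w unfolding read_loop_def[symmetric] by (simp add: numeral_2_eq_2)
    qed simp
    then show ?thesis unfolding read_loop_def e using True by simp
  qed
  then have "wp (read_loop r) (?\<sigma>, enc_int v @ 4 # rest) (\<lambda>t1 s1. wp (neg_if (X 0) r) s1 (\<lambda>t2 s'. t1 + t2 \<le> 3 * length (enc_int v) + 12 \<and> snd s' = rest \<and>
     fst s' r = v \<and> (\<forall>r'. r' \<notin> insert r (range X) \<longrightarrow> fst s' r' = \<sigma> r')))"
    by (rule wp_mono) (use ne in auto)
  then show ?thesis unfolding read_int_def by (auto elim!: wp_mono)
qed

lemma wp_read_ints:
  assumes "length vs = length xs" "store_rel \<Sigma> \<sigma>"
  shows "wp (read_ints xs) (\<sigma>, enc_input vs) (\<lambda>t s'. t \<le> 3 * input_len vs + 21 * length xs + 1 \<and> snd s' = [] \<and>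
     store_rel (\<Sigma>(xs [\<mapsto>] map VInt vs)) (fst s'))"
  using assms
proof (induction vs xs arbitrary: \<Sigma> \<sigma> rule: list_induct2)
  case Nil
  then show ?case by (simp add: enc_input_def)
next
  case (Cons v vs x xs)
  let ?r = "enc_input vs"
  have e: "enc_input (v # vs) = enc_int v @ 4 # ?r" by (simp add: enc_input_def)
  have l: "input_len (v # vs) = length (enc_int v) + 1 + input_len vs" by (simp add: input_len_def e)
  have "wp (read_int (V x)) (\<sigma>, enc_int v @ 4 # ?r) (\<lambda>t1 s1. wp (read_ints xs) s1
      (\<lambda>t2 s'. Suc (t1 + t2) \<le> 3 * input_len (v # vs) + 21 * length (x # xs) + 1 \<and> snd s' = [] \<and>
     store_rel (\<Sigma>(x # xs [\<mapsto>] map VInt (v # vs))) (fst s')))"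
  proof (rule wp_mono[OF wp_read_int])
    fix t1 s1
    assume t: "t1 \<le> 3 * length (enc_int v) + 20 \<and> snd s1 = ?r \<and> fst s1 (V x) = v \<and>
       (\<forall>r'. r' \<notin> insert (V x) (range X) \<longrightarrow> fst s1 r' = \<sigma> r')"
    have r: "store_rel (\<Sigma>(x \<mapsto> VInt v)) (fst s1)" using Cons.prems t by (auto simp: store_rel_def)
    have s1: "s1 = (fst s1, ?r)" using t by (metis prod.collapse)
    show "wp (read_ints xs) s1 (\<lambda>t2 s'. Suc (t1 + t2) \<le> 3 * input_len (v # vs) + 21 * length (x # xs) + 1 \<and> snd s' = [] \<and>
     store_rel (\<Sigma>(x # xs [\<mapsto>] map VInt (v # vs))) (fst s'))"
      by (subst s1, rule wp_mono[OF Cons.IH[OF r]]) (use t l in \<open>auto simp: fun_upd_def\<close>)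
  qed auto
  then show ?case by (simp add: e)
qed

lemma less_power_length_bin_digits: "n < 2 ^ length (bin_digits n)"
proof (induction n rule: bin_digits.induct)
  case (1 n)
  then show ?case by (subst bin_digits.simps) auto
qed

lemma fits_enc_int: "fits (length (enc_int v)) v"
proof -
  have "fits (length (bin_digits (nat \<bar>v\<bar>))) v"
    using less_power_length_bin_digits[of "nat \<bar>v\<bar>"] unfolding fits_def by (simp add: nat_less_iff)
  then show ?thesis by (rule fits_mono) (auto simp: enc_int_def)
qed

lemma length_enc_int_le: "v \<in> set vs \<Longrightarrow> length (enc_int v) \<le> input_len vs"
  by (induction vs) (auto simp: input_len_def enc_input_def)

lemma map_upds_ran: "(\<Sigma>(xs [\<mapsto>] us)) x = Some u \<Longrightarrow> \<Sigma> x = Some u \<or> u \<in> set us"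
proof (induction xs arbitrary: \<Sigma> us)
  case (Cons y ys)
  then show ?case by (cases us) (auto split: if_splits dest!: Cons.IH)
qed simp

lemma store_fits_input: "store_fits (input_len vs) (Map.empty(xs [\<mapsto>] map VInt vs))"
  unfolding store_fits_def
proof (intro allI impI)
  fix x u assume "(Map.empty(xs [\<mapsto>] map VInt vs)) x = Some u"
  then obtain v where v: "v \<in> set vs" "u = VInt v" using map_upds_ran[of Map.empty xs "map VInt vs" x u] by auto
  then show "fits (input_len vs) (val_rep u)" using fits_mono[OF fits_enc_int length_enc_int_le] by auto
qed

lemma set_enc_input: "set (enc_input vs) \<subseteq> {1..4}"
proof -
  have "set (enc_int v) \<subseteq> {1..4}" for v
    using set_bin_digits[of "nat v"] set_bin_digits[of "nat (- v)"] by (auto simp: enc_int_def)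
  from subsetD[OF this] show ?thesis by (auto simp: enc_input_def)
qed

text \<open>The last two commands leave the sign in \<open>X 0\<close> and the absolute value in
  \<open>T 0\<close>, the form in which the machine prints the result.\<close>

fun comp_prog :: "prog \<Rightarrow> cmd" where
  "comp_prog (Prog xs ss e) = Seq (read_ints xs) (Seq (comp_seq 0 ss) (Seq (comp_expr 0 e) (Seq (mvr (X 0) (T 0)) (neg_if (T 0) (T 0)))))"

lemma wp_comp_prog:
  assumes "well_typed p"
  obtains P where "poly_bounded P" "\<And>vs v. prog_sem p vs v \<Longrightarrow>
    wp (comp_prog p) (\<lambda>_. 0, enc_input vs) (\<lambda>t s'. t \<le> P (input_len vs) \<and> snd s' = [] \<and>
      fst s' (T 0) = \<bar>v\<bar> \<and> (fst s' (X 0) < 0 \<longleftrightarrow> v < 0))"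
proof -
  obtain xs ss e where p: "p = Prog xs ss e" by (cases p)
  obtain \<Gamma> \<Gamma>' where "ty_seq \<Gamma> False ss \<Gamma>'" using assms p by auto
  then obtain A P where o: "poly_sim \<Gamma> False (\<lambda>\<Sigma> \<Sigma>'. exec_seq \<Sigma> ss \<Sigma>') (\<lambda>h. comp_seq h ss) A P"
    using poly_sim_typed(2) by blast
  obtain Pe where pPe: "poly_bounded Pe" and Pe: "\<And>\<Sigma> v L d \<sigma> i. eval \<Sigma> e v \<Longrightarrow> store_fits L \<Sigma> \<Longrightarrow> store_rel \<Sigma> \<sigma> \<Longrightarrow>
     wp (comp_expr d e) (\<sigma>, i) (\<lambda>t s'. t \<le> Pe L \<and> fst s' (T d) = val_rep v)" using wp_comp_expr[of e] by blast
  define R where "R = (\<lambda>n. 3 * n + 21 * length xs + 1 + P n + Pe (A n) + 10)"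
  show ?thesis
  proof (rule that[of R])
    show "poly_bounded R" unfolding R_def by (intro poly_bounded_intros poly_bounded_comp[OF pPe] poly_sim_poly_bounded[OF o])
    fix vs v
    assume "prog_sem p vs v"
    then obtain \<Sigma>' where l: "length vs = length xs" and ex: "exec_seq (Map.empty(xs [\<mapsto>] map VInt vs)) ss \<Sigma>'"
      and ev: "eval \<Sigma>' e (VInt v)" using p by auto
    let ?N = "input_len vs"
    let ?F = "\<lambda>t (s' :: rstate). t \<le> R ?N \<and> snd s' = [] \<and> fst s' (T 0) = \<bar>v\<bar> \<and> (fst s' (X 0) < 0 \<longleftrightarrow> v < 0)"
    have b: "store_fits (A ?N) \<Sigma>'" if "store_rel (Map.empty(xs [\<mapsto>] map VInt vs)) \<sigma>" for \<sigma>
      using poly_simD(1)[OF o ex that store_fits_input, of 0] by simp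
    have "store_rel Map.empty (\<lambda>_. 0)" by (simp add: store_rel_def)
    from wp_read_ints[OF l this] have
      "wp (read_ints xs) (\<lambda>_. 0, enc_input vs) (\<lambda>t1 s1. wp (comp_seq 0 ss) s1 (\<lambda>t2 s2. wp (comp_expr 0 e) s2
         (\<lambda>t3 s3. wp (Seq (mvr (X 0) (T 0)) (neg_if (T 0) (T 0))) s3 (\<lambda>t4. ?F (Suc (t1 + Suc (t2 + Suc (t3 + t4))))))))"
    proof (rule wp_mono)
      fix t1 and s1 :: rstate
      assume s1: "t1 \<le> 3 * ?N + 21 * length xs + 1 \<and> snd s1 = [] \<and> store_rel (Map.empty(xs [\<mapsto>] map VInt vs)) (fst s1)"
      then obtain \<sigma> where \<sigma>: "s1 = (\<sigma>, [])" "store_rel (Map.empty(xs [\<mapsto>] map VInt vs)) \<sigma>" by (cases s1) auto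
      show "wp (comp_seq 0 ss) s1 (\<lambda>t2 s2. wp (comp_expr 0 e) s2
         (\<lambda>t3 s3. wp (Seq (mvr (X 0) (T 0)) (neg_if (T 0) (T 0))) s3 (\<lambda>t4. ?F (Suc (t1 + Suc (t2 + Suc (t3 + t4)))))))"
        unfolding \<sigma>(1)
      proof (rule wp_frame[OF poly_simD(3)[OF o ex \<sigma>(2) store_fits_input, of 0] read_free_comp_stmt(2)])
        fix t2 \<tau>
        assume t2: "t2 \<le> P ?N \<and> store_rel \<Sigma>' (fst (\<tau>, []))"
        have "store_rel \<Sigma>' \<tau>" using t2 by simp
        from Pe[OF ev b[OF \<sigma>(2)] this]
        show "wp (comp_expr 0 e) (\<tau>, []) (\<lambda>t3 s3. wp (Seq (mvr (X 0) (T 0)) (neg_if (T 0) (T 0))) s3 (\<lambda>t4. ?F (Suc (t1 + Suc (t2 + Suc (t3 + t4))))))"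
        proof (rule wp_frame[OF _ read_free_comp_expr])
          fix t3 \<rho>
          assume "t3 \<le> Pe (A ?N) \<and> fst (\<rho>, []) (T 0) = val_rep (VInt v)"
          then show "wp (Seq (mvr (X 0) (T 0)) (neg_if (T 0) (T 0))) (\<rho>, []) (\<lambda>t4. ?F (Suc (t1 + Suc (t2 + Suc (t3 + t4)))))"
            using s1 t2 by (auto simp: R_def)
        qed
      qed auto
    qed
    then show "wp (comp_prog p) (\<lambda>_. 0, enc_input vs) ?F" using p by simp
  qed
qed

theorem theorem3:
  shows "FPC \<subseteq> FP"
proof
  fix mf assume "mf \<in> FPC"
  then obtain m f p where mf: "mf = (m, f)" and p: "well_typed p"
    and sem: "\<And>vs. length vs = m \<Longrightarrow> prog_sem p vs (f vs)"
    unfolding FPC_def by auto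
  obtain P where P: "poly_bounded P" "\<And>vs v. prog_sem p vs v \<Longrightarrow>
    wp (comp_prog p) (\<lambda>_. 0, enc_input vs) (\<lambda>t s'. t \<le> P (input_len vs) \<and> snd s' = [] \<and>
      fst s' (T 0) = \<bar>v\<bar> \<and> (fst s' (X 0) < 0 \<longleftrightarrow> v < 0))"
    using wp_comp_prog[OF p] by blast
  obtain M where M: "tm_wf M" "\<And>i t \<sigma>' v. set i \<subseteq> {1..4} \<Longrightarrow> runs (comp_prog p) (\<lambda>_. 0, i) t (\<sigma>', []) \<Longrightarrow>
      \<sigma>' (T 0) = \<bar>v\<bar> \<Longrightarrow> (\<sigma>' (X 0) < 0 \<longleftrightarrow> v < 0) \<Longrightarrow>
      \<exists>n \<le> (t + 1) * (2 * t + 2 * length i + 10). case tm_run M n (tm_start M, [], i) of (q, ls, rs) \<Rightarrow>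
         q = tm_halt M \<and> strip_blanks rs = enc_int v"
    using cmd_tm[of "comp_prog p"] by blast
  \<comment> \<open>This is the time bound of \<open>cmd_tm\<close> for at most \<open>P n\<close>
    units on an encoded input of length \<open>n\<close>.\<close>
  have "poly_bounded (\<lambda>n. (P n + 1) * (2 * P n + 2 * n + 10))" by (intro poly_bounded_intros P(1))
  then obtain c k where ck: "\<And>n. (P n + 1) * (2 * P n + 2 * n + 10) \<le> c * (n + 1) ^ k"
    by (auto simp: poly_bounded_def)
  have "\<exists>t. t \<le> c * (input_len vs + 1) ^ k \<and>
     (case tm_run M t (tm_start M, [], enc_input vs) of (q, ls, rs) \<Rightarrow> q = tm_halt M \<and> strip_blanks rs = enc_int (f vs))"
    if vs: "length vs = m" for vs
  proof -
    let ?N = "input_len vs"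
    obtain t s' where "runs (comp_prog p) (\<lambda>_. 0, enc_input vs) t s'" "t \<le> P ?N \<and> snd s' = [] \<and>
      fst s' (T 0) = \<bar>f vs\<bar> \<and> (fst s' (X 0) < 0 \<longleftrightarrow> f vs < 0)"
      using P(2)[OF sem[OF vs]] unfolding wp_def by blast
    then obtain \<sigma>' where t: "runs (comp_prog p) (\<lambda>_. 0, enc_input vs) t (\<sigma>', [])" "t \<le> P ?N"
      "\<sigma>' (T 0) = \<bar>f vs\<bar>" "\<sigma>' (X 0) < 0 \<longleftrightarrow> f vs < 0"
      by (cases s') simp
    obtain n where n: "n \<le> (t + 1) * (2 * t + 2 * ?N + 10)"
      "case tm_run M n (tm_start M, [], enc_input vs) of (q, ls, rs) \<Rightarrow> q = tm_halt M \<and> strip_blanks rs = enc_int (f vs)"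
      using M(2)[OF set_enc_input t(1,3,4), folded input_len_def] by (elim exE conjE) (rule that)
    have "(t + 1) * (2 * t + 2 * ?N + 10) \<le> (P ?N + 1) * (2 * P ?N + 2 * ?N + 10)"
      using t(2) by (intro mult_mono) auto
    then have "n \<le> c * (?N + 1) ^ k" using n(1) ck[of ?N] by linarith
    then show ?thesis using n(2) by (intro exI[of _ n] conjI)
  qed
  then have main: "tm_wf M \<and> (\<forall>vs. length vs = m \<longrightarrow> (\<exists>t. t \<le> c * (input_len vs + 1) ^ k \<and>
     (case tm_run M t (tm_start M, [], enc_input vs) of (q, ls, rs) \<Rightarrow> q = tm_halt M \<and> strip_blanks rs = enc_int (f vs))))"
    using M(1) by simp
  have "\<exists>M c k. tm_wf M \<and> (\<forall>vs. length vs = m \<longrightarrow> (\<exists>t. t \<le> c * (input_len vs + 1) ^ k \<and>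
     (case tm_run M t (tm_start M, [], enc_input vs) of (q, ls, rs) \<Rightarrow> q = tm_halt M \<and> strip_blanks rs = enc_int (f vs))))"
    by (rule exI[of _ M], rule exI[of _ c], rule exI[of _ k]) (rule main)
  then show "mf \<in> FP" unfolding FP_def mf mem_Collect_eq prod.case .
qed

end
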